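(* Let $(Q, N, C_1, C_2, \dots)$ be a nonnegative random vector, with $N \in \{0,1,2,\dots\} \cup \{\infty\}$ and $P(Q > 0) > 0$, and let $R=\bigvee_{k=0}^\infty V_k$ be the solution to $$R \stackrel{\mathcal{D}}{=} \left(\bigvee_{i=1}^N C_i R_i \right) \vee Q$$ constructed on the weighted branching tree (see context). Suppose that there exists $j \geq 1$ with $P(N\ge j,\,C_j>0)>0$ such that the measure $P(\log C_j\in du,\, C_j > 0,\, N\ge j)$ is nonarithmetic, and that for some $\alpha > 0$, $E[Q^\alpha] < \infty$, $0 < E \left[ \sum_{i=1}^N C_i^\alpha \log C_i \right] < \infty$ and $E \left[ \sum_{i=1}^N C_i^\alpha \right] = 1$. In addition, assume 1. $E\left[ \left( \sum_{i=1}^N C_i \right)^\alpha \right] < \infty$, if $\alpha > 1$; or, 2. $E\left[ \left( \sum_{i=1}^N C_i^{\alpha/(1+\epsilon)}\right)^{1+\epsilon} \right] < \infty$ for some $0 < \epsilon< 1$, if $0 < \alpha \leq 1$. Then $$P(R > t) \sim H t^{-\alpha}, \qquad t \to \infty,$$ where $0 \leq H < \infty$ is given by $$H = \frac{1}{E\left[ \sum_{i=1}^N C_i^\alpha \log C_i \right] } \int_{0}^\infty v^{\alpha-1} \left( P(R > v) - E\left[ \sum_{i=1}^{N} 1(C_{i} R > v ) \right] \right) dv = \frac{E\left[ \left( \bigvee_{i=1}^N C_i R_i \right)^\alpha \vee Q^\alpha - \sum_{i=1}^N (C_i R_i )^\alpha \right]}{\alpha E\left[ \sum_{i=1}^N C_i^\alpha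 \log C_i \right] }.$$
   Context: Construction of $R$. Let $U=\bigcup_{k=0}^\infty \{1,2,3,\dots\}^k$ be the set of finite sequences of positive integers, with $\{1,2,\dots\}^0=\{\emptyset\}$; $(\mathbf{i},j)$ denotes concatenation, $(\emptyset,j)=j$. Let $\{(Q_{\mathbf i}, N_{\mathbf i}, C_{(\mathbf i,1)}, C_{(\mathbf i,2)},\dots)\}_{\mathbf i\in U}$ be iid copies of $(Q,N,C_1,C_2,\dots)$, the copy at the root $\emptyset$ being $(Q,N,C_1,C_2,\dots)$ itself. Put $A_0=\{\emptyset\}$ and $A_n=\{(i_1,\dots,i_n)\in U: (i_1,\dots,i_{n-1})\in A_{n-1},\ 1\le i_n\le N_{(i_1,\dots,i_{n-1})}\}$ for $n\ge1$. The weights are $\Pi_\emptyset=1$ and $\Pi_{(i_1,\dots,i_n)}=C_{(i_1,\dots,i_n)}\Pi_{(i_1,\dots,i_{n-1})}$. Define $V_n=\bigvee_{\mathbf i\in A_n}Q_{\mathbf i}\Pi_{\mathbf i}$, $n\ge0$, and $R=\bigvee_{k=0}^\infty V_k$; $R$ satisfies the displayed distributional equation. Here $\vee$ and $\bigvee$ denote maximum (supremum for infinite families; the supremum over an empty family of nonnegative quantities is $0$). In the distributional equation and in the second expression for $H$, $\{R_i\}$ are iid copies of $R$, independent of $(Q,N,C_1,C_2,\dots)$; in the first expression $R$ is taken independent of $(N,C_1,C_2,\dots)$. $1(\cdot)$ is the indicator function; $\stackrel{\mathcal D}{=}$ is equality in distribution. Convention: $0^\alpha\log 0=0$ for $\alpha>0$.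 When $N=\infty$, $\sum_{i=1}^N$ is an infinite series. A measure on $\mathbb{R}$ is nonarithmetic if it is not concentrated on $d\mathbb{Z}$ for any $d>0$. $P(R>t)\sim Ht^{-\alpha}$ means $\lim_{t\to\infty}t^\alpha P(R>t)=H$. *)

theory Defs
  imports "HOL-Probability.Probability"
begin

text \<open>
  The series with terms \<open>f 1, f 2, \<dots>, f n\<close>; an infinite series if \<open>n = \<infinity>\<close>. It is used both
  for extended nonnegative and for real terms.
\<close>
definition series_upto :: "enat \<Rightarrow> (nat \<Rightarrow> 'b) \<Rightarrow> 'b::{comm_monoid_add,topological_space}" where
  "series_upto n f = (\<Sum>i. if enat (Suc i) \<le> n then f (Suc i) else 0)"

lemma series_upto_enat:
  fixes f :: "nat \<Rightarrow> 'b::{comm_monoid_add,t2_space}"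
  shows "series_upto (enat n) f = (\<Sum>i=1..n. f i)"
proof -
  have "series_upto (enat n) f = (\<Sum>i<n. if enat (Suc i) \<le> enat n then f (Suc i) else 0)"
    unfolding series_upto_def by (rule suminf_finite) auto
  also have "\<dots> = (\<Sum>i<n. f (Suc i))"
    by (rule sum.cong) auto
  also have "\<dots> = (\<Sum>i=1..n. f i)"
    by (simp add: sum.shift_bounds_Suc_ivl [symmetric] lessThan_atLeast0 atLeastLessThanSuc_atLeastAtMost)
  finally show ?thesis .
qed

text \<open>Powers with exponent \<open>a > 0\<close>; no other exponents are used.\<close>
definition ennreal_powr :: "ennreal \<Rightarrow> real \<Rightarrow> ennreal" where
  "ennreal_powr x a = (if x = \<infinity> then \<infinity> else ennreal (enn2real x powr a))"

definition nonarithmetic :: "real measure \<Rightarrow> bool" where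
  "nonarithmetic \<mu> \<longleftrightarrow> (\<forall>d>0. \<not> (AE x in \<mu>. x \<in> range (\<lambda>k::int. d * of_int k)))"

text \<open>
  Nodes of the tree are finite sequences of positive integers, and \<open>(\<^bold>i, j)\<close> is \<open>i @ [j]\<close>.
  \<open>C\<close> is indexed by nodes, as in \<open>C\<^bsub>(\<^bold>i, j)\<^esub>\<close>; its value at the root \<open>[]\<close> is never used. The generic
  vector \<open>(Q, N, C\<^sub>1, C\<^sub>2, \<dots>)\<close> is the one at the root: \<open>Q []\<close>, \<open>N []\<close>, \<open>C [1]\<close>, \<open>C [2]\<close>, \<dots>
\<close>
definition nodes :: "nat list set" where
  "nodes = {i. \<forall>j\<in>set i. 1 \<le> j}"

definition generic_vector_space :: "(real \<times> enat \<times> (nat \<Rightarrow> real)) measure" where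
  "generic_vector_space = borel \<Otimes>\<^sub>M count_space UNIV \<Otimes>\<^sub>M (\<Pi>\<^sub>M j\<in>{1..}. borel)"

definition node_vector ::
  "(nat list \<Rightarrow> 'a \<Rightarrow> real) \<Rightarrow> (nat list \<Rightarrow> 'a \<Rightarrow> enat) \<Rightarrow> (nat list \<Rightarrow> 'a \<Rightarrow> real) \<Rightarrow>
     nat list \<Rightarrow> 'a \<Rightarrow> real \<times> enat \<times> (nat \<Rightarrow> real)" where
  "node_vector Q N C i \<omega> = (Q i \<omega>, N i \<omega>, \<lambda>j\<in>{1..}. C (i @ [j]) \<omega>)"

text \<open>Measurability of the node vectors is part of the library's \<open>indep_vars\<close>.\<close>
locale weighted_branching_tree = prob_space M
  for M :: "'a measure" and Q :: "nat list \<Rightarrow> 'a \<Rightarrow> real"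
    and N :: "nat list \<Rightarrow> 'a \<Rightarrow> enat" and C :: "nat list \<Rightarrow> 'a \<Rightarrow> real" +
  assumes Q_nonneg: "i \<in> nodes \<Longrightarrow> \<omega> \<in> space M \<Longrightarrow> 0 \<le> Q i \<omega>"
    and C_nonneg: "i \<in> nodes \<Longrightarrow> 1 \<le> j \<Longrightarrow> \<omega> \<in> space M \<Longrightarrow> 0 \<le> C (i @ [j]) \<omega>"
    and indep: "indep_vars (\<lambda>_. generic_vector_space) (node_vector Q N C) nodes"
    and identically_distributed: "i \<in> nodes \<Longrightarrow>
      distr M generic_vector_space (node_vector Q N C i) = distr M generic_vector_space (node_vector Q N C [])"

primrec generation :: "(nat list \<Rightarrow> 'a \<Rightarrow> enat) \<Rightarrow> nat \<Rightarrow> 'a \<Rightarrow> nat list set" where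
  "generation N 0 \<omega> = {[]}"
| "generation N (Suc n) \<omega> =
     {i @ [j] | i j. i \<in> generation N n \<omega> \<and> 1 \<le> j \<and> enat j \<le> N i \<omega>}"

fun weight :: "(nat list \<Rightarrow> 'a \<Rightarrow> real) \<Rightarrow> nat list \<Rightarrow> 'a \<Rightarrow> real" where
  "weight C i \<omega> = (if i = [] then 1 else C i \<omega> * weight C (butlast i) \<omega>)"

declare weight.simps [simp del]

definition level_max :: "(nat list \<Rightarrow> 'a \<Rightarrow> real) \<Rightarrow> (nat list \<Rightarrow> 'a \<Rightarrow> enat) \<Rightarrow>
    (nat list \<Rightarrow> 'a \<Rightarrow> real) \<Rightarrow> nat \<Rightarrow> 'a \<Rightarrow> ennreal" where
  "level_max Q N C n \<omega> = (SUP i\<in>generation N n \<omega>. ennreal (Q i \<omega> * weight C i \<omega>))"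

text \<open>
  The random variable \<open>R\<close>. A supremum of infinitely many finite quantities need not be finite
  everywhere, so \<open>R\<close> is extended-valued.
\<close>
definition tree_max :: "(nat list \<Rightarrow> 'a \<Rightarrow> real) \<Rightarrow> (nat list \<Rightarrow> 'a \<Rightarrow> enat) \<Rightarrow>
    (nat list \<Rightarrow> 'a \<Rightarrow> real) \<Rightarrow> 'a \<Rightarrow> ennreal" where
  "tree_max Q N C \<omega> = (SUP n. level_max Q N C n \<omega>)"

text \<open>
  \<open>E[\<Sum>\<^sub>i 1(C\<^sub>i R > v)]\<close> with \<open>R\<close> independent of \<open>(N, C\<^sub>1, C\<^sub>2, \<dots>)\<close>: the generic vector lives on the
  first factor of the product space, \<open>R\<close> on the second.
\<close>
definition expected_exceedances :: "'a measure \<Rightarrow> (nat list \<Rightarrow> 'a \<Rightarrow> real) \<Rightarrow>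
    (nat list \<Rightarrow> 'a \<Rightarrow> enat) \<Rightarrow> (nat list \<Rightarrow> 'a \<Rightarrow> real) \<Rightarrow> real \<Rightarrow> ennreal" where
  "expected_exceedances M Q N C v =
     (\<integral>\<^sup>+(\<omega>, \<omega>'). series_upto (N [] \<omega>)
        (\<lambda>i. indicator {ennreal v<..} (ennreal (C [i] \<omega>) * tree_max Q N C \<omega>')) \<partial>(M \<Otimes>\<^sub>M M))"

text \<open>
  The product space carrying the generic vector (first factor) and an independent sequence of iid
  copies of \<open>R\<close>, namely \<open>R\<^sub>i (\<omega>, \<omega>') = R (\<omega>' i)\<close> for \<open>i \<ge> 1\<close>.
\<close>
definition copies_space :: "'a measure \<Rightarrow> ('a \<times> (nat \<Rightarrow> 'a)) measure" where
  "copies_space M = M \<Otimes>\<^sub>M (\<Pi>\<^sub>M i\<in>{1..}. M)"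

definition max_power :: "(nat list \<Rightarrow> 'a \<Rightarrow> real) \<Rightarrow> (nat list \<Rightarrow> 'a \<Rightarrow> enat) \<Rightarrow>
    (nat list \<Rightarrow> 'a \<Rightarrow> real) \<Rightarrow> real \<Rightarrow> 'a \<times> (nat \<Rightarrow> 'a) \<Rightarrow> ennreal" where
  "max_power Q N C \<alpha> = (\<lambda>(\<omega>, \<omega>').
     max (ennreal_powr (SUP i\<in>{i. 1 \<le> i \<and> enat i \<le> N [] \<omega>}.
            ennreal (C [i] \<omega>) * tree_max Q N C (\<omega>' i)) \<alpha>)
         (ennreal (Q [] \<omega> powr \<alpha>)))"

definition sum_power :: "(nat list \<Rightarrow> 'a \<Rightarrow> real) \<Rightarrow> (nat list \<Rightarrow> 'a \<Rightarrow> enat) \<Rightarrow>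
    (nat list \<Rightarrow> 'a \<Rightarrow> real) \<Rightarrow> real \<Rightarrow> 'a \<times> (nat \<Rightarrow> 'a) \<Rightarrow> ennreal" where
  "sum_power Q N C \<alpha> = (\<lambda>(\<omega>, \<omega>').
     series_upto (N [] \<omega>)
       (\<lambda>i. ennreal_powr (ennreal (C [i] \<omega>) * tree_max Q N C (\<omega>' i)) \<alpha>))"

end

theory Submission
  imports Defs
begin

text \<open>
  With \<open>r t = exp (\<alpha> t) P(R > exp t)\<close> the distributional equation becomes a renewal equation \<open>r = g + r * \<nu>\<close>,
  where \<open>\<nu>\<close> is the law of \<open>ln C\<^sub>i\<close> tilted by \<open>C\<^sub>i\<^sup>\<alpha>\<close>; it is a nonarithmetic probability measure
  on the whole line with positive mean \<open>\<mu>\<close> and \<open>\<integral> exp (- \<delta> u) \<nu>(du) = E[\<Sum> C\<^sub>i\<^sup>\<alpha>\<^sup>-\<^sup>\<delta>] < 1\<close> for small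
  \<open>\<delta> > 0\<close>. The last fact also bounds the tail of \<open>R\<close> by \<open>K v\<^sup>-\<^sup>\<beta>\<close> for \<open>\<beta> < \<alpha>\<close> close to \<open>\<alpha>\<close>. As the
  copies of \<open>R\<close> are independent given the weights, the expected number of exceedances differs from the
  probability of at least one by a term of second order, and the moment condition makes \<open>g\<close> integrable.

  The renewal theorem is proved without renewal measures. After smoothing, \<open>r\<close> becomes a function \<open>f\<close>
  for which the integral of \<open>F t - F (t - u)\<close> over \<open>\<nu>(du)\<close>, \<open>F\<close> being an antiderivative of \<open>f\<close>, tends to \<open>\<integral> g\<close>.
  Translates of \<open>f\<close> along a sequence realising the upper limit \<open>L\<close> are asymptotically \<open>\<nu>\<close>-harmonic and
  maximal at \<open>0\<close>, hence nearly constant far to the left, where the conserved quantity reads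
  \<open>L \<mu> = \<integral> g\<close>. The lower limit obeys the same identity.
\<close>

text \<open>Steps take both signs, and \<open>r\<close> is neither continuous nor bounded in
  advance: as E[R^\<alpha>] may be infinite, the tail estimate gives only growth at every small
  exponential rate. So the maximum principle is used three times. Applied to normalised translates
  of an unbounded solution, it would make the mean of \<nu> vanish, which proves boundedness; the
  upper and the lower limit come after that.

  For the same reason the two terms in each formula for the constant can have infinite integrals
  separately. All subtractions are therefore confined to two quantities of finite mean, the surplus
  of exceedances beyond the first and the contribution of the root. Exchanging the integrals over
  threshold and sample leads from one formula to the other.

  Integrability rests on an exponent \<beta> slightly below \<alpha>. With S the sum of the
  C_i^\<beta>, the second-order term is at most the minimum of y and y^2, where y is a multiple of S
  v^(-\<beta>). Against v^(\<alpha> - 1) this converges at both ends because \<beta> < \<alpha> < 2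
  \<beta>, and by scaling the result is a multiple of S^(\<alpha> / \<beta>), whose mean the moment
  condition controls.\<close>

section \<open>Limits of translates and the maximum principle\<close>

text \<open>Two elements \<open>b'\<close> and \<open>b' + w\<close> with a small gap
  \<open>w\<close> suffice: the sums of n of them form a chain of mesh \<open>w\<close> that starts
  at n b', and once n w exceeds b' the chain reaches beyond (n + 1) b'.\<close>

lemma asymptotically_dense_semigroup:
  fixes S :: "real set"
  assumes add: "\<And>x y. x \<in> S \<Longrightarrow> y \<in> S \<Longrightarrow> x + y \<in> S"
    and zero: "0 \<in> S" and p: "p \<in> S" "0 < p"
    and nonarith: "\<And>d. 0 < d \<Longrightarrow> \<not> S \<subseteq> range (\<lambda>k::int. d * of_int k)"
    and "0 < \<eta>"
  obtains x0 where "\<And>x. x0 \<le> x \<Longrightarrow> \<exists>z\<in>S. \<bar>x - z\<bar> \<le> \<eta>"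
proof -
  define G where "G = {a - b | a b. a \<in> S \<and> b \<in> S}"
  have S_G: "S \<subseteq> G" using zero by (force simp: G_def)
  have G_diff: "x - y \<in> G" if "x \<in> G" "y \<in> G" for x y
  proof -
    from that obtain a b c d where "x = a - b" "y = c - d" "a \<in> S" "b \<in> S" "c \<in> S" "d \<in> S"
      by (auto simp: G_def)
    then have "x - y = (a + d) - (b + c)" "a + d \<in> S" "b + c \<in> S" using add by auto
    then show ?thesis unfolding G_def by blast
  qed
  have G_0: "0 \<in> G" using S_G zero by auto
  have G_minus: "- x \<in> G" if "x \<in> G" for x using G_diff[OF G_0 that] by simp
  have G_add: "x + y \<in> G" if "x \<in> G" "y \<in> G" for x y using G_diff[OF that(1) G_minus[OF that(2)]] by simp
  have G_nat: "real n * x \<in> G" if "x \<in> G" for n x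
    by (induction n) (use that G_0 G_add in \<open>auto simp: algebra_simps\<close>)
  have G_int: "of_int k * x \<in> G" if "x \<in> G" for k x
    using G_nat[OF that, of "nat k"] G_minus[OF G_nat[OF that, of "nat (- k)"]]
    by (cases "0 \<le> k") auto
  \<comment> \<open>Otherwise distinct elements of the group \<open>G\<close> are at least \<eta>
    apart, so the infimum \<open>d\<close> of its positive elements is attained, and division with
    remainder puts \<open>S\<close> into the multiples of \<open>d\<close>.\<close>
  have "\<exists>x\<in>G. 0 < x \<and> x < \<eta>"
  proof (rule ccontr)
    assume "\<not> ?thesis"
    then have large: "\<eta> \<le> x" if "x \<in> G" "0 < x" for x using that by force
    define P where "P = {x \<in> G. 0 < x}"
    have P_ne: "P \<noteq> {}" using p S_G by (auto simp: P_def)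
    have bdd: "bdd_below P" by (rule bdd_belowI[of _ 0]) (auto simp: P_def)
    define d where "d = Inf P"
    have d_le: "d \<le> x" if "x \<in> P" for x unfolding d_def by (rule cInf_lower[OF that bdd])
    have "\<eta> \<le> d" unfolding d_def by (rule cInf_greatest[OF P_ne]) (auto simp: P_def large)
    then have "0 < d" using \<open>0 < \<eta>\<close> by simp
    obtain x where x: "x \<in> P" "x < d + \<eta>"
      using cInf_lessD[OF P_ne, of "d + \<eta>"] \<open>0 < \<eta>\<close> by (auto simp: d_def)
    have "x = d"
    proof (rule ccontr)
      assume "x \<noteq> d"
      then obtain y where y: "y \<in> P" "y < x"
        using cInf_lessD[OF P_ne, of x] d_le[OF x(1)] by (auto simp: d_def)
      then have "\<eta> \<le> x - y" using large[of "x - y"] G_diff[of x y] x by (auto simp: P_def)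
      then show False using d_le[OF y(1)] x by simp
    qed
    then have "d \<in> G" using x by (simp add: P_def)
    have "s \<in> range (\<lambda>k::int. d * of_int k)" if "s \<in> S" for s
    proof -
      define q where "q = s - of_int \<lfloor>s / d\<rfloor> * d"
      have "q \<in> G" unfolding q_def using G_diff G_int \<open>d \<in> G\<close> S_G that by blast
      moreover have "0 \<le> q" "q < d" using \<open>0 < d\<close> floor_divide_lower[of d s] floor_divide_upper[of d s]
        by (auto simp: q_def algebra_simps)
      ultimately have "q = 0" using d_le[of q] by (force simp: P_def)
      then have "s = d * of_int \<lfloor>s / d\<rfloor>" by (simp add: q_def mult.commute)
      then show ?thesis by blast
    qed
    then show False using nonarith[OF \<open>0 < d\<close>] by blast
  qed
  then obtain a b where ab: "a \<in> S" "b \<in> S" "0 < a - b" "a - b < \<eta>" by (auto simp: G_def)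
  have S_nat: "real n * x \<in> S" if "x \<in> S" for n x
    by (induction n) (use that zero add in \<open>auto simp: algebra_simps\<close>)
  obtain k where k: "- b < real k * p" using reals_Archimedean3[OF p(2)] by blast
  \<comment> \<open>\<open>S\<close> may contain negative numbers. Adding the same multiple of
    \<open>p\<close> to both elements makes the smaller one positive and keeps the gap.\<close>
  define b' where "b' = b + real k * p"
  define w where "w = a - b"
  have b': "b' \<in> S" "0 < b'" using add[OF ab(2) S_nat[OF p(1)]] k by (auto simp: b'_def)
  have a': "b' + w \<in> S" using add[OF ab(1) S_nat[OF p(1), of k]] by (simp add: b'_def w_def algebra_simps)
  have w: "0 < w" "w < \<eta>" using ab by (auto simp: w_def)
  \<comment> \<open>The threshold makes the quotient n exceed b' / w, hence m \<le> n, and n b' + m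
    w is a sum of m elements \<open>b' + w\<close> and n - m elements \<open>b'\<close>.\<close>
  have "\<exists>z\<in>S. \<bar>x - z\<bar> \<le> \<eta>" if x: "b' * (b' / w + 1) \<le> x" for x
  proof -
    have "0 < x" using x b' w by (smt (verit) divide_pos_pos mult_pos_pos)
    define n where "n = nat \<lfloor>x / b'\<rfloor>"
    have n: "real n * b' \<le> x" "x < (real n + 1) * b'"
      using floor_divide_lower[OF b'(2), of x] floor_divide_upper[OF b'(2), of x] \<open>0 < x\<close> b'
      by (auto simp: n_def)
    define y where "y = x - real n * b'"
    have y: "0 \<le> y" "y < b'" using n by (auto simp: y_def algebra_simps)
    define m where "m = nat \<lfloor>y / w\<rfloor>"
    have m: "real m * w \<le> y" "y < (real m + 1) * w"
      using floor_divide_lower[OF w(1), of y] floor_divide_upper[OF w(1), of y] y w by (auto simp: m_def)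
    have "b' * (b' / w + 1) < (real n + 1) * b'" using x n by simp
    then have "b' / w < real n" using b' by (simp add: mult.commute)
    moreover have "real m \<le> y / w" using m w by (simp add: field_simps)
    moreover have "y / w < b' / w" using y w by (simp add: divide_strict_right_mono)
    ultimately have "m \<le> n" by simp
    have "real m * (b' + w) + real (n - m) * b' \<in> S" using add S_nat a' b' by blast
    also have "real m * (b' + w) + real (n - m) * b' = real n * b' + real m * w"
      using \<open>m \<le> n\<close> by (simp add: of_nat_diff algebra_simps)
    finally have "real n * b' + real m * w \<in> S" .
    moreover have "\<bar>x - (real n * b' + real m * w)\<bar> \<le> \<eta>" using m w by (simp add: y_def algebra_simps)
    ultimately show ?thesis by blast
  qed
  then show ?thesis using that by blast
qed

text \<open>A point outside the support lies in an interval of measure 0 with rational endpoints,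
  and there are only countably many of these.\<close>

lemma AE_in_support:
  fixes \<nu> :: "real measure"
  assumes [measurable_cong]: "sets \<nu> = sets borel"
  shows "AE u in \<nu>. \<forall>\<theta>>0. emeasure \<nu> {u - \<theta><..<u + \<theta>} \<noteq> 0"
proof -
  define J where "J = {(a, b) \<in> \<rat> \<times> \<rat>. emeasure \<nu> {a<..<b::real} = 0}"
  have "countable J" unfolding J_def by (rule countable_subset[of _ "\<rat> \<times> \<rat>"]) (auto simp: countable_rat)
  have "{a<..<b} \<in> null_sets \<nu>" if "(a, b) \<in> J" for a b
    using that assms by (auto simp: J_def null_sets_def)
  then have null: "(\<Union>(a, b)\<in>J. {a<..<b}) \<in> null_sets \<nu>"
    using \<open>countable J\<close> by (intro null_sets_UN') auto
  show ?thesis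
  proof (rule AE_I'[OF null], rule subsetI)
    fix u assume "u \<in> {u \<in> space \<nu>. \<not> (\<forall>\<theta>>0. emeasure \<nu> {u - \<theta><..<u + \<theta>} \<noteq> 0)}"
    then obtain \<theta> where "0 < \<theta>" and 0: "emeasure \<nu> {u - \<theta><..<u + \<theta>} = 0" by blast
    obtain a where a: "a \<in> \<rat>" "u - \<theta> < a" "a < u" using Rats_dense_in_real[of "u - \<theta>" u] \<open>0 < \<theta>\<close> by auto
    obtain b where b: "b \<in> \<rat>" "u < b" "b < u + \<theta>" using Rats_dense_in_real[of u "u + \<theta>"] \<open>0 < \<theta>\<close> by auto
    have "emeasure \<nu> {a<..<b} \<le> emeasure \<nu> {u - \<theta><..<u + \<theta>}"
      by (rule emeasure_mono) (use a b assms in auto)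
    then have "(a, b) \<in> J" using 0 a b by (simp add: J_def)
    then show "u \<in> (\<Union>(a, b)\<in>J. {a<..<b})" using a b by (subst UN_iff, intro bexI[of _ "(a, b)"]) auto
  qed
qed

lemma integrable_dominated:
  fixes f g :: "'a \<Rightarrow> real"
  assumes "integrable M g" "f \<in> borel_measurable M" "\<And>x. x \<in> space M \<Longrightarrow> \<bar>f x\<bar> \<le> g x"
  shows "integrable M f"
  by (rule Bochner_Integration.integrable_bound[OF assms(1,2)])
    (intro AE_I2, metis assms(3) abs_ge_self order_trans real_norm_def)

text \<open>
  The points \<open>x\<close> at which \<open>h\<^sub>n (- x)\<close> approaches its maximal limit \<open>L\<close> are stable under adding points of
  the support of \<open>\<nu>\<close>: an average close to the maximum is an average of values close to the maximum.
  The generated semigroup fills a neighbourhood of \<open>+\<infinity>\<close> with arbitrarily small gaps, so that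
  \<open>h\<^sub>n\<close> is nearly constant far to the left, and there the conservation law reads \<open>L \<mu> = c\<close>.
\<close>
lemma maximum_principle_limit:
  fixes \<nu> :: "real measure" and h H :: "nat \<Rightarrow> real \<Rightarrow> real"
  assumes "prob_space \<nu>" and sets_nu[measurable_cong]: "sets \<nu> = sets borel"
    and nonarith: "\<And>d. 0 < d \<Longrightarrow> \<not> (AE x in \<nu>. x \<in> range (\<lambda>k::int. d * of_int k))"
    and int_id: "integrable \<nu> (\<lambda>u. u)" and mean_pos: "0 < (\<integral>u. u \<partial>\<nu>)"
    and int_exp: "integrable \<nu> (\<lambda>u. exp (- d * u))"
    and int_id_exp: "integrable \<nu> (\<lambda>u. \<bar>u\<bar> * exp (- d * u))"
    and "0 \<le> d"
    and bound: "\<And>n s. \<bar>h n s\<bar> \<le> D * (1 + exp (d * s))"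
    and equicont: "\<And>\<eta>. 0 < \<eta> \<Longrightarrow> \<exists>\<theta>>0. \<forall>s. \<forall>\<^sub>F n in sequentially. \<forall>s'. \<bar>s' - s\<bar> < \<theta> \<longrightarrow> \<bar>h n s' - h n s\<bar> \<le> \<eta>"
    and renewal: "\<And>s. (\<lambda>n. h n s - (\<integral>u. h n (s - u) \<partial>\<nu>)) \<longlonglongrightarrow> 0"
    and upper: "\<And>s \<eta>. 0 < \<eta> \<Longrightarrow> \<forall>\<^sub>F n in sequentially. h n s \<le> L + \<eta>"
    and lower: "\<And>s. \<forall>\<^sub>F n in sequentially. - B \<le> h n s"
    and at_0: "(\<lambda>n. h n 0) \<longlonglongrightarrow> L"
    and deriv: "\<And>n s. (H n has_real_derivative h n s) (at s)"
    and conserved: "\<And>x. (\<lambda>n. \<integral>u. H n x - H n (x - u) \<partial>\<nu>) \<longlonglongrightarrow> c"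
    and meas[measurable]: "\<And>n. h n \<in> borel_measurable borel"
  shows "L * (\<integral>u. u \<partial>\<nu>) = c"
proof -
  interpret prob_space \<nu> by fact
  have [measurable]: "H n \<in> borel_measurable borel" for n
    using deriv by (intro borel_measurable_continuous_onI continuous_at_imp_continuous_on ballI)
      (blast intro: DERIV_isCont)
  have "0 \<le> D"
    using bound[of 0 0] by (smt (verit) abs_ge_zero exp_gt_zero zero_le_mult_iff)
  define supp where "supp = {u. \<forall>\<theta>>0. emeasure \<nu> {u - \<theta><..<u + \<theta>} \<noteq> 0}"
  have AE_supp: "AE u in \<nu>. u \<in> supp"
    using AE_in_support[OF sets_nu] by (simp add: supp_def)
  \<comment> \<open>The sign makes a step u from the support act as addition of u.\<close>
  define S where "S = {x. (\<lambda>n. h n (- x)) \<longlonglongrightarrow> L}"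
  have dom: "\<bar>h n (x - u)\<bar> \<le> D * (1 + exp (d * x) * exp (- d * u))" for n x u
    using bound[of n "x - u"] by (simp add: exp_add[symmetric] algebra_simps)
  have int_dom: "integrable \<nu> (\<lambda>u. D * (1 + exp (d * x) * exp (- d * u)))" for x
    using int_exp by simp
  have int_h: "integrable \<nu> (\<lambda>u. h n (x - u))" for n x
    by (rule integrable_dominated[OF int_dom[of x]]) (use dom in auto)
  have S_step: "x + u0 \<in> S" if "x \<in> S" "u0 \<in> supp" for x u0
  proof -
    have 1: "(\<lambda>n. \<integral>u. h n (- x - u) \<partial>\<nu>) \<longlonglongrightarrow> L"
    proof -
      have "(\<lambda>n. h n (- x) - (h n (- x) - (\<integral>u. h n (- x - u) \<partial>\<nu>))) \<longlonglongrightarrow> L - 0"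
        using that renewal[of "- x"] by (intro tendsto_diff) (auto simp: S_def)
      then show ?thesis by simp
    qed
    \<comment> \<open>The averages of h_n (- x - u) tend to L, and the part above L vanishes in mean
      by \<open>upper\<close>. Since |y - L| = (L - y) + 2 max 0 (y - L), this is convergence in
      mean.\<close>
    define b where "b n u = max 0 (h n (- x - u) - L)" for n u
    have b_meas[measurable]: "b n \<in> borel_measurable borel" for n unfolding b_def by simp
    have b_bound: "\<bar>b n u\<bar> \<le> D * (1 + exp (d * (- x)) * exp (- d * u)) + \<bar>L\<bar>" for n u
      using dom[of n "- x" u] by (auto simp: b_def)
    have int_b_dom: "integrable \<nu> (\<lambda>u. D * (1 + exp (d * (- x)) * exp (- d * u)) + \<bar>L\<bar>)"
      using int_dom[of "- x"] by simp
    have int_b: "integrable \<nu> (b n)" for n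
      by (rule integrable_dominated[OF int_b_dom]) (use b_bound in auto)
    have "(\<lambda>n. \<integral>u. b n u \<partial>\<nu>) \<longlonglongrightarrow> (\<integral>u. 0 \<partial>\<nu>)"
    proof (rule integral_dominated_convergence[OF _ _ int_b_dom])
      show "AE u in \<nu>. (\<lambda>n. b n u) \<longlonglongrightarrow> 0"
      proof (rule AE_I2, rule tendstoI)
        fix u and e :: real assume "0 < e"
        have "\<forall>\<^sub>F n in sequentially. h n (- x - u) \<le> L + e / 2" using upper \<open>0 < e\<close> by simp
        then show "\<forall>\<^sub>F n in sequentially. dist (b n u) 0 < e"
          by eventually_elim (use \<open>0 < e\<close> in \<open>auto simp: b_def dist_real_def\<close>)
      qed
    qed (use b_bound in auto)
    then have b_lim: "(\<lambda>n. \<integral>u. b n u \<partial>\<nu>) \<longlonglongrightarrow> 0" by simp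
    have abs_eq: "(\<integral>u. \<bar>h n (- x - u) - L\<bar> \<partial>\<nu>) = L - (\<integral>u. h n (- x - u) \<partial>\<nu>) + 2 * (\<integral>u. b n u \<partial>\<nu>)" for n
    proof -
      have "(\<integral>u. \<bar>h n (- x - u) - L\<bar> \<partial>\<nu>) = (\<integral>u. L - h n (- x - u) + 2 * b n u \<partial>\<nu>)"
        by (rule Bochner_Integration.integral_cong) (auto simp: b_def max_def)
      also have "\<dots> = L - (\<integral>u. h n (- x - u) \<partial>\<nu>) + 2 * (\<integral>u. b n u \<partial>\<nu>)"
        using int_h[of n "- x"] int_b[of n] by (simp add: prob_space)
      finally show ?thesis .
    qed
    have L1: "(\<lambda>n. \<integral>u. \<bar>h n (- x - u) - L\<bar> \<partial>\<nu>) \<longlonglongrightarrow> 0"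
      unfolding abs_eq using tendsto_add[OF tendsto_diff[OF tendsto_const[of L] 1] tendsto_mult_left[OF b_lim, of 2]]
      by simp
    have "(\<lambda>n. h n (- (x + u0))) \<longlonglongrightarrow> L"
    proof (rule tendstoI)
      fix e :: real assume "0 < e"
      then have "0 < e / 3" by simp
      from equicont[OF this] obtain \<theta> where \<theta>: "0 < \<theta>"
        and ev: "\<And>s. \<forall>\<^sub>F n in sequentially. \<forall>s'. \<bar>s' - s\<bar> < \<theta> \<longrightarrow> \<bar>h n s' - h n s\<bar> \<le> e / 3" by blast
      \<comment> \<open>By equicontinuity a deviation of size e at - (x + u0) leaves one of at least
        e / 3 for every u in \<open>I\<close>. As \<open>I\<close> has positive mass, this
        contradicts convergence in mean.\<close>
      define I where "I = {u0 - \<theta><..<u0 + \<theta>}"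
      have "0 < measure \<nu> I" using that \<theta> unfolding zero_less_measure_iff by (simp add: supp_def I_def emeasure_eq_measure)
      then have "\<forall>\<^sub>F n in sequentially. (\<integral>u. \<bar>h n (- x - u) - L\<bar> \<partial>\<nu>) < e / 3 * measure \<nu> I"
        using order_tendstoD(2)[OF L1, of "e / 3 * measure \<nu> I"] \<open>0 < e\<close> by simp
      then show "\<forall>\<^sub>F n in sequentially. dist (h n (- (x + u0))) L < e"
        using ev[of "- (x + u0)"]
      proof eventually_elim
        case (elim n)
        show ?case
        proof (rule ccontr)
          assume "\<not> ?case"
          then have far: "e \<le> \<bar>h n (- (x + u0)) - L\<bar>" by (simp add: dist_real_def)
          have "e / 3 * indicator I u \<le> \<bar>h n (- x - u) - L\<bar>" for u
          proof (cases "u \<in> I")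
            case True
            then have "\<bar>h n (- x - u) - h n (- (x + u0))\<bar> \<le> e / 3"
              using elim(2)[rule_format, of "- x - u"] by (auto simp: I_def abs_less_iff)
            then show ?thesis using far True \<open>0 < e\<close> by (simp add: abs_if split: if_splits)
          qed auto
          then have "(\<integral>u. e / 3 * indicator I u \<partial>\<nu>) \<le> (\<integral>u. \<bar>h n (- x - u) - L\<bar> \<partial>\<nu>)"
            using int_h[of n "- x"] by (intro integral_mono) (auto simp: I_def emeasure_eq_measure)
          also have "(\<integral>u. e / 3 * indicator I u \<partial>\<nu>) = e / 3 * measure \<nu> I"
            by (simp add: I_def sets_nu)
          finally show False using elim(1) by simp
        qed
      qed
    qed
    then show ?thesis by (simp add: S_def)
  qed
  define T where "T = {x. \<forall>y\<in>S. y + x \<in> S}"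
  have "0 \<in> S" using at_0 by (simp add: S_def)
  have T_S: "T \<subseteq> S"
  proof
    fix x assume "x \<in> T"
    then have "0 + x \<in> S" using \<open>0 \<in> S\<close> unfolding T_def by blast
    then show "x \<in> S" by simp
  qed
  have supp_T: "supp \<subseteq> T" using S_step by (auto simp: T_def)
  have T_add: "x + y \<in> T" if "x \<in> T" "y \<in> T" for x y
    using that by (auto simp: T_def add.assoc[symmetric])
  have T_0: "0 \<in> T" by (simp add: T_def)
  have T_nonarith: "\<not> T \<subseteq> range (\<lambda>k::int. e * of_int k)" if "0 < e" for e
    using nonarith[OF that] AE_supp supp_T by (metis (mono_tags, lifting) AE_mp AE_I2 subsetD)
  obtain p where p: "p \<in> T" "0 < p"
  proof -
    have "\<exists>u\<in>supp. 0 < u"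
    proof (rule ccontr)
      assume "\<not> ?thesis"
      then have "AE u in \<nu>. u \<le> 0" using AE_supp by (auto elim!: eventually_mono)
      then have "(\<integral>u. u \<partial>\<nu>) \<le> (\<integral>u. 0 \<partial>\<nu>)" using int_id by (intro integral_mono_AE) auto
      then show False using mean_pos by simp
    qed
    then show ?thesis using that supp_T by blast
  qed
  define B' where "B' = \<bar>B\<bar> + \<bar>L\<bar> + 2"
  \<comment> \<open>A step u > - m keeps the segment between x and x - u to the left of - x0, where
    h_n is within 2 \<eta> of L. A step u \<le> - m may leave this region, and only the crude bound
    B' remains.\<close>
  have near: "\<bar>c - L * (\<integral>u. u \<partial>\<nu>)\<bar> \<le> (\<integral>u. \<bar>u\<bar> * (2 * \<eta>) + \<bar>u\<bar> * B' * indicator {..-m} u \<partial>\<nu>)"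
    if \<eta>: "0 < \<eta>" "\<eta> \<le> 1" for \<eta> m
  proof -
    from equicont[OF \<eta>(1)] obtain \<theta> where \<theta>: "0 < \<theta>"
      and ev: "\<And>s. \<forall>\<^sub>F n in sequentially. \<forall>s'. \<bar>s' - s\<bar> < \<theta> \<longrightarrow> \<bar>h n s' - h n s\<bar> \<le> \<eta>" by blast
    obtain x0 where x0: "\<And>x. x0 \<le> x \<Longrightarrow> \<exists>z\<in>T. \<bar>x - z\<bar> \<le> \<theta> / 2"
      using asymptotically_dense_semigroup[of T p "\<theta> / 2"] T_add T_0 p T_nonarith \<theta> by auto
    have pt: "\<forall>\<^sub>F n in sequentially. \<forall>s'. \<bar>s' - s\<bar> \<le> \<theta> / 4 \<longrightarrow> \<bar>h n s' - L\<bar> \<le> 2 * \<eta>" if s: "s \<le> - x0" for s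
    proof -
      have "x0 \<le> - s" using s by simp
      then obtain z where z: "z \<in> T" "\<bar>- s - z\<bar> \<le> \<theta> / 2" using x0 by blast
      then have "(\<lambda>n. h n (- z)) \<longlonglongrightarrow> L" using T_S by (auto simp: S_def)
      from tendstoD[OF this \<eta>(1)] have "\<forall>\<^sub>F n in sequentially. \<bar>h n (- z) - L\<bar> < \<eta>" by (simp add: dist_real_def)
      then show ?thesis using ev[of "- z"]
      proof eventually_elim
        case (elim n)
        show ?case
        proof safe
          fix s' assume "\<bar>s' - s\<bar> \<le> \<theta> / 4"
          then have "\<bar>s' - (- z)\<bar> < \<theta>" using z(2) \<theta> by arith
          then have "\<bar>h n s' - h n (- z)\<bar> \<le> \<eta>" using elim by simp
          then show "\<bar>h n s' - L\<bar> \<le> 2 * \<eta>" using elim by simp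
        qed
      qed
    qed
    have pt': "\<forall>\<^sub>F n in sequentially. \<forall>s'. \<bar>s' - s\<bar> \<le> \<theta> / 4 \<longrightarrow> \<bar>h n s' - L\<bar> \<le> B'" for s
      using ev[of s] upper[OF \<eta>(1), of s] lower[of s]
    proof eventually_elim
      case (elim n)
      show ?case
      proof safe
        fix s' assume "\<bar>s' - s\<bar> \<le> \<theta> / 4"
        then have "\<bar>h n s' - h n s\<bar> \<le> \<eta>" using elim \<theta> by simp
        then show "\<bar>h n s' - L\<bar> \<le> B'" using elim \<eta> by (auto simp: B'_def abs_if split: if_splits)
      qed
    qed
    \<comment> \<open>Eventual bounds on small balls give one eventual bound on a compact interval
      by a finite subcover.\<close>
    have cover: "\<forall>\<^sub>F n in sequentially. \<forall>s\<in>{a..b}. \<bar>h n s - L\<bar> \<le> E"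
      if *: "\<And>s. a \<le> s \<Longrightarrow> s \<le> b \<Longrightarrow> \<forall>\<^sub>F n in sequentially. \<forall>s'. \<bar>s' - s\<bar> \<le> \<theta> / 4 \<longrightarrow> \<bar>h n s' - L\<bar> \<le> E" for a b E
    proof -
      have "{a..b} \<subseteq> (\<Union>s\<in>{a..b}. ball s (\<theta> / 4))" using \<theta> by force
      then obtain K where K: "K \<subseteq> {a..b}" "finite K" "{a..b} \<subseteq> (\<Union>s\<in>K. ball s (\<theta> / 4))"
        using compactE_image[OF compact_Icc, of "{a..b}" "\<lambda>s. ball s (\<theta> / 4)" a b] by auto
      have "\<forall>\<^sub>F n in sequentially. \<forall>s\<in>K. \<forall>s'. \<bar>s' - s\<bar> \<le> \<theta> / 4 \<longrightarrow> \<bar>h n s' - L\<bar> \<le> E"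
        using K * by (intro eventually_ball_finite) auto
      then show ?thesis
      proof eventually_elim
        case (elim n)
        show ?case
        proof
          fix s assume "s \<in> {a..b}"
          then obtain s0 where "s0 \<in> K" "dist s0 s < \<theta> / 4" using K by auto
          then show "\<bar>h n s - L\<bar> \<le> E" using elim by (auto simp: dist_real_def abs_minus_commute)
        qed
      qed
    qed
    define x where "x = - x0 - \<bar>m\<bar>"
    \<comment> \<open>The increment of H_n compared with that of a function of slope L. Its integral
      tends to c minus L times the mean.\<close>
    define a where "a n u = H n x - H n (x - u) - L * u" for n u
    define w where "w u = \<bar>u\<bar> * (2 * \<eta>) + \<bar>u\<bar> * B' * indicator {..-m} u" for u
    have mvt: "\<bar>a n u\<bar> \<le> \<bar>u\<bar> * E" if "\<forall>s\<in>{min x (x - u)..max x (x - u)}. \<bar>h n s - L\<bar> \<le> E" for n u E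
    proof -
      define k where "k s = H n s - L * s" for s
      have dk: "(k has_real_derivative h n s - L) (at s)" for s
        unfolding k_def by (auto intro!: derivative_eq_intros deriv)
      have "\<bar>k x - k (x - u)\<bar> \<le> E * \<bar>x - (x - u)\<bar>"
      proof (cases "u = 0")
        case False
        have "\<exists>z. min x (x - u) < z \<and> z < max x (x - u) \<and>
            k (max x (x - u)) - k (min x (x - u)) = (max x (x - u) - min x (x - u)) * (h n z - L)"
          using False by (intro MVT2 dk) auto
        then obtain z where z: "min x (x - u) < z" "z < max x (x - u)"
          "k (max x (x - u)) - k (min x (x - u)) = (max x (x - u) - min x (x - u)) * (h n z - L)" by blast
        have "\<bar>k x - k (x - u)\<bar> = \<bar>k (max x (x - u)) - k (min x (x - u))\<bar>" by (auto simp: max_def min_def)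
        also have "\<dots> = \<bar>u\<bar> * \<bar>h n z - L\<bar>" unfolding z(3) by (auto simp: abs_mult max_def min_def)
        also have "\<dots> \<le> \<bar>u\<bar> * E" using that z by (intro mult_left_mono) auto
        finally show ?thesis by (simp add: mult.commute)
      qed auto
      then show ?thesis by (simp add: a_def k_def algebra_simps)
    qed
    have ev_w: "\<forall>\<^sub>F n in sequentially. \<bar>a n u\<bar> \<le> w u" for u
    proof (cases "u \<le> - m")
      case True
      have "\<forall>\<^sub>F n in sequentially. \<forall>s\<in>{min x (x - u)..max x (x - u)}. \<bar>h n s - L\<bar> \<le> B'"
        by (rule cover) (rule pt')
      then show ?thesis
      proof eventually_elim
        case (elim n)
        from mvt[OF this] show ?case using True \<eta> by (simp add: w_def add_increasing)
      qed
    next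
      case False
      have "\<forall>\<^sub>F n in sequentially. \<forall>s\<in>{min x (x - u)..max x (x - u)}. \<bar>h n s - L\<bar> \<le> 2 * \<eta>"
        by (rule cover, rule pt) (use False in \<open>auto simp: x_def max_def split: if_splits\<close>)
      then show ?thesis
      proof eventually_elim
        case (elim n)
        from mvt[OF this] show ?case using False by (simp add: w_def)
      qed
    qed
    have int_w: "integrable \<nu> w"
    proof -
      have "integrable \<nu> (\<lambda>u. \<bar>u\<bar> * B' * indicator {..-m} u)"
      proof (rule integrable_dominated)
        show "integrable \<nu> (\<lambda>u. \<bar>u\<bar> * B')" using int_id by (intro integrable_mult_left) simp
      qed (auto simp: indicator_def B'_def)
      then show ?thesis unfolding w_def using int_id
        by (intro Bochner_Integration.integrable_add integrable_mult_left) simp_all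
    qed
    have a_dom: "\<bar>a n u\<bar> \<le> \<bar>u\<bar> * (D * (1 + exp (d * x) + exp (d * x) * exp (- d * u)) + \<bar>L\<bar>)" for n u
    proof (rule mvt, safe)
      fix s assume s: "s \<in> {min x (x - u)..max x (x - u)}"
      have "exp (d * s) \<le> exp (d * x) + exp (d * x) * exp (- d * u)"
      proof (cases "s \<le> x")
        case True
        then have "exp (d * s) \<le> exp (d * x)" using \<open>0 \<le> d\<close> by (simp add: mult_left_mono)
        then show ?thesis by (simp add: add_increasing2)
      next
        case False
        then have "exp (d * s) \<le> exp (d * (x - u))" using s \<open>0 \<le> d\<close> by (auto simp: mult_left_mono)
        also have "\<dots> = exp (d * x) * exp (- d * u)" by (simp add: exp_add[symmetric] algebra_simps)
        finally show ?thesis by (smt (verit) exp_gt_zero)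
      qed
      then have "D * (1 + exp (d * s)) \<le> D * (1 + exp (d * x) + exp (d * x) * exp (- d * u))"
        using \<open>0 \<le> D\<close> by (intro mult_left_mono) auto
      then show "\<bar>h n s - L\<bar> \<le> D * (1 + exp (d * x) + exp (d * x) * exp (- d * u)) + \<bar>L\<bar>"
        using bound[of n s] by simp
    qed
    have int_a_dom: "integrable \<nu> (\<lambda>u. \<bar>u\<bar> * (D * (1 + exp (d * x) + exp (d * x) * exp (- d * u)) + \<bar>L\<bar>))"
    proof -
      have "integrable \<nu> (\<lambda>u. (D * (1 + exp (d * x)) + \<bar>L\<bar>) * \<bar>u\<bar> + D * exp (d * x) * (\<bar>u\<bar> * exp (- d * u)))"
        using int_id int_id_exp by (intro Bochner_Integration.integrable_add integrable_mult_right) auto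
      then show ?thesis by (simp add: algebra_simps)
    qed
    have a_meas[measurable]: "a n \<in> borel_measurable borel" for n unfolding a_def by simp
    have int_a: "integrable \<nu> (a n)" for n
      by (rule integrable_dominated[OF int_a_dom]) (use a_dom in auto)
    \<comment> \<open>The bound by \<open>w\<close> holds only from an index on that depends on u.
      The overshoot is dominated and eventually 0 at each u, so its integral disappears in the
      limit.\<close>
    define b where "b n u = max 0 (\<bar>a n u\<bar> - w u)" for n u
    have w_nonneg: "0 \<le> w u" for u using \<eta> by (auto simp: w_def B'_def indicator_def)
    have w_meas[measurable]: "w \<in> borel_measurable borel" unfolding w_def by simp
    have b_bound: "\<bar>b n u\<bar> \<le> \<bar>u\<bar> * (D * (1 + exp (d * x) + exp (d * x) * exp (- d * u)) + \<bar>L\<bar>)" for n u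
      using a_dom[of n u] w_nonneg[of u] by (simp add: b_def)
    have b_meas[measurable]: "b n \<in> borel_measurable borel" for n unfolding b_def by simp
    have int_b: "integrable \<nu> (b n)" for n
      by (rule integrable_dominated[OF int_a_dom]) (use b_bound in auto)
    have "(\<lambda>n. \<integral>u. b n u \<partial>\<nu>) \<longlonglongrightarrow> (\<integral>u. 0 \<partial>\<nu>)"
    proof (rule integral_dominated_convergence[OF _ _ int_a_dom])
      show "AE u in \<nu>. (\<lambda>n. b n u) \<longlonglongrightarrow> 0"
      proof (rule AE_I2)
        fix u
        have "\<forall>\<^sub>F n in sequentially. b n u = 0" using ev_w[of u] by eventually_elim (simp add: b_def)
        then show "(\<lambda>n. b n u) \<longlonglongrightarrow> 0" by (rule tendsto_eventually)
      qed
    qed (use b_bound in auto)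
    then have b_lim: "(\<lambda>n. \<integral>u. b n u \<partial>\<nu>) \<longlonglongrightarrow> 0" by simp
    have ia: "(\<integral>u. a n u \<partial>\<nu>) = (\<integral>u. H n x - H n (x - u) \<partial>\<nu>) - L * (\<integral>u. u \<partial>\<nu>)" for n
    proof -
      have "integrable \<nu> (\<lambda>u. a n u + L * u)" using int_a int_id by simp
      then have "integrable \<nu> (\<lambda>u. H n x - H n (x - u))" by (simp add: a_def)
      then show ?thesis unfolding a_def using int_id by simp
    qed
    have "(\<lambda>n. \<bar>\<integral>u. a n u \<partial>\<nu>\<bar>) \<longlonglongrightarrow> \<bar>c - L * (\<integral>u. u \<partial>\<nu>)\<bar>"
      unfolding ia by (intro tendsto_intros conserved)
    moreover have "(\<lambda>n. (\<integral>u. w u \<partial>\<nu>) + (\<integral>u. b n u \<partial>\<nu>)) \<longlonglongrightarrow> (\<integral>u. w u \<partial>\<nu>) + 0"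
      by (intro tendsto_intros b_lim)
    moreover have "\<bar>\<integral>u. a n u \<partial>\<nu>\<bar> \<le> (\<integral>u. w u \<partial>\<nu>) + (\<integral>u. b n u \<partial>\<nu>)" for n
    proof -
      have "\<bar>\<integral>u. a n u \<partial>\<nu>\<bar> \<le> (\<integral>u. \<bar>a n u\<bar> \<partial>\<nu>)" by (rule integral_abs_bound)
      also have "\<dots> \<le> (\<integral>u. w u + b n u \<partial>\<nu>)"
        using int_a int_w int_b by (intro integral_mono) (auto simp: b_def)
      also have "\<dots> = (\<integral>u. w u \<partial>\<nu>) + (\<integral>u. b n u \<partial>\<nu>)" using int_w int_b by simp
      finally show ?thesis .
    qed
    ultimately have "\<bar>c - L * (\<integral>u. u \<partial>\<nu>)\<bar> \<le> (\<integral>u. w u \<partial>\<nu>) + 0"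
      using LIMSEQ_le by blast
    then show ?thesis by (simp add: w_def)
  qed
  \<comment> \<open>Accuracy \<eta> = 1 / (n + 1) and cutoff m = n are sent to their limits
    together.\<close>
  have "(\<lambda>n. \<integral>u. \<bar>u\<bar> * (2 * (1 / real (Suc n))) + \<bar>u\<bar> * B' * indicator {..- real n} u \<partial>\<nu>) \<longlonglongrightarrow> (\<integral>u. 0 \<partial>\<nu>)"
  proof (rule integral_dominated_convergence)
    show "integrable \<nu> (\<lambda>u. \<bar>u\<bar> * 2 + \<bar>u\<bar> * B')" using int_id by simp
    show "AE u in \<nu>. (\<lambda>n. \<bar>u\<bar> * (2 * (1 / real (Suc n))) + \<bar>u\<bar> * B' * indicator {..- real n} u) \<longlonglongrightarrow> 0"
    proof (rule AE_I2)
      fix u :: real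
      have "(\<lambda>n. \<bar>u\<bar> * (2 * (1 / real (Suc n)))) \<longlonglongrightarrow> \<bar>u\<bar> * (2 * 0)"
        by (intro tendsto_intros LIMSEQ_Suc lim_1_over_n)
      moreover have "\<forall>\<^sub>F n in sequentially. \<bar>u\<bar> * B' * indicator {..- real n} u = 0"
        using eventually_gt_at_top[of "nat \<lceil>\<bar>u\<bar>\<rceil>"]
        by eventually_elim (auto simp: indicator_def, linarith)
      then have "(\<lambda>n. \<bar>u\<bar> * B' * indicator {..- real n} u) \<longlonglongrightarrow> 0" by (rule tendsto_eventually)
      ultimately show "(\<lambda>n. \<bar>u\<bar> * (2 * (1 / real (Suc n))) + \<bar>u\<bar> * B' * indicator {..- real n} u) \<longlonglongrightarrow> 0"
        using tendsto_add by fastforce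
    qed
    show "AE u in \<nu>. norm (\<bar>u\<bar> * (2 * (1 / real (Suc n))) + \<bar>u\<bar> * B' * indicator {..- real n} u)
        \<le> \<bar>u\<bar> * 2 + \<bar>u\<bar> * B'" for n
    proof (rule AE_I2)
      fix u :: real
      have "\<bar>u\<bar> * (2 * (1 / real (Suc n))) \<le> \<bar>u\<bar> * 2" by (intro mult_left_mono) (auto simp: field_simps)
      moreover have "\<bar>u\<bar> * B' * indicator {..- real n} u \<le> \<bar>u\<bar> * B'" by (auto simp: indicator_def B'_def)
      moreover have "0 \<le> \<bar>u\<bar> * B' * indicator {..- real n} u" by (auto simp: indicator_def B'_def)
      ultimately show "norm (\<bar>u\<bar> * (2 * (1 / real (Suc n))) + \<bar>u\<bar> * B' * indicator {..- real n} u)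
        \<le> \<bar>u\<bar> * 2 + \<bar>u\<bar> * B'" by simp
    qed
  qed auto
  then have "(\<lambda>n. \<integral>u. \<bar>u\<bar> * (2 * (1 / real (Suc n))) + \<bar>u\<bar> * B' * indicator {..- real n} u \<partial>\<nu>) \<longlonglongrightarrow> 0"
    by simp
  then have "\<bar>c - L * (\<integral>u. u \<partial>\<nu>)\<bar> \<le> 0"
  proof (rule LIMSEQ_le_const, intro exI allI impI)
    fix n :: nat
    show "\<bar>c - L * (\<integral>u. u \<partial>\<nu>)\<bar>
        \<le> (\<integral>u. \<bar>u\<bar> * (2 * (1 / real (Suc n))) + \<bar>u\<bar> * B' * indicator {..- real n} u \<partial>\<nu>)"
      by (rule near) auto
  qed
  then show ?thesis by simp
qed

section \<open>Renewal equations with the Harnack property\<close>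

text \<open>L is the infimum over T of the suprema of f on the half-lines from T on. Each of these
  suprema is at least L, so values close to L occur arbitrarily far out.\<close>

lemma bounded_limsup_sequence:
  fixes f :: "real \<Rightarrow> real"
  assumes bound: "\<And>t. \<bar>f t\<bar> \<le> B"
  obtains L t where "filterlim t at_top sequentially" "(\<lambda>n. f (t n)) \<longlonglongrightarrow> L"
    "\<And>\<eta>. 0 < \<eta> \<Longrightarrow> \<forall>\<^sub>F x in at_top. f x \<le> L + \<eta>"
proof -
  define U where "U T = (SUP t\<in>{T..}. f t)" for T
  have bdd: "bdd_above (f ` {T..})" for T
    by (rule bdd_aboveI[of _ B]) (use bound in \<open>auto simp: abs_le_iff\<close>)
  have f_U: "f t \<le> U T" if "T \<le> t" for t T
    unfolding U_def using that by (intro cSUP_upper bdd) auto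
  have bddU: "bdd_below (range U)"
    using f_U bound by (intro bdd_belowI[of _ "- B"]) (force intro: order_trans[OF _ f_U[OF order_refl]] simp: abs_le_iff minus_le_iff)
  define L where "L = (INF T. U T)"
  have L_U: "L \<le> U T" for T unfolding L_def by (rule cINF_lower[OF bddU]) simp
  have U_L: "\<exists>T. U T < L + \<eta>" if "0 < \<eta>" for \<eta>
    using cINF_less_iff[OF _ bddU, of "L + \<eta>"] that by (auto simp: L_def)
  have "\<exists>t. real n \<le> t \<and> \<bar>f t - L\<bar> < 1 / real (Suc n)" for n
  proof -
    obtain T where T: "U T < L + 1 / real (Suc n)" using U_L[of "1 / real (Suc n)"] by auto
    have "L - 1 / real (Suc n) < U (max T (real n))" by (rule less_le_trans[OF _ L_U]) simp
    then obtain t where "max T (real n) \<le> t" "L - 1 / real (Suc n) < f t"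
      unfolding U_def using less_cSUP_iff[OF _ bdd, of "max T (real n)"] by auto
    then show ?thesis using T f_U[of T t] by (intro exI[of _ t]) (auto simp: abs_less_iff)
  qed
  then obtain t where t: "\<And>n. real n \<le> t n" "\<And>n. \<bar>f (t n) - L\<bar> < 1 / real (Suc n)" by metis
  show ?thesis
  proof (rule that)
    show "filterlim t at_top sequentially"
      by (rule filterlim_at_top_mono[OF filterlim_real_sequentially]) (use t in auto)
    have "(\<lambda>n. f (t n) - L) \<longlonglongrightarrow> 0"
      by (rule LIMSEQ_norm_0) (use t in auto)
    then show "(\<lambda>n. f (t n)) \<longlonglongrightarrow> L" by (simp add: LIM_zero_iff)
    fix \<eta> :: real assume "0 < \<eta>"
    from U_L[OF this] obtain T where T: "U T < L + \<eta>" by blast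
    show "\<forall>\<^sub>F x in at_top. f x \<le> L + \<eta>"
      using eventually_ge_at_top[of T]
    proof eventually_elim
      case (elim x)
      then show ?case using f_U[OF elim] T by simp
    qed
  qed
qed

text \<open>With \<kappa> = max 1 \<alpha>, moving by a changes f by a factor between exp (-
  \<kappa> |a|) and exp (\<kappa> |a|). The modulus is relative to \<open>f t\<close>, so it
  survives division of f by constants: normalised translates are equicontinuous wherever they are
  bounded.\<close>

lemma harnack_modulus:
  fixes f :: "real \<Rightarrow> real"
  assumes f_nonneg: "\<And>t. 0 \<le> f t" and "0 < \<alpha>"
    and harnack_lower: "\<And>t h. 0 \<le> h \<Longrightarrow> exp (- h) * f t \<le> f (t + h)"
    and harnack_upper: "\<And>t h. 0 \<le> h \<Longrightarrow> f (t + h) \<le> exp (\<alpha> * h) * f t"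
  shows "\<exists>\<kappa>>0. \<forall>t a. \<bar>f (t + a) - f t\<bar> \<le> (exp (\<kappa> * \<bar>a\<bar>) - 1) * f t"
proof -
  define \<kappa> where "\<kappa> = max 1 \<alpha>"
  \<comment> \<open>Equivalent to exp y + exp (- y) \<ge> 2; it brings the lower factor into the
    form of the upper one.\<close>
  have inv: "1 - (exp (\<kappa> * \<bar>a\<bar>) - 1) \<le> exp (- (\<kappa> * \<bar>a\<bar>))" for a
  proof -
    have "0 \<le> (exp (\<kappa> * \<bar>a\<bar>) - 1)\<^sup>2" by simp
    then show ?thesis by (simp add: exp_minus field_simps power2_eq_square)
  qed
  have "\<bar>f (t + a) - f t\<bar> \<le> (exp (\<kappa> * \<bar>a\<bar>) - 1) * f t" for t a
  proof -
    have up: "f (t + a) \<le> exp (\<kappa> * \<bar>a\<bar>) * f t"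
    proof (cases "0 \<le> a")
      case True
      have "exp (\<alpha> * a) * f t \<le> exp (\<kappa> * \<bar>a\<bar>) * f t"
        using True f_nonneg by (intro mult_right_mono) (auto simp: \<kappa>_def mult_right_mono)
      then show ?thesis using harnack_upper[OF True, of t] by simp
    next
      case False
      have "exp a * f (t + a) \<le> f t" using harnack_lower[of "- a" "t + a"] False by simp
      then have "f (t + a) \<le> exp (- a) * f t" by (simp add: exp_minus field_simps)
      also have "\<dots> \<le> exp (\<kappa> * \<bar>a\<bar>) * f t"
        using False f_nonneg mult_right_mono[of 1 \<kappa> "- a"] by (intro mult_right_mono) (auto simp: \<kappa>_def)
      finally show ?thesis .
    qed
    have lo: "exp (- (\<kappa> * \<bar>a\<bar>)) * f t \<le> f (t + a)"
    proof (cases "0 \<le> a")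
      case True
      have "exp (- (\<kappa> * \<bar>a\<bar>)) * f t \<le> exp (- a) * f t"
        using True f_nonneg mult_right_mono[of 1 \<kappa> a] by (intro mult_right_mono) (auto simp: \<kappa>_def)
      then show ?thesis using harnack_lower[OF True, of t] by simp
    next
      case False
      have "f t \<le> exp (\<alpha> * - a) * f (t + a)" using harnack_upper[of "- a" "t + a"] False by simp
      then have "exp (\<alpha> * a) * f t \<le> f (t + a)" by (simp add: exp_minus field_simps)
      moreover have "exp (- (\<kappa> * \<bar>a\<bar>)) * f t \<le> exp (\<alpha> * a) * f t"
        using False f_nonneg mult_right_mono_neg[of \<alpha> \<kappa> a] by (intro mult_right_mono) (auto simp: \<kappa>_def)
      ultimately show ?thesis by simp
    qed
    have "(1 - (exp (\<kappa> * \<bar>a\<bar>) - 1)) * f t \<le> exp (- (\<kappa> * \<bar>a\<bar>)) * f t"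
      by (rule mult_right_mono[OF inv f_nonneg])
    then show ?thesis using up lo by (simp add: algebra_simps)
  qed
  moreover have "0 < \<kappa>" by (simp add: \<kappa>_def)
  ultimately show ?thesis by blast
qed

text \<open>For u < 0 one half of the exponent e absorbs the factor |u| and the other half dominates
  exp (- d u). Hence the restriction of d to half of \<open>\<delta>\<^sub>1\<close> in
  \<open>int_id_exp\<close>.\<close>

lemma abs_mult_exp_le:
  fixes d e u :: real
  assumes "0 \<le> d" "d \<le> e / 2" "0 < e"
  shows "\<bar>u\<bar> * exp (- d * u) \<le> \<bar>u\<bar> + 2 / e * exp (- e * u)"
proof (cases "0 \<le> u")
  case True
  then have "u * exp (- d * u) \<le> u * 1" using assms by (intro mult_left_mono) auto
  then show ?thesis using True \<open>0 < e\<close> by (simp add: add_increasing2)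
next
  case False
  have "- u \<le> (2 / e) * exp (- (e / 2) * u)" using exp_ge_add_one_self[of "- (e / 2) * u"] \<open>0 < e\<close>
    by (simp add: field_simps)
  moreover have "exp (- d * u) \<le> exp (- (e / 2) * u)" using False assms by (simp add: mult_right_mono_neg)
  ultimately have "- u * exp (- d * u) \<le> (2 / e) * exp (- (e / 2) * u) * exp (- (e / 2) * u)"
    using False \<open>0 < e\<close> by (intro mult_mono) auto
  also have "\<dots> = (2 / e) * exp (- e * u)" by (simp add: exp_add[symmetric])
  finally show ?thesis using False by (simp add: abs_if)
qed

locale renewal_step = prob_space \<nu> for \<nu> :: "real measure" +
  fixes \<delta>\<^sub>1 :: real
  assumes sets_nu[measurable_cong]: "sets \<nu> = sets borel"
    and nonarith: "\<And>d. 0 < d \<Longrightarrow> \<not> (AE x in \<nu>. x \<in> range (\<lambda>k::int. d * of_int k))"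
    and int_id: "integrable \<nu> (\<lambda>u. u)" and mean_pos: "0 < (\<integral>u. u \<partial>\<nu>)"
    and delta_pos: "0 < \<delta>\<^sub>1" and int_exp_delta: "integrable \<nu> (\<lambda>u. exp (- \<delta>\<^sub>1 * u))"
begin

lemma int_exp:
  assumes "0 \<le> \<delta>" "\<delta> \<le> \<delta>\<^sub>1"
  shows "integrable \<nu> (\<lambda>u. exp (- \<delta> * u))"
proof (rule integrable_dominated)
  show "integrable \<nu> (\<lambda>u. 1 + exp (- \<delta>\<^sub>1 * u))" using int_exp_delta by simp
  fix u
  show "\<bar>exp (- \<delta> * u)\<bar> \<le> 1 + exp (- \<delta>\<^sub>1 * u)"
  proof (cases "0 \<le> u")
    case True
    then have "exp (- \<delta> * u) \<le> 1" using assms by simp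
    then show ?thesis by (simp add: add_increasing2)
  next
    case False
    then have "exp (- \<delta> * u) \<le> exp (- \<delta>\<^sub>1 * u)" using assms by (simp add: mult_right_mono_neg)
    then show ?thesis by (simp add: add_increasing)
  qed
qed simp

lemma int_id_exp:
  assumes "0 \<le> d" "d \<le> \<delta>\<^sub>1 / 2"
  shows "integrable \<nu> (\<lambda>u. \<bar>u\<bar> * exp (- d * u))"
proof (rule integrable_dominated)
  show "integrable \<nu> (\<lambda>u. \<bar>u\<bar> + 2 / \<delta>\<^sub>1 * exp (- \<delta>\<^sub>1 * u))" using int_id int_exp_delta by simp
  show "\<bar>\<bar>u\<bar> * exp (- d * u)\<bar> \<le> \<bar>u\<bar> + 2 / \<delta>\<^sub>1 * exp (- \<delta>\<^sub>1 * u)" for u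
    using abs_mult_exp_le[OF assms delta_pos, of u] by (simp add: abs_mult)
qed simp

end

text \<open>The exponents 1 and \<alpha> are those of the smoothed tail: the rate of the exponential
  shift and the power in the monotone factor. Boundedness is to be proved from
  \<open>growth\<close>. The renewal equation and the conservation law are asymptotic, as translates
  to infinity are all that is taken.\<close>

locale harnack_renewal = renewal_step +
  fixes f F :: "real \<Rightarrow> real" and \<alpha> \<gamma> :: real
  assumes alpha_pos: "0 < \<alpha>"
    and f_meas[measurable]: "f \<in> borel_measurable borel"
    and f_nonneg: "\<And>t. 0 \<le> f t"
    and harnack_lower: "\<And>t h. 0 \<le> h \<Longrightarrow> exp (- h) * f t \<le> f (t + h)"
    and harnack_upper: "\<And>t h. 0 \<le> h \<Longrightarrow> f (t + h) \<le> exp (\<alpha> * h) * f t"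
    and growth: "\<And>\<delta>. 0 < \<delta> \<Longrightarrow> \<delta> \<le> \<delta>\<^sub>1 \<Longrightarrow> \<exists>K. \<forall>t. f t \<le> K * exp (\<delta> * t)"
    and renewal: "((\<lambda>t. f t - (\<integral>u. f (t - u) \<partial>\<nu>)) \<longlongrightarrow> 0) at_top"
    and deriv: "\<And>t. (F has_real_derivative f t) (at t)"
    and conserved: "((\<lambda>t. \<integral>u. F t - F (t - u) \<partial>\<nu>) \<longlongrightarrow> \<gamma>) at_top"
begin

text \<open>Covers three normalisations: a = 1 for the upper limit, a = -1 to treat the lower limit
  as an upper one, and a n = f (t n) with c = 0 for an unbounded f.\<close>

lemma translate_limit:
  fixes t a :: "nat \<Rightarrow> real"
  assumes t: "filterlim t at_top sequentially" and a: "\<And>n. 1 \<le> \<bar>a n\<bar>"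
    and bound: "\<And>n s. f (t n + s) / \<bar>a n\<bar> \<le> D * (1 + exp (\<delta>\<^sub>1 / 2 * s))"
    and ev_bound: "\<And>s. \<forall>\<^sub>F n in sequentially. f (t n + s) / \<bar>a n\<bar> \<le> B"
    and upper: "\<And>s \<eta>. 0 < \<eta> \<Longrightarrow> \<forall>\<^sub>F n in sequentially. f (t n + s) / a n \<le> L + \<eta>"
    and at_0: "(\<lambda>n. f (t n) / a n) \<longlonglongrightarrow> L"
    and c: "(\<lambda>n. \<gamma> / a n) \<longlonglongrightarrow> c"
  shows "L * (\<integral>u. u \<partial>\<nu>) = c"
proof (rule maximum_principle_limit[where h = "\<lambda>n s. f (t n + s) / a n" and H = "\<lambda>n s. F (t n + s) / a n"
      and d = "\<delta>\<^sub>1 / 2" and D = D and B = B])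
  have t': "filterlim (\<lambda>n. t n + s) at_top sequentially" for s
    using filterlim_tendsto_add_at_top[OF tendsto_const[of s] t] by (simp add: add.commute)
  \<comment> \<open>Division by numbers of modulus at least 1 keeps null sequences null, so both
    asymptotic identities pass to the normalised translates.\<close>
  have small: "(\<lambda>n. x n / a n) \<longlonglongrightarrow> 0" if "x \<longlonglongrightarrow> 0" for x :: "nat \<Rightarrow> real"
  proof (rule Lim_null_comparison[OF always_eventually tendsto_rabs_zero[OF that]], rule allI)
    fix n
    have "\<bar>x n\<bar> * 1 \<le> \<bar>x n\<bar> * \<bar>a n\<bar>" by (rule mult_left_mono) (use a in auto)
    then show "norm (x n / a n) \<le> \<bar>x n\<bar>"
      using a[of n] by (simp add: divide_le_eq)
  qed
  show "prob_space \<nu>" by unfold_locales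
  show "integrable \<nu> (\<lambda>u. exp (- (\<delta>\<^sub>1 / 2) * u))" using delta_pos by (intro int_exp) auto
  show "integrable \<nu> (\<lambda>u. \<bar>u\<bar> * exp (- (\<delta>\<^sub>1 / 2) * u))" using delta_pos by (intro int_id_exp) auto
  show "\<bar>f (t n + s) / a n\<bar> \<le> D * (1 + exp (\<delta>\<^sub>1 / 2 * s))" for n s
    using bound[of n s] f_nonneg by simp
  show "\<exists>\<theta>>0. \<forall>s. \<forall>\<^sub>F n in sequentially. \<forall>s'. \<bar>s' - s\<bar> < \<theta> \<longrightarrow> \<bar>f (t n + s') / a n - f (t n + s) / a n\<bar> \<le> \<eta>"
    if "0 < \<eta>" for \<eta>
  proof -
    obtain \<kappa> where \<kappa>: "0 < \<kappa>" "\<And>t a. \<bar>f (t + a) - f t\<bar> \<le> (exp (\<kappa> * \<bar>a\<bar>) - 1) * f t"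
      using harnack_modulus[OF f_nonneg alpha_pos harnack_lower harnack_upper] by blast
    define B' where "B' = max 1 B"
    \<comment> \<open>Solves exp (\<kappa> \<theta>) - 1 = \<eta> / B', so that the relative modulus
      times the bound B' is at most \<eta>.\<close>
    define \<theta> where "\<theta> = ln (1 + \<eta> / B') / \<kappa>"
    have "0 < B'" by (simp add: B'_def)
    have \<theta>: "0 < \<theta>" "exp (\<kappa> * \<theta>) - 1 = \<eta> / B'"
      using \<open>0 < \<eta>\<close> \<open>0 < B'\<close> \<kappa>(1) by (auto simp: \<theta>_def add_pos_pos)
    have "\<forall>\<^sub>F n in sequentially. \<forall>s'. \<bar>s' - s\<bar> < \<theta> \<longrightarrow> \<bar>f (t n + s') / a n - f (t n + s) / a n\<bar> \<le> \<eta>" for s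
      using ev_bound[of s]
    proof eventually_elim
      case (elim n)
      show ?case
      proof safe
        fix s' assume s': "\<bar>s' - s\<bar> < \<theta>"
        have "\<bar>f (t n + s') / a n - f (t n + s) / a n\<bar> = \<bar>f ((t n + s) + (s' - s)) - f (t n + s)\<bar> / \<bar>a n\<bar>"
          by (simp add: diff_divide_distrib[symmetric])
        also have "\<dots> \<le> (exp (\<kappa> * \<bar>s' - s\<bar>) - 1) * f (t n + s) / \<bar>a n\<bar>"
          by (intro divide_right_mono \<kappa>) auto
        also have "\<dots> = (exp (\<kappa> * \<bar>s' - s\<bar>) - 1) * (f (t n + s) / \<bar>a n\<bar>)" by simp
        also have "\<dots> \<le> (\<eta> / B') * B'"
        proof (rule mult_mono)
          show "exp (\<kappa> * \<bar>s' - s\<bar>) - 1 \<le> \<eta> / B'"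
            using \<theta>(2)[symmetric] s' \<kappa>(1) by (simp add: mult_left_mono)
        qed (use elim f_nonneg \<open>0 < \<eta>\<close> \<open>0 < B'\<close> in \<open>auto simp: B'_def\<close>)
        finally show "\<bar>f (t n + s') / a n - f (t n + s) / a n\<bar> \<le> \<eta>" using \<open>0 < B'\<close> by simp
      qed
    qed
    then show ?thesis using \<theta>(1) by blast
  qed
  show "(\<lambda>n. f (t n + s) / a n - (\<integral>u. f (t n + (s - u)) / a n \<partial>\<nu>)) \<longlonglongrightarrow> 0" for s
  proof -
    have "(\<lambda>n. (f (t n + s) - (\<integral>u. f (t n + s - u) \<partial>\<nu>)) / a n) \<longlonglongrightarrow> 0"
      by (rule small) (rule filterlim_compose[OF renewal t'])
    then show ?thesis by (simp add: diff_divide_distrib add_diff_eq)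
  qed
  show "\<forall>\<^sub>F n in sequentially. - B \<le> f (t n + s) / a n" for s
    using ev_bound[of s]
  proof eventually_elim
    case (elim n)
    have "\<bar>f (t n + s) / a n\<bar> \<le> B" using elim f_nonneg by simp
    then show ?case by linarith
  qed
  show "((\<lambda>s. F (t n + s) / a n) has_real_derivative f (t n + s) / a n) (at s)" for n s
  proof -
    have "((\<lambda>s. F (s + t n)) has_real_derivative f (s + t n)) (at s)"
      using deriv[of "s + t n"] by (simp add: DERIV_shift)
    then show ?thesis by (auto intro: DERIV_cdivide simp: add.commute)
  qed
  show "(\<lambda>n. \<integral>u. F (t n + x) / a n - F (t n + (x - u)) / a n \<partial>\<nu>) \<longlonglongrightarrow> c" for x
  proof -
    have "(\<lambda>n. ((\<integral>u. F (t n + x) - F (t n + x - u) \<partial>\<nu>) - \<gamma>) / a n) \<longlonglongrightarrow> 0"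
      by (rule small, rule LIM_zero) (rule filterlim_compose[OF conserved t'])
    from tendsto_add[OF this c] show ?thesis by (simp add: diff_divide_distrib[symmetric] add_divide_distrib[symmetric] add_diff_eq)
  qed
  show "0 \<le> \<delta>\<^sub>1 / 2" using delta_pos by simp
  show "(\<lambda>n. f (t n + 0) / a n) \<longlonglongrightarrow> L" using at_0 by simp
  show "(\<lambda>s. f (t n + s) / a n) \<in> borel_measurable borel" for n by simp
qed (fact sets_nu nonarith int_id mean_pos upper)+

text \<open>
  If \<open>f\<close> is unbounded, the translates to near-maximisers of \<open>f t * exp (- d t)\<close>, divided by their value
  at \<open>0\<close>, satisfy the hypotheses of the maximum principle with \<open>L = 1\<close> as \<open>d \<rightarrow> 0\<close>, whereas
  the conserved quantity is divided by a sequence tending to infinity.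
\<close>
lemma bounded: "\<exists>B. \<forall>t. f t \<le> B"
proof (rule ccontr)
  assume unbounded: "\<not> ?thesis"
  define d where "d n = \<delta>\<^sub>1 / 2 / real (Suc n)" for n :: nat
  have d_pos: "0 < d n" for n using delta_pos by (simp add: d_def)
  have d_le: "d n \<le> \<delta>\<^sub>1 / 2" for n using delta_pos unfolding d_def by (simp add: field_simps)
  have d_lim: "d \<longlonglongrightarrow> 0"
    using tendsto_mult_left[OF LIMSEQ_Suc[OF lim_1_over_n], of "\<delta>\<^sub>1 / 2"] by (simp add: d_def[abs_def])
  \<comment> \<open>Finite by \<open>growth\<close> at the rate \<open>d n\<close>.\<close>
  define M where "M n = (SUP t. f t * exp (- d n * t))" for n
  have bdd: "bdd_above (range (\<lambda>t. f t * exp (- d n * t)))" for n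
  proof -
    obtain K where K: "\<And>t. f t \<le> K * exp (d n * t)" using growth[OF d_pos, of n] d_le[of n] delta_pos by auto
    have "f t * exp (- d n * t) \<le> K" for t
    proof -
      have "f t * exp (- d n * t) \<le> K * exp (d n * t) * exp (- d n * t)" by (intro mult_right_mono K) simp
      also have "\<dots> = K" by (simp add: exp_minus)
      finally show ?thesis .
    qed
    then show ?thesis by (intro bdd_aboveI) auto
  qed
  have le_M: "f t * exp (- d n * t) \<le> M n" for t n unfolding M_def by (rule cSUP_upper[OF _ bdd]) simp
  have M_pos: "0 < M n" for n
  proof -
    obtain t where "0 < f t" using unbounded by (auto simp: not_le)
    then have "0 < f t * exp (- d n * t)" by simp
    then show ?thesis using le_M[of t n] by simp
  qed
  \<comment> \<open>The supremum need not be attained. Points that reach the fraction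
    \<open>q n\<close> of it do just as well, because \<open>q n\<close> tends to 1.\<close>
  define q where "q n = real (Suc n) / real (Suc (Suc n))" for n
  have q: "0 < q n" "q n < 1" "1 / 2 \<le> q n" for n by (auto simp: q_def field_simps)
  have q_lim: "q \<longlonglongrightarrow> 1"
  proof -
    have "(\<lambda>n. 1 - 1 / real (Suc (Suc n))) \<longlonglongrightarrow> 1 - 0"
      by (intro tendsto_intros LIMSEQ_Suc lim_1_over_n)
    moreover have "q = (\<lambda>n. 1 - 1 / real (Suc (Suc n)))" by (auto simp: q_def field_simps)
    ultimately show ?thesis by simp
  qed
  have "\<exists>t. q n * M n < f t * exp (- d n * t)" for n
  proof -
    have "q n * M n < M n" using q(2)[of n] M_pos[of n] by simp
    then show ?thesis unfolding M_def using less_cSUP_iff[OF _ bdd[of n]] by auto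
  qed
  then obtain t where t: "\<And>n. q n * M n < f (t n) * exp (- d n * t n)" by metis
  obtain K where K: "\<And>t. f t \<le> K * exp (\<delta>\<^sub>1 * t)" using growth[OF delta_pos] by auto
  have "0 \<le> K" using K[of 0] f_nonneg[of 0] by simp
  \<comment> \<open>For fixed s the weight exp (- d n s) tends to 1, so \<open>M n\<close> is
    eventually almost as large as f s, which can be chosen at will; q n \<ge> 1 / 2 passes this on
    to the near-maximisers.\<close>
  have large: "\<forall>\<^sub>F n in sequentially. X < f (t n) * exp (- d n * t n)" for X
  proof -
    obtain s where s: "2 * \<bar>X\<bar> < f s" using unbounded by (auto simp: not_le)
    have "(\<lambda>n. 1 / 2 * (f s * exp (- d n * s))) \<longlonglongrightarrow> 1 / 2 * (f s * exp (- 0 * s))"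
      by (intro tendsto_intros d_lim)
    then have "\<forall>\<^sub>F n in sequentially. \<bar>X\<bar> < 1 / 2 * (f s * exp (- d n * s))"
      using s by (intro order_tendstoD) auto
    then show ?thesis
    proof eventually_elim
      case (elim n)
      have "1 / 2 * (f s * exp (- d n * s)) \<le> q n * M n"
        using q[of n] M_pos[of n] le_M[of s n] f_nonneg by (intro mult_mono) auto
      then show ?case using elim t[of n] by linarith
    qed
  qed
  \<comment> \<open>On the negative half-line \<open>f t * exp (- d n * t)\<close> is at most
    \<open>K\<close>, by growth at the larger rate \<open>\<delta>\<^sub>1\<close>.\<close>
  have t_nonneg: "\<forall>\<^sub>F n in sequentially. 0 \<le> t n"
    using large[of K]
  proof eventually_elim
    case (elim n)
    show ?case
    proof (rule ccontr)
      assume "\<not> 0 \<le> t n"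
      then have neg: "t n < 0" by simp
      have "f (t n) * exp (- d n * t n) \<le> K * exp (\<delta>\<^sub>1 * t n) * exp (- d n * t n)"
        by (intro mult_right_mono K) simp
      also have "\<dots> = K * exp ((\<delta>\<^sub>1 - d n) * t n)" by (simp add: exp_add[symmetric] algebra_simps)
      also have "\<dots> \<le> K * 1"
        using neg d_le[of n] delta_pos \<open>0 \<le> K\<close>
        by (intro mult_left_mono) (auto intro!: mult_nonneg_nonpos)
      finally show False using elim by simp
    qed
  qed
  have f_large: "\<forall>\<^sub>F n in sequentially. X < f (t n)" for X
    using large[of X] t_nonneg
  proof eventually_elim
    case (elim n)
    have "f (t n) * exp (- d n * t n) \<le> f (t n) * 1"
      using elim d_pos[of n] f_nonneg by (intro mult_left_mono) auto
    then show ?case using elim by simp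
  qed
  \<comment> \<open>f is bounded on every left half-line, so points with values tending to infinity
    escape to the right.\<close>
  have t_lim: "filterlim t at_top sequentially"
    unfolding filterlim_at_top
  proof
    fix X
    show "\<forall>\<^sub>F n in sequentially. X \<le> t n"
      using f_large[of "K * exp (\<delta>\<^sub>1 * X)"]
    proof eventually_elim
      case (elim n)
      show ?case
      proof (rule ccontr)
        assume "\<not> X \<le> t n"
        then have "K * exp (\<delta>\<^sub>1 * t n) \<le> K * exp (\<delta>\<^sub>1 * X)"
          using \<open>0 \<le> K\<close> delta_pos by (intro mult_left_mono) auto
        then show False using elim K[of "t n"] by simp
      qed
    qed
  qed
  have ratio: "f (t n + s) \<le> exp (d n * s) / q n * f (t n)" for n s
  proof -
    have "q n * (f (t n + s) * exp (- d n * (t n + s))) \<le> q n * M n"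
      using q[of n] by (intro mult_left_mono le_M) simp
    also have "\<dots> \<le> f (t n) * exp (- d n * t n)" using t[of n] by simp
    finally have "q n * f (t n + s) * exp (- d n * s) * exp (- d n * t n) \<le> f (t n) * exp (- d n * t n)"
      by (simp add: exp_add[symmetric] algebra_simps)
    then have "q n * f (t n + s) * exp (- d n * s) \<le> f (t n)" by simp
    then show ?thesis using q[of n] by (simp add: exp_minus field_simps)
  qed
  \<comment> \<open>Dropping an initial segment makes all normalising values exceed 1.\<close>
  obtain n0 where n0: "\<And>n. n0 \<le> n \<Longrightarrow> 1 < f (t n)"
    using f_large[of 1] by (auto simp: eventually_sequentially)
  define t' where "t' n = t (n + n0)" for n
  define a where "a n = f (t' n)" for n
  have a: "1 < a n" for n using n0 by (simp add: a_def t'_def)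
  have t': "filterlim t' at_top sequentially"
    using filterlim_compose[OF t_lim filterlim_add_const_nat_at_top[of n0]] by (simp add: t'_def[abs_def])
  have ratio': "f (t' n + s) / a n \<le> exp (d (n + n0) * s) / q (n + n0)" for n s
    using ratio[of "n + n0" s] a[of n] by (simp add: a_def t'_def divide_le_eq)
  have lim_ratio: "(\<lambda>n. exp (d (n + n0) * s) / q (n + n0)) \<longlonglongrightarrow> 1" for s
  proof -
    have "(\<lambda>n. exp (d (n + n0) * s) / q (n + n0)) \<longlonglongrightarrow> exp (0 * s) / 1"
      by (intro tendsto_intros LIMSEQ_ignore_initial_segment d_lim q_lim) simp
    then show ?thesis by simp
  qed
  have ev: "\<forall>\<^sub>F n in sequentially. f (t' n + s) / a n \<le> 1 + \<eta>" if "0 < \<eta>" for s \<eta>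
  proof -
    have "\<forall>\<^sub>F n in sequentially. exp (d (n + n0) * s) / q (n + n0) < 1 + \<eta>"
      using order_tendstoD(2)[OF lim_ratio, of "1 + \<eta>"] that by simp
    then show ?thesis by eventually_elim (use ratio' in \<open>auto intro: order_trans[OF ratio']\<close>)
  qed
  have "1 * (\<integral>u. u \<partial>\<nu>) = 0"
  proof (rule translate_limit[OF t', where a = a and D = 2 and B = 2])
    show "1 \<le> \<bar>a n\<bar>" for n using a[of n] by simp
    show "f (t' n + s) / \<bar>a n\<bar> \<le> 2 * (1 + exp (\<delta>\<^sub>1 / 2 * s))" for n s
    proof -
      have "exp (d (n + n0) * s) \<le> 1 + exp (\<delta>\<^sub>1 / 2 * s)"
      proof (cases "0 \<le> s")
        case True
        then have "exp (d (n + n0) * s) \<le> exp (\<delta>\<^sub>1 / 2 * s)"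
          using d_le by (subst exp_le_cancel_iff) (rule mult_right_mono)
        then show ?thesis by (rule order_trans) simp
      next
        case False
        then have "exp (d (n + n0) * s) \<le> 1"
          using d_pos[of "n + n0"] by (simp add: mult_nonneg_nonpos)
        then show ?thesis by (simp add: add_increasing2)
      qed
      then have "exp (d (n + n0) * s) / q (n + n0) \<le> (1 + exp (\<delta>\<^sub>1 / 2 * s)) / (1 / 2)"
        using q[of "n + n0"] by (intro frac_le) auto
      then show ?thesis using ratio'[of n s] a[of n] by simp
    qed
    show "\<forall>\<^sub>F n in sequentially. f (t' n + s) / \<bar>a n\<bar> \<le> 2" for s
      using ev[of 1 s] a by (simp add: less_imp_le abs_of_pos less_trans[OF zero_less_one])
    show "\<forall>\<^sub>F n in sequentially. f (t' n + s) / a n \<le> 1 + \<eta>" if "0 < \<eta>" for s \<eta>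
      by (rule ev[OF that])
    have "f (t' n) / a n = 1" for n using a[of n] by (simp add: a_def)
    then show "(\<lambda>n. f (t' n) / a n) \<longlonglongrightarrow> 1" by (simp only: tendsto_const)
    have "filterlim a at_top sequentially"
      unfolding filterlim_at_top
    proof
      fix X
      have "\<forall>\<^sub>F n in sequentially. X < f (t (n + n0))"
        using f_large[of X] by (simp add: eventually_sequentially) (meson trans_le_add1)
      then show "\<forall>\<^sub>F n in sequentially. X \<le> a n" by eventually_elim (simp add: a_def t'_def)
    qed
    then show "(\<lambda>n. \<gamma> / a n) \<longlonglongrightarrow> 0"
      by (rule real_tendsto_divide_at_top[OF tendsto_const])
  qed
  then show False using mean_pos by simp
qed

text \<open>The upper limits of f and of - f, times the mean, are \<gamma> and - \<gamma>; hence the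
  upper and the lower limit of f agree.\<close>

theorem tendsto_renewal_limit: "(f \<longlongrightarrow> \<gamma> / (\<integral>u. u \<partial>\<nu>)) at_top"
proof -
  obtain B where le_B: "\<forall>t. f t \<le> B" using bounded by blast
  have B: "\<bar>f t\<bar> \<le> B" "\<bar>- f t\<bar> \<le> B" for t
    using le_B[rule_format, of t] f_nonneg[of t] by simp_all
  have "0 \<le> B" using B(1)[of 0] by simp
  have bnd: "f (t n + s) / \<bar>1\<bar> \<le> B * (1 + exp (\<delta>\<^sub>1 / 2 * s))"
    "f (t n + s) / \<bar>- 1\<bar> \<le> B * (1 + exp (\<delta>\<^sub>1 / 2 * s))" for t :: "nat \<Rightarrow> real" and n s
  proof -
    have "B * 1 \<le> B * (1 + exp (\<delta>\<^sub>1 / 2 * s))" using \<open>0 \<le> B\<close> by (intro mult_left_mono) auto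
    then show "f (t n + s) / \<bar>1\<bar> \<le> B * (1 + exp (\<delta>\<^sub>1 / 2 * s))"
      "f (t n + s) / \<bar>- 1\<bar> \<le> B * (1 + exp (\<delta>\<^sub>1 / 2 * s))" using B(1)[of "t n + s"] by auto
  qed
  have bnd': "f x / \<bar>1\<bar> \<le> B" "f x / \<bar>- 1\<bar> \<le> B" for x using B(1)[of x] by auto
  have shift: "\<forall>\<^sub>F n in sequentially. P (t n + s)"
    if "filterlim t at_top sequentially" "\<forall>\<^sub>F x in at_top. P x" for t :: "nat \<Rightarrow> real" and s P
    using eventually_compose_filterlim[OF that(2) filterlim_tendsto_add_at_top[OF tendsto_const[of s] that(1)]]
    by (simp add: add.commute)
  obtain L t where L: "filterlim t at_top sequentially" "(\<lambda>n. f (t n)) \<longlonglongrightarrow> L"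
      "\<And>\<eta>. 0 < \<eta> \<Longrightarrow> \<forall>\<^sub>F x in at_top. f x \<le> L + \<eta>"
    by (rule bounded_limsup_sequence[of f, OF B(1)]) (rule that)
  have "L * (\<integral>u. u \<partial>\<nu>) = \<gamma>"
  proof (rule translate_limit[OF L(1), where a = "\<lambda>_. 1" and D = B and B = B])
    show "\<forall>\<^sub>F n in sequentially. f (t n + s) / 1 \<le> L + \<eta>" if "0 < \<eta>" for s \<eta>
      using shift[OF L(1) L(3)[OF that], of s] by simp
    show "f (t n + s) / \<bar>1\<bar> \<le> B * (1 + exp (\<delta>\<^sub>1 / 2 * s))" for n s by (rule bnd)
    show "\<forall>\<^sub>F n in sequentially. f (t n + s) / \<bar>1\<bar> \<le> B" for s by (intro always_eventually allI bnd')
  qed (use L(2) in simp_all)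
  then have L_eq: "L = \<gamma> / (\<integral>u. u \<partial>\<nu>)" using mean_pos by (simp add: field_simps)
  obtain l r where l: "filterlim r at_top sequentially" "(\<lambda>n. - f (r n)) \<longlonglongrightarrow> l"
      "\<And>\<eta>. 0 < \<eta> \<Longrightarrow> \<forall>\<^sub>F x in at_top. - f x \<le> l + \<eta>"
    by (rule bounded_limsup_sequence[of "\<lambda>x. - f x", OF B(2)]) (rule that)
  have "l * (\<integral>u. u \<partial>\<nu>) = - \<gamma>"
  proof (rule translate_limit[OF l(1), where a = "\<lambda>_. - 1" and D = B and B = B])
    show "\<forall>\<^sub>F n in sequentially. f (r n + s) / - 1 \<le> l + \<eta>" if "0 < \<eta>" for s \<eta>
      using shift[OF l(1) l(3)[OF that], of s] by simp
    show "f (r n + s) / \<bar>- 1\<bar> \<le> B * (1 + exp (\<delta>\<^sub>1 / 2 * s))" for n s by (rule bnd)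
    show "\<forall>\<^sub>F n in sequentially. f (r n + s) / \<bar>- 1\<bar> \<le> B" for s by (intro always_eventually allI bnd')
  qed (use l(2) in simp_all)
  then have l_eq: "l = - (\<gamma> / (\<integral>u. u \<partial>\<nu>))" using mean_pos by (simp add: field_simps)
  show ?thesis
  proof (rule tendstoI)
    fix e :: real assume "0 < e"
    then have "0 < e / 2" by simp
    show "\<forall>\<^sub>F x in at_top. dist (f x) (\<gamma> / (\<integral>u. u \<partial>\<nu>)) < e"
      using L(3)[OF \<open>0 < e / 2\<close>] l(3)[OF \<open>0 < e / 2\<close>]
      by eventually_elim (use \<open>0 < e\<close> L_eq l_eq in \<open>auto simp: dist_real_def abs_less_iff\<close>)
  qed
qed

end

section \<open>The renewal theorem for monotone tails\<close>

definition conv :: "real measure \<Rightarrow> (real \<Rightarrow> real) \<Rightarrow> real \<Rightarrow> real" where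
  "conv m k t = (\<integral>x. k (t - x) \<partial>m)"

text \<open>Convolution with such measures preserves bounds of the form K exp (\<delta> t). One
  framework thus serves the step law, the exponential law and Lebesgue measure on a half-line, whose
  mass is infinite.\<close>

locale exp_bounded_conv = sigma_finite_measure m for m :: "real measure" +
  fixes \<delta> :: real
  assumes sets_m[measurable_cong]: "sets m = sets borel"
    and int_exp_m: "integrable m (\<lambda>x. exp (- \<delta> * x))"
begin

context
  fixes k :: "real \<Rightarrow> real" and K :: real
  assumes k_meas[measurable]: "k \<in> borel_measurable borel"
    and k_nonneg: "\<And>t. 0 \<le> k t" and k_le: "\<And>t. k t \<le> K * exp (\<delta> * t)"
begin

lemma int_conv: "integrable m (\<lambda>x. k (t - x))"
proof (rule integrable_dominated)
  show "integrable m (\<lambda>x. K * exp (\<delta> * t) * exp (- \<delta> * x))" using int_exp_m by simp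
  show "\<bar>k (t - x)\<bar> \<le> K * exp (\<delta> * t) * exp (- \<delta> * x)" for x
    using k_le[of "t - x"] k_nonneg by (simp add: mult.assoc exp_add[symmetric] algebra_simps)
qed simp

lemma conv_nonneg: "0 \<le> conv m k t"
  unfolding conv_def by (simp add: k_nonneg)

lemma conv_le: "conv m k t \<le> K * (\<integral>x. exp (- \<delta> * x) \<partial>m) * exp (\<delta> * t)"
proof -
  have "conv m k t \<le> (\<integral>x. K * exp (\<delta> * t) * exp (- \<delta> * x) \<partial>m)"
    unfolding conv_def
  proof (rule integral_mono[OF int_conv])
    show "integrable m (\<lambda>x. K * exp (\<delta> * t) * exp (- \<delta> * x))" using int_exp_m by simp
    show "k (t - x) \<le> K * exp (\<delta> * t) * exp (- \<delta> * x)" for x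
      using k_le[of "t - x"] by (simp add: mult.assoc exp_add[symmetric] algebra_simps)
  qed
  then show ?thesis by (simp add: mult_ac)
qed

lemma conv_measurable: "conv m k \<in> borel_measurable borel"
  unfolding conv_def[abs_def] by (rule borel_measurable_lebesgue_integral) simp

lemma ennreal_conv: "ennreal (conv m k t) = (\<integral>\<^sup>+x. ennreal (k (t - x)) \<partial>m)"
  unfolding conv_def by (rule nn_integral_eq_integral[symmetric, OF int_conv]) (simp add: k_nonneg)

end

end

text \<open>Tonelli for the nonnegative double integral, which the exponential bound makes finite.
  It exchanges averaging over \<nu> with smoothing and with taking antiderivatives.\<close>

lemma conv_commute:
  assumes m: "exp_bounded_conv m \<delta>" and n: "exp_bounded_conv n \<delta>"
    and k[measurable]: "k \<in> borel_measurable borel" and "\<And>t. 0 \<le> k t" "\<And>t. k t \<le> K * exp (\<delta> * t)"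
  shows "conv m (conv n k) t = conv n (conv m k) t"
proof -
  interpret m: exp_bounded_conv m \<delta> by (rule m)
  interpret n: exp_bounded_conv n \<delta> by (rule n)
  interpret pair_sigma_finite m n ..
  note k = assms(3-5)
  note km = m.conv_measurable[OF k] m.conv_nonneg[OF k] m.conv_le[OF k]
  note kn = n.conv_measurable[OF k] n.conv_nonneg[OF k] n.conv_le[OF k]
  have "ennreal (conv m (conv n k) t) = (\<integral>\<^sup>+x. \<integral>\<^sup>+y. ennreal (k (t - x - y)) \<partial>n \<partial>m)"
    by (simp add: m.ennreal_conv[OF kn] n.ennreal_conv[OF k])
  also have "\<dots> = (\<integral>\<^sup>+y. \<integral>\<^sup>+x. ennreal (k (t - x - y)) \<partial>m \<partial>n)"
    by (rule Fubini'[symmetric]) simp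
  also have "\<dots> = ennreal (conv n (conv m k) t)"
    by (simp add: n.ennreal_conv[OF km] m.ennreal_conv[OF k] algebra_simps)
  finally show ?thesis
    using m.conv_nonneg[OF kn] n.conv_nonneg[OF km] by simp
qed

abbreviation exp1 :: "real measure" where
  "exp1 \<equiv> density lborel (exponential_density 1)"

text \<open>Convolution with this measure integrates over all points up to t: it is the
  antiderivative that vanishes at minus infinity.\<close>

abbreviation half_line :: "real measure" where
  "half_line \<equiv> density lborel (\<lambda>x. ennreal (indicator {0..} x))"

lemma integrable_exponential_density: "0 < l \<Longrightarrow> integrable lborel (exponential_density l)"
proof -
  assume l: "0 < l"
  interpret prob_space "density lborel (exponential_density l)" by (rule prob_space_exponential_density[OF l])
  have "(\<integral>\<^sup>+x. ennreal (exponential_density l x) \<partial>lborel) = 1"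
    using emeasure_space_1 by (simp add: emeasure_density)
  then show ?thesis
    using l by (intro integrableI_nonneg) (auto simp: exponential_density_nonneg)
qed

lemma exp_bounded_exp1: "0 < \<delta> \<Longrightarrow> exp_bounded_conv exp1 \<delta>"
proof
  interpret e: prob_space exp1 by (rule prob_space_exponential_density) simp
  show "\<exists>A. countable A \<and> A \<subseteq> sets exp1 \<and> \<Union> A = space exp1 \<and> (\<forall>a\<in>A. emeasure exp1 a \<noteq> \<infinity>)"
    by (rule e.sigma_finite_countable)
  assume "0 < \<delta>"
  \<comment> \<open>Tilting the standard exponential density by exp (- \<delta> x) gives a multiple
    of the density of rate 1 + \<delta>.\<close>
  have "integrable lborel (\<lambda>x. 1 / (1 + \<delta>) * exponential_density (1 + \<delta>) x)"
    using \<open>0 < \<delta>\<close> by (intro integrable_mult_right integrable_exponential_density) simp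
  also have "(\<lambda>x. 1 / (1 + \<delta>) * exponential_density (1 + \<delta>) x) = (\<lambda>x. exponential_density 1 x * exp (- \<delta> * x))"
  proof
    fix x
    have "exp (- x * (1 + \<delta>)) = exp (- x * 1) * exp (- \<delta> * x)"
      by (simp add: exp_add[symmetric] algebra_simps)
    then show "1 / (1 + \<delta>) * exponential_density (1 + \<delta>) x = exponential_density 1 x * exp (- \<delta> * x)"
      using \<open>0 < \<delta>\<close> by (simp add: exponential_density_def)
  qed
  finally show "integrable exp1 (\<lambda>x. exp (- \<delta> * x))"
    by (subst integrable_real_density) (auto simp: exponential_density_nonneg)
qed simp

lemma exp_bounded_half_line: "0 < \<delta> \<Longrightarrow> exp_bounded_conv half_line \<delta>"
proof -
  assume "0 < \<delta>"
  have "sigma_finite_measure half_line"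
    by (subst sigma_finite_measure.sigma_finite_iff_density_finite[OF sigma_finite_lborel]) auto
  moreover have "integrable half_line (\<lambda>x. exp (- \<delta> * x))"
  proof -
    have "integrable lborel (\<lambda>x. 1 / \<delta> * exponential_density \<delta> x)"
      using \<open>0 < \<delta>\<close> by (intro integrable_mult_right integrable_exponential_density) simp
    also have "(\<lambda>x. 1 / \<delta> * exponential_density \<delta> x) = (\<lambda>x. indicator {0..} x * exp (- \<delta> * x))"
      using \<open>0 < \<delta>\<close> by (auto simp: exponential_density_def indicator_def algebra_simps)
    finally show ?thesis by (subst integrable_real_density) auto
  qed
  ultimately show ?thesis by (simp add: exp_bounded_conv_def exp_bounded_conv_axioms_def)
qed

lemma conv_density:
  assumes [measurable]: "\<rho> \<in> borel_measurable borel" "k \<in> borel_measurable borel" and "\<And>x. 0 \<le> \<rho> x"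
  shows "conv (density lborel (\<lambda>x. ennreal (\<rho> x))) k t = (\<integral>s. \<rho> (t - s) * k s \<partial>lborel)"
proof -
  have "conv (density lborel (\<lambda>x. ennreal (\<rho> x))) k t = (\<integral>x. \<rho> x * k (t - x) \<partial>lborel)"
    unfolding conv_def using assms(3) by (subst integral_real_density) auto
  also have "\<dots> = (\<integral>s. \<rho> (t - s) * k s \<partial>lborel)"
    by (subst lborel_integral_real_affine[where c = "- 1" and t = t]) auto
  finally show ?thesis .
qed

lemma integrable_conv_density:
  fixes \<rho> k :: "real \<Rightarrow> real"
  assumes [measurable]: "\<rho> \<in> borel_measurable borel" "k \<in> borel_measurable borel" and "\<And>x. 0 \<le> \<rho> x"
    and "integrable (density lborel (\<lambda>x. ennreal (\<rho> x))) (\<lambda>x. k (t - x))"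
  shows "integrable lborel (\<lambda>s. \<rho> (t - s) * k s)"
proof -
  have "integrable lborel (\<lambda>x. \<rho> x * k (t - x))"
    using assms(3,4) by (subst (asm) integrable_real_density) auto
  from lborel_integrable_real_affine[OF this, of "- 1" t] show ?thesis by simp
qed

text \<open>A Tauberian step. In the application \<open>exp h * f (t + h) - f t\<close> is the
  integral of exp (s - t) r s over an interval of length h, which monotonicity compares with h times
  r at its ends. First t tends to infinity for a fixed h; the error factors are close to 1 for small
  h.\<close>

lemma tendsto_of_smoothed:
  fixes r f :: "real \<Rightarrow> real"
  assumes r_nonneg: "\<And>t. 0 \<le> r t"
    and lower: "\<And>t h. 0 < h \<Longrightarrow> exp h * f (t + h) - f t \<le> h * exp ((1 + \<alpha>) * h) * r t"
    and upper: "\<And>t h. 0 < h \<Longrightarrow> h * exp (- \<alpha> * h) * r (t + h) \<le> exp h * f (t + h) - f t"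
    and lim: "(f \<longlongrightarrow> L) at_top"
  shows "(r \<longlongrightarrow> L) at_top"
proof (rule tendstoI)
  fix e :: real assume "0 < e"
  have "((\<lambda>h. exp ((1 + \<alpha>) * h) * L) \<longlongrightarrow> exp ((1 + \<alpha>) * 0) * L) (at_right 0)"
    "((\<lambda>h. exp (- ((1 + \<alpha>) * h)) * L) \<longlongrightarrow> exp (- ((1 + \<alpha>) * 0)) * L) (at_right 0)"
    by (intro tendsto_intros)+
  then have "((\<lambda>h. exp ((1 + \<alpha>) * h) * L) \<longlongrightarrow> L) (at_right 0)" "((\<lambda>h. exp (- ((1 + \<alpha>) * h)) * L) \<longlongrightarrow> L) (at_right 0)"
    by simp_all
  then have "\<forall>\<^sub>F h in at_right 0. exp ((1 + \<alpha>) * h) * L < L + e" "\<forall>\<^sub>F h in at_right 0. L - e < exp (- ((1 + \<alpha>) * h)) * L"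
    using \<open>0 < e\<close> by (auto intro: order_tendstoD)
  moreover have "\<forall>\<^sub>F h in at_right (0::real). 0 < h" by (rule eventually_at_right_less)
  ultimately have "\<forall>\<^sub>F h in at_right 0. 0 < h \<and> exp ((1 + \<alpha>) * h) * L < L + e \<and> L - e < exp (- ((1 + \<alpha>) * h)) * L"
    by eventually_elim simp
  then obtain h where h: "0 < h" "exp ((1 + \<alpha>) * h) * L < L + e" "L - e < exp (- ((1 + \<alpha>) * h)) * L"
    using eventually_happens'[OF trivial_limit_at_right_real] by blast
  have lim_shift: "((\<lambda>t. f (t + c)) \<longlongrightarrow> L) at_top" for c
    by (rule filterlim_compose[OF lim]) (use filterlim_tendsto_add_at_top[OF tendsto_const[of c] filterlim_ident] in \<open>simp add: add.commute\<close>)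
  have "((\<lambda>t. exp h * f (t + h) - f t) \<longlongrightarrow> exp h * L - L) at_top" by (intro tendsto_intros lim lim_shift)
  moreover have "0 \<le> exp h * f (t + h) - f t" for t
    using upper[OF h(1), of t] r_nonneg[of "t + h"] h(1) by (smt (verit) exp_gt_zero mult_nonneg_nonneg)
  ultimately have "0 \<le> exp h * L - L" by (intro tendsto_lowerbound) auto
  then have "0 \<le> (exp h - 1) * L" by (simp add: algebra_simps)
  \<comment> \<open>The sign allows the bounds on (exp h - 1) / h to be multiplied by L.\<close>
  then have "0 \<le> L" using h(1) by (simp add: zero_le_mult_iff)
  have exp_bounds: "1 \<le> (exp h - 1) / h" "(exp h - 1) / h \<le> exp h"
  proof -
    show "1 \<le> (exp h - 1) / h" using exp_ge_add_one_self[of h] h(1) by (simp add: field_simps)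
    have "exp h * (1 - h) \<le> exp h * exp (- h)" using exp_ge_add_one_self[of "- h"] by (intro mult_left_mono) auto
    then show "(exp h - 1) / h \<le> exp h" using h(1) by (simp add: exp_minus field_simps)
  qed
  have "((\<lambda>t. exp (\<alpha> * h) / h * (exp h * f (t + 0) - f (t + (- h)))) \<longlongrightarrow> exp (\<alpha> * h) / h * (exp h * L - L)) at_top"
    by (intro tendsto_intros lim_shift)
  moreover have "exp (\<alpha> * h) / h * (exp h * L - L) < L + e"
  proof -
    have "exp (\<alpha> * h) / h * (exp h * L - L) = exp (\<alpha> * h) * ((exp h - 1) / h) * L" by (simp add: field_simps)
    also have "\<dots> \<le> exp (\<alpha> * h) * exp h * L"
      using exp_bounds \<open>0 \<le> L\<close> by (intro mult_right_mono mult_left_mono) auto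
    also have "\<dots> = exp ((1 + \<alpha>) * h) * L" by (simp add: exp_add[symmetric] algebra_simps)
    finally show ?thesis using h by simp
  qed
  ultimately have ev1: "\<forall>\<^sub>F t in at_top. exp (\<alpha> * h) / h * (exp h * f (t + 0) - f (t + (- h))) < L + e"
    by (rule order_tendstoD)
  have "((\<lambda>t. exp (- ((1 + \<alpha>) * h)) / h * (exp h * f (t + h) - f t)) \<longlongrightarrow> exp (- ((1 + \<alpha>) * h)) / h * (exp h * L - L)) at_top"
    by (intro tendsto_intros lim_shift lim)
  moreover have "L - e < exp (- ((1 + \<alpha>) * h)) / h * (exp h * L - L)"
  proof -
    have "exp (- ((1 + \<alpha>) * h)) * 1 * L \<le> exp (- ((1 + \<alpha>) * h)) * ((exp h - 1) / h) * L"
      using exp_bounds \<open>0 \<le> L\<close> by (intro mult_right_mono mult_left_mono) auto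
    also have "\<dots> = exp (- ((1 + \<alpha>) * h)) / h * (exp h * L - L)" by (simp add: field_simps)
    finally show ?thesis using h by simp
  qed
  ultimately have ev2: "\<forall>\<^sub>F t in at_top. L - e < exp (- ((1 + \<alpha>) * h)) / h * (exp h * f (t + h) - f t)"
    by (rule order_tendstoD)
  show "\<forall>\<^sub>F t in at_top. dist (r t) L < e"
    using ev1 ev2
  proof eventually_elim
    case (elim t)
    \<comment> \<open>\<open>upper\<close> controls r at the right end of an interval, so it is
      applied from t - h to t, whereas \<open>lower\<close> is applied from t to t + h.\<close>
    have "h * exp (- \<alpha> * h) * r t \<le> exp h * f t - f (t - h)" using upper[OF h(1), of "t - h"] by simp
    then have "exp (\<alpha> * h) / h * (h * exp (- \<alpha> * h) * r t) \<le> exp (\<alpha> * h) / h * (exp h * f t - f (t - h))"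
      using h(1) by (intro mult_left_mono) auto
    moreover have "exp (\<alpha> * h) / h * (h * exp (- \<alpha> * h) * r t) = r t" using h(1) by (simp add: exp_minus)
    ultimately have up: "r t < L + e" using elim(1) by simp
    have "exp (- ((1 + \<alpha>) * h)) / h * (exp h * f (t + h) - f t)
        \<le> exp (- ((1 + \<alpha>) * h)) / h * (h * exp ((1 + \<alpha>) * h) * r t)"
      using lower[OF h(1), of t] h(1) by (intro mult_left_mono) auto
    also have "\<dots> = r t" using h(1) by (simp add: exp_minus)
    finally show ?case using up elim(2) by (simp add: dist_real_def abs_less_iff)
  qed
qed

lemma has_real_derivative_integral_atMost:
  fixes f :: "real \<Rightarrow> real"
  assumes cont: "\<And>t. isCont f t" and int: "\<And>t. integrable lborel (\<lambda>s. indicator {..t} s * f s)"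
  shows "((\<lambda>t. \<integral>s. indicator {..t} s * f s \<partial>lborel) has_real_derivative f t) (at t)"
proof -
  define F where "F t = (\<integral>s. indicator {..t} s * f s \<partial>lborel)" for t
  \<comment> \<open>A finite base point to the left of t: beyond it the improper integral is a
    proper one plus the constant \<open>F a\<close>.\<close>
  define a where "a = t - 1"
  have cont': "continuous_on A f" for A by (intro continuous_at_imp_continuous_on ballI cont)
  then have [measurable]: "f \<in> borel_measurable borel" by (rule borel_measurable_continuous_onI)
  have eq: "F a + integral {a..x} f = F x" if "a \<le> x" for x
  proof -
    have ind: "indicator {..x} s * f s - indicator {..a} s * f s = indicator {a<..x} s * f s" for s
      using that by (auto simp: indicator_def)
    have "F x - F a = (\<integral>s. indicator {a<..x} s * f s \<partial>lborel)"
      unfolding F_def ind[symmetric] by (rule Bochner_Integration.integral_diff[symmetric]) (rule int)+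
    also have "\<dots> = (LINT s:{a..x}|lborel. f s)"
      unfolding set_lebesgue_integral_def
      by (rule integral_cong_AE) (use AE_lborel_singleton[of a] in \<open>auto simp: indicator_def elim!: eventually_mono\<close>)
    also have "\<dots> = integral {a..x} f"
      by (rule set_borel_integral_eq_integral) (rule borel_integrable_atLeastAtMost', rule cont')
    finally show ?thesis by simp
  qed
  have "((\<lambda>x. integral {a..x} f) has_real_derivative f t) (at t within {a..t + 1})"
    by (rule integral_has_real_derivative) (auto simp: a_def cont')
  then have "((\<lambda>x. integral {a..x} f) has_real_derivative f t) (at t)"
    by (subst (asm) at_within_Icc_at) (simp_all add: a_def)
  from DERIV_add[OF DERIV_const[of "F a"] this]
  have "((\<lambda>x. F a + integral {a..x} f) has_real_derivative f t) (at t)"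
    by simp
  then have "(F has_real_derivative f t) (at t)"
  proof (rule has_field_derivative_transform_within_open)
    show "open {a<..}" "t \<in> {a<..}" by (simp_all add: a_def)
    show "F a + integral {a..x} f = F x" if "x \<in> {a<..}" for x using eq[of x] that by simp
  qed
  then show ?thesis by (simp add: F_def[abs_def])
qed

context renewal_step begin

text \<open>
  Averaging over an independent standard exponential shift turns \<open>r\<close> into a function with the Harnack
  property; monotonicity of \<open>exp (- \<alpha> t) * r t\<close> recovers \<open>r\<close> from its average.
\<close>
theorem renewal_theorem_monotone:
  fixes r g :: "real \<Rightarrow> real"
  assumes "0 < \<alpha>" and r_meas[measurable]: "r \<in> borel_measurable borel" and r_nonneg: "\<And>t. 0 \<le> r t"
    and mono: "\<And>s t. s \<le> t \<Longrightarrow> r t \<le> exp (\<alpha> * (t - s)) * r s"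
    and growth: "\<And>\<delta>. 0 < \<delta> \<Longrightarrow> \<delta> \<le> \<delta>\<^sub>1 \<Longrightarrow> \<exists>K. \<forall>t. r t \<le> K * exp (\<delta> * t)"
    and g: "\<And>t. g t = r t - (\<integral>u. r (t - u) \<partial>\<nu>)" and int_g: "integrable lborel g"
  shows "(r \<longlongrightarrow> (\<integral>t. g t \<partial>lborel) / (\<integral>u. u \<partial>\<nu>)) at_top"
proof -
  obtain K where K: "\<And>t. r t \<le> K * exp (\<delta>\<^sub>1 * t)" using growth[OF delta_pos] by auto
  note rK = r_meas r_nonneg K
  note E = exp_bounded_exp1 note H = exp_bounded_half_line
  have nu: "exp_bounded_conv \<nu> \<delta>" if "0 < \<delta>" "\<delta> \<le> \<delta>\<^sub>1" for \<delta>
    by unfold_locales (use that sets_nu int_exp in auto)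
  note N = nu[OF delta_pos order_refl]
  note E1 = E[OF delta_pos] note H1 = H[OF delta_pos]
  define f where "f = conv exp1 r"
  have f_meas[measurable]: "f \<in> borel_measurable borel"
    unfolding f_def by (rule exp_bounded_conv.conv_measurable[OF E1 rK])
  have f_nonneg: "0 \<le> f t" for t
    unfolding f_def by (rule exp_bounded_conv.conv_nonneg[OF E1 rK])
  have f_growth: "\<exists>K. \<forall>t. f t \<le> K * exp (\<delta> * t)" if \<delta>: "0 < \<delta>" "\<delta> \<le> \<delta>\<^sub>1" for \<delta>
  proof -
    obtain K where "\<And>t. r t \<le> K * exp (\<delta> * t)" using growth[OF \<delta>] by auto
    from exp_bounded_conv.conv_le[OF E[OF \<delta>(1)] r_meas r_nonneg this] show ?thesis unfolding f_def by blast
  qed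
  obtain K' where K': "\<And>t. f t \<le> K' * exp (\<delta>\<^sub>1 * t)" using f_growth[OF delta_pos] by auto
  note fK = f_meas f_nonneg K'
  note exp_def = exponential_density_def
  have int_exp1: "integrable exp1 (\<lambda>x. r (t - x))" for t by (rule exp_bounded_conv.int_conv[OF E1 rK])
  have f_eq: "f t = (\<integral>s. exponential_density 1 (t - s) * r s \<partial>lborel)" for t
    unfolding f_def by (rule conv_density) (auto simp: exponential_density_nonneg)
  have f_int: "integrable lborel (\<lambda>s. exponential_density 1 (t - s) * r s)" for t
    by (rule integrable_conv_density) (auto simp: exponential_density_nonneg int_exp1)
  \<comment> \<open>The factor exp h aligns the two exponential kernels, which then cancel for s
    \<le> t; only the interval from t to t + h remains.\<close>
  have step: "exp h * f (t + h) - f t = (\<integral>s. indicator {t<..t + h} s * (exp (s - t) * r s) \<partial>lborel)"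
    and step_int: "integrable lborel (\<lambda>s. indicator {t<..t + h} s * (exp (s - t) * r s))" if "0 < h" for t h
  proof -
    have *: "exp h * (exponential_density 1 (t + h - s) * r s) - exponential_density 1 (t - s) * r s
        = indicator {t<..t + h} s * (exp (s - t) * r s)" for s
      using that by (auto simp: exp_def indicator_def exp_add[symmetric] mult.assoc[symmetric])
    show "exp h * f (t + h) - f t = (\<integral>s. indicator {t<..t + h} s * (exp (s - t) * r s) \<partial>lborel)"
      unfolding f_eq *[symmetric] using f_int by simp
    show "integrable lborel (\<lambda>s. indicator {t<..t + h} s * (exp (s - t) * r s))"
      unfolding *[symmetric] using f_int by simp
  qed
  have const: "(\<integral>s. indicator {t<..t + h} s * c \<partial>lborel) = h * c" "integrable lborel (\<lambda>s. indicator {t<..t + h} s * c)"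
    if "0 < h" for t h c :: real
    using that by simp_all
  have lower: "exp h * f (t + h) - f t \<le> h * exp ((1 + \<alpha>) * h) * r t" if "0 < h" for t h
  proof -
    have "(\<integral>s. indicator {t<..t + h} s * (exp (s - t) * r s) \<partial>lborel)
        \<le> (\<integral>s. indicator {t<..t + h} s * (exp ((1 + \<alpha>) * h) * r t) \<partial>lborel)"
    proof (rule integral_mono[OF step_int[OF that] const(2)[OF that]])
      fix s
      have "exp (s - t) * r s \<le> exp ((1 + \<alpha>) * h) * r t" if s: "s \<in> {t<..t + h}"
      proof -
        have "exp (s - t) * r s \<le> exp (s - t) * (exp (\<alpha> * (s - t)) * r t)"
          using s by (intro mult_left_mono mono) auto
        also have "\<dots> = exp ((1 + \<alpha>) * (s - t)) * r t" by (simp add: exp_add[symmetric] algebra_simps)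
        also have "\<dots> \<le> exp ((1 + \<alpha>) * h) * r t"
          using s \<open>0 < \<alpha>\<close> r_nonneg mult_left_mono[of "s - t" h "1 + \<alpha>"] by (intro mult_right_mono) auto
        finally show ?thesis .
      qed
      then show "indicator {t<..t + h} s * (exp (s - t) * r s) \<le> indicator {t<..t + h} s * (exp ((1 + \<alpha>) * h) * r t)"
        by (auto simp: indicator_def)
    qed
    then show ?thesis unfolding step[OF that] const(1)[OF that] by (simp add: mult.assoc)
  qed
  have upper: "h * exp (- \<alpha> * h) * r (t + h) \<le> exp h * f (t + h) - f t" if "0 < h" for t h
  proof -
    have "(\<integral>s. indicator {t<..t + h} s * (exp (- \<alpha> * h) * r (t + h)) \<partial>lborel)
        \<le> (\<integral>s. indicator {t<..t + h} s * (exp (s - t) * r s) \<partial>lborel)"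
    proof (rule integral_mono[OF const(2)[OF that] step_int[OF that]])
      fix s
      have "exp (- \<alpha> * h) * r (t + h) \<le> exp (s - t) * r s" if s: "s \<in> {t<..t + h}"
      proof -
        have "exp (- \<alpha> * h) * r (t + h) \<le> exp (- \<alpha> * h) * (exp (\<alpha> * (t + h - s)) * r s)"
          using s by (intro mult_left_mono mono) auto
        also have "\<dots> = exp (\<alpha> * (t - s)) * r s" by (simp add: exp_add[symmetric] algebra_simps)
        also have "\<dots> \<le> exp (s - t) * r s"
        proof (intro mult_right_mono r_nonneg)
          have "\<alpha> * (t - s) \<le> 0" using s \<open>0 < \<alpha>\<close> by (intro mult_nonneg_nonpos) auto
          then show "exp (\<alpha> * (t - s)) \<le> exp (s - t)" using s by simp
        qed
        finally show ?thesis .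
      qed
      then show "indicator {t<..t + h} s * (exp (- \<alpha> * h) * r (t + h)) \<le> indicator {t<..t + h} s * (exp (s - t) * r s)"
        by (auto simp: indicator_def)
    qed
    then show ?thesis unfolding step[OF that] const(1)[OF that] by (simp add: mult.assoc)
  qed
  \<comment> \<open>By \<open>upper\<close>, exp t * f t is nondecreasing.\<close>
  have harnack_lower: "exp (- h) * f t \<le> f (t + h)" if "0 \<le> h" for t h
  proof (cases "h = 0")
    case False
    then have "0 \<le> exp h * f (t + h) - f t"
      using upper[of h t] that r_nonneg[of "t + h"] by (smt (verit) exp_gt_zero mult_nonneg_nonneg)
    then show ?thesis by (simp add: exp_minus field_simps)
  qed simp
  have harnack_upper: "f (t + h) \<le> exp (\<alpha> * h) * f t" if "0 \<le> h" for t h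
  proof -
    have "(\<integral>x. r (t + h - x) \<partial>exp1) \<le> (\<integral>x. exp (\<alpha> * h) * r (t - x) \<partial>exp1)"
      using int_exp1 mono[of "t - x" "t + h - x" for x] that by (intro integral_mono) auto
    then show ?thesis by (simp add: f_def conv_def)
  qed
  obtain \<kappa> where \<kappa>: "0 < \<kappa>" "\<And>t a. \<bar>f (t + a) - f t\<bar> \<le> (exp (\<kappa> * \<bar>a\<bar>) - 1) * f t"
    using harnack_modulus[OF f_nonneg \<open>0 < \<alpha>\<close> harnack_lower harnack_upper] by blast
  have f_cont: "isCont f t" for t
  proof -
    have "((\<lambda>a. (exp (\<kappa> * \<bar>a\<bar>) - 1) * f t) \<longlongrightarrow> (exp (\<kappa> * \<bar>0\<bar>) - 1) * f t) (at 0)"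
      by (intro tendsto_intros)
    then have "((\<lambda>a. (exp (\<kappa> * \<bar>a\<bar>) - 1) * f t) \<longlongrightarrow> 0) (at 0)" by simp
    then have "((\<lambda>a. f (t + a) - f t) \<longlongrightarrow> 0) (at 0)"
      by (rule Lim_null_comparison[rotated]) (use \<kappa>(2) in simp)
    then show ?thesis by (simp add: isCont_iff LIM_zero_iff)
  qed
  define F where "F = conv half_line f"
  have F_eq: "F t = (\<integral>s. indicator {..t} s * f s \<partial>lborel)" for t
  proof -
    have "F t = (\<integral>s. indicator {0..} (t - s) * f s \<partial>lborel)"
      unfolding F_def by (rule conv_density) auto
    also have "\<dots> = (\<integral>s. indicator {..t} s * f s \<partial>lborel)"
      by (rule Bochner_Integration.integral_cong) (auto simp: indicator_def)
    finally show ?thesis .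
  qed
  have F_int: "integrable lborel (\<lambda>s. indicator {..t} s * f s)" for t
  proof -
    have "integrable lborel (\<lambda>s. indicator {0..} (t - s) * f s)"
      by (rule integrable_conv_density) (auto intro: exp_bounded_conv.int_conv[OF H1 fK])
    also have "(\<lambda>s. indicator {0..} (t - s) * f s) = (\<lambda>s. indicator {..t} s * f s)"
      by (auto simp: indicator_def)
    finally show ?thesis .
  qed
  have deriv: "(F has_real_derivative f t) (at t)" for t
    unfolding F_eq[abs_def] by (rule has_real_derivative_integral_atMost[OF f_cont F_int])
  \<comment> \<open>Averaging over \<nu> commutes with the exponential smoothing, so
    \<open>z\<close> is the smoothing of \<open>g\<close>. It therefore tends to 0 and has the same
    integral as \<open>g\<close>.\<close>
  define z where "z t = f t - conv \<nu> f t" for t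
  have g_meas[measurable]: "g \<in> borel_measurable borel" using int_g by auto
  note nuK = exp_bounded_conv.conv_measurable[OF N rK] exp_bounded_conv.conv_nonneg[OF N rK]
    exp_bounded_conv.conv_le[OF N rK]
  note nufK = exp_bounded_conv.conv_measurable[OF N fK] exp_bounded_conv.conv_nonneg[OF N fK]
    exp_bounded_conv.conv_le[OF N fK]
  have z_eq: "z t = (\<integral>x. g (t - x) \<partial>exp1)" for t
  proof -
    have "conv \<nu> f t = conv exp1 (conv \<nu> r) t"
      unfolding f_def by (rule conv_commute[OF N E1 rK])
    then have "z t = (\<integral>x. r (t - x) \<partial>exp1) - (\<integral>x. conv \<nu> r (t - x) \<partial>exp1)"
      by (simp add: z_def f_def conv_def[of exp1])
    also have "\<dots> = (\<integral>x. r (t - x) - conv \<nu> r (t - x) \<partial>exp1)"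
      by (rule Bochner_Integration.integral_diff[symmetric, OF int_exp1 exp_bounded_conv.int_conv[OF E1 nuK]])
    finally show ?thesis by (simp add: g conv_def)
  qed
  have z_lborel: "z t = (\<integral>s. exponential_density 1 (t - s) * g s \<partial>lborel)" for t
    unfolding z_eq conv_def[symmetric] by (rule conv_density) (auto simp: exponential_density_nonneg)
  have z_lim: "(z \<longlongrightarrow> 0) at_top"
  proof -
    have "((\<lambda>t. \<integral>s. exponential_density 1 (t - s) * g s \<partial>lborel) \<longlongrightarrow> (\<integral>s. 0 \<partial>(lborel :: real measure))) at_top"
    proof (rule integral_dominated_convergence_at_top)
      show "integrable lborel (\<lambda>s. \<bar>g s\<bar>)" using int_g by simp
      show "\<forall>\<^sub>F t in at_top. AE s in lborel. norm (exponential_density 1 (t - s) * g s) \<le> \<bar>g s\<bar>"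
        by (intro always_eventually allI AE_I2) (auto simp: exp_def abs_mult intro!: mult_left_le_one_le)
      show "AE s in lborel. ((\<lambda>t. exponential_density 1 (t - s) * g s) \<longlongrightarrow> 0) at_top"
      proof (rule AE_I2)
        fix s :: real
        have "((\<lambda>t. exp (s - t) * g s) \<longlongrightarrow> 0 * g s) at_top"
        proof (intro tendsto_intros filterlim_compose[OF exp_at_bot])
          show "LIM t at_top. s - t :> at_bot"
            unfolding filterlim_at_bot
          proof
            fix Z
            show "\<forall>\<^sub>F t in at_top. s - t \<le> Z" using eventually_ge_at_top[of "s - Z"] by eventually_elim simp
          qed
        qed
        moreover have "\<forall>\<^sub>F t in at_top. exp (s - t) * g s = exponential_density 1 (t - s) * g s"
          using eventually_ge_at_top[of s] by eventually_elim (simp add: exp_def)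
        ultimately show "((\<lambda>t. exponential_density 1 (t - s) * g s) \<longlongrightarrow> 0) at_top"
          by (simp add: tendsto_cong)
      qed
    qed auto
    then show ?thesis by (simp add: z_lborel[abs_def])
  qed
  interpret e: prob_space exp1 by (rule prob_space_exponential_density) simp
  interpret P: pair_sigma_finite exp1 lborel
    by (intro pair_sigma_finite.intro e.sigma_finite_measure_axioms sigma_finite_lborel)
  have shift_g: "integrable lborel (\<lambda>t. g (t - x))" "(\<integral>t. g (t - x) \<partial>lborel) = (\<integral>t. g t \<partial>lborel)"
    "(\<integral>t. \<bar>g (t - x)\<bar> \<partial>lborel) = (\<integral>t. \<bar>g t\<bar> \<partial>lborel)" for x
    using lborel_integrable_real_affine[OF int_g, of 1 "- x"]
      lborel_integral_real_affine[of 1 g "- x"] lborel_integral_real_affine[of 1 "\<lambda>t. \<bar>g t\<bar>" "- x"] by simp_all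
  have pair_int: "integrable (exp1 \<Otimes>\<^sub>M lborel) (\<lambda>(x, t). g (t - x))"
    by (rule P.Fubini_integrable) (use shift_g in auto)
  have z_int: "integrable lborel z"
    using P.integrable_snd[OF pair_int] by (simp add: z_eq[abs_def])
  have z_integral: "(\<integral>t. z t \<partial>lborel) = (\<integral>t. g t \<partial>lborel)"
    using P.Fubini_integral[OF pair_int] e.prob_space by (simp add: z_eq shift_g)
  have conserved: "((\<lambda>t. \<integral>u. F t - F (t - u) \<partial>\<nu>) \<longlongrightarrow> (\<integral>t. g t \<partial>lborel)) at_top"
  proof -
    \<comment> \<open>The antiderivative inherits the equation: \<open>F\<close> minus its average
      over \<nu> is the integral of \<open>z\<close> up to t.\<close>
    have F_diff: "(\<integral>u. F t - F (t - u) \<partial>\<nu>) = (\<integral>s. indicator {..t} s * z s \<partial>lborel)" for t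
    proof -
      note FK = exp_bounded_conv.conv_measurable[OF H1 fK] exp_bounded_conv.conv_nonneg[OF H1 fK]
        exp_bounded_conv.conv_le[OF H1 fK]
      have "(\<integral>u. F t - F (t - u) \<partial>\<nu>) = F t - conv \<nu> F t"
        unfolding conv_def using exp_bounded_conv.int_conv[OF N FK] by (simp add: F_def prob_space)
      also have "conv \<nu> F t = conv half_line (conv \<nu> f) t"
        unfolding F_def by (rule conv_commute[OF N H1 fK])
      also have "F t - conv half_line (conv \<nu> f) t = (\<integral>x. f (t - x) - conv \<nu> f (t - x) \<partial>half_line)"
        unfolding F_def conv_def[of half_line]
        by (rule Bochner_Integration.integral_diff[symmetric, OF exp_bounded_conv.int_conv[OF H1 fK] exp_bounded_conv.int_conv[OF H1 nufK]])
      also have "\<dots> = conv half_line z t" by (simp add: z_def conv_def[of half_line])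
      also have "\<dots> = (\<integral>s. indicator {0..} (t - s) * z s \<partial>lborel)"
        using z_int by (intro conv_density) auto
      also have "\<dots> = (\<integral>s. indicator {..t} s * z s \<partial>lborel)"
        by (rule Bochner_Integration.integral_cong) (auto simp: indicator_def)
      finally show ?thesis .
    qed
    have "((\<lambda>t. \<integral>s. indicator {..t} s * z s \<partial>lborel) \<longlongrightarrow> (\<integral>s. z s \<partial>lborel)) at_top"
    proof (rule integral_dominated_convergence_at_top)
      show "integrable lborel (\<lambda>s. \<bar>z s\<bar>)" using z_int by simp
      show "\<forall>\<^sub>F t in at_top. AE s in lborel. norm (indicator {..t} s * z s) \<le> \<bar>z s\<bar>"
        by (intro always_eventually allI AE_I2) (auto simp: indicator_def)
      show "AE s in lborel. ((\<lambda>t. indicator {..t} s * z s) \<longlongrightarrow> z s) at_top"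
      proof (rule AE_I2)
        fix s
        have "\<forall>\<^sub>F t in at_top. indicator {..t} s * z s = z s"
          using eventually_ge_at_top[of s] by eventually_elim simp
        then show "((\<lambda>t. indicator {..t} s * z s) \<longlongrightarrow> z s) at_top" by (rule tendsto_eventually)
      qed
    qed (use z_int in auto)
    then show ?thesis unfolding F_diff z_integral .
  qed
  interpret harnack_renewal \<nu> \<delta>\<^sub>1 f F \<alpha> "\<integral>t. g t \<partial>lborel"
    by unfold_locales
      (fact \<open>0 < \<alpha>\<close> f_meas f_nonneg harnack_lower harnack_upper f_growth deriv conserved z_lim[unfolded z_def[abs_def] conv_def])+
  show ?thesis
    by (rule tendsto_of_smoothed[OF r_nonneg lower upper tendsto_renewal_limit])
qed

end

section \<open>Random weights and the tilted step distribution\<close>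

lemma borel_measurable_ennreal_powr [measurable]: "(\<lambda>x. ennreal_powr x a) \<in> borel_measurable borel"
  unfolding ennreal_powr_def by measurable

lemma ennreal_powr_ennreal: "0 \<le> x \<Longrightarrow> ennreal_powr (ennreal x) a = ennreal (x powr a)"
  by (simp add: ennreal_powr_def)

lemma ennreal_powr_mono: "0 \<le> a \<Longrightarrow> x \<le> y \<Longrightarrow> ennreal_powr x a \<le> ennreal_powr y a"
  unfolding ennreal_powr_def
  by (cases x; cases y) (auto simp: top_unique intro!: ennreal_leI powr_mono2)

lemma ennreal_le_suminf: "f j \<le> (\<Sum>i. f i)" for f :: "nat \<Rightarrow> ennreal"
  using sum_le_suminf[of f "{j}"] by simp

lemma integrable_enn2real_finite:
  assumes [measurable]: "f \<in> borel_measurable M" and "(\<integral>\<^sup>+x. f x \<partial>M) < \<infinity>"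
  shows "integrable M (\<lambda>x. enn2real (f x))"
proof (rule integrableI_nonneg)
  have "(\<integral>\<^sup>+x. ennreal (enn2real (f x)) \<partial>M) \<le> (\<integral>\<^sup>+x. f x \<partial>M)"
    by (rule nn_integral_mono) (simp add: ennreal_enn2real_if)
  then show "(\<integral>\<^sup>+x. ennreal (enn2real (f x)) \<partial>M) < \<infinity>" using assms(2) by (rule le_less_trans)
qed auto

text \<open>Children are indexed from 0 and weights beyond the last child will be 0, so sums run
  over all indices. The exponent \<open>\<beta>\<^sub>0\<close> unites the two moment conditions: it
  is 1 for \<alpha> > 1 and \<alpha> / (1 + \<epsilon>) otherwise.\<close>

locale random_weights = prob_space M for M :: "'a measure" +
  fixes c :: "nat \<Rightarrow> 'a \<Rightarrow> real" and \<alpha> \<beta>\<^sub>0 :: real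
  assumes c_meas[measurable]: "\<And>i. c i \<in> borel_measurable M"
    and c_nonneg: "\<And>i \<omega>. 0 \<le> c i \<omega>"
    and beta0: "0 < \<beta>\<^sub>0" "\<beta>\<^sub>0 < \<alpha>"
    and sum_one: "(\<integral>\<^sup>+\<omega>. (\<Sum>i. ennreal (c i \<omega> powr \<alpha>)) \<partial>M) = 1"
    and moment: "(\<integral>\<^sup>+\<omega>. ennreal_powr (\<Sum>i. ennreal (c i \<omega> powr \<beta>\<^sub>0)) (\<alpha> / \<beta>\<^sub>0) \<partial>M) < \<infinity>"
    and log_integrable: "integrable M (\<lambda>\<omega>. \<Sum>i. c i \<omega> powr \<alpha> * ln (c i \<omega>))"
    and log_pos: "0 < (\<integral>\<omega>. (\<Sum>i. c i \<omega> powr \<alpha> * ln (c i \<omega>)) \<partial>M)"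
    and nonarith: "\<exists>j. \<forall>d>0. \<not> (AE \<omega> in M. 0 < c j \<omega> \<longrightarrow> ln (c j \<omega>) \<in> range (\<lambda>k::int. d * of_int k))"
begin

lemma alpha_pos: "0 < \<alpha>" using beta0 by simp

definition \<phi> :: "real \<Rightarrow> ennreal" where
  "\<phi> \<beta> = (\<integral>\<^sup>+\<omega>. (\<Sum>i. ennreal (c i \<omega> powr \<beta>)) \<partial>M)"

text \<open>Monotonicity of sequence norms. If S is the sum of the powers of order
  \<open>\<beta>\<^sub>0\<close>, each of these powers is at most S, so the sum of the powers of
  order \<beta> is at most S to the power \<open>\<beta> / \<beta>\<^sub>0\<close>.\<close>

lemma moment_beta:
  assumes "\<beta>\<^sub>0 \<le> \<beta>" "\<beta> \<le> \<alpha>"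
  shows "(\<integral>\<^sup>+\<omega>. ennreal_powr (\<Sum>i. ennreal (c i \<omega> powr \<beta>)) (\<alpha> / \<beta>) \<partial>M) < \<infinity>"
proof -
  have "ennreal_powr (\<Sum>i. ennreal (c i \<omega> powr \<beta>)) (\<alpha> / \<beta>) \<le> ennreal_powr (\<Sum>i. ennreal (c i \<omega> powr \<beta>\<^sub>0)) (\<alpha> / \<beta>\<^sub>0)" for \<omega>
  proof (cases "(\<Sum>i. ennreal (c i \<omega> powr \<beta>\<^sub>0)) = \<infinity>")
    case True
    then show ?thesis by (simp add: ennreal_powr_def)
  next
    case False
    define S where "S = enn2real (\<Sum>i. ennreal (c i \<omega> powr \<beta>\<^sub>0))"
    have S: "(\<Sum>i. ennreal (c i \<omega> powr \<beta>\<^sub>0)) = ennreal S" "0 \<le> S"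
      using False by (auto simp: S_def less_top)
    have le: "c i \<omega> powr \<beta>\<^sub>0 \<le> S" for i
    proof -
      have "ennreal (c i \<omega> powr \<beta>\<^sub>0) \<le> ennreal S"
        unfolding S(1)[symmetric] by (rule ennreal_le_suminf)
      then show ?thesis using S(2) by simp
    qed
    have "(\<Sum>i. ennreal (c i \<omega> powr \<beta>)) \<le> (\<Sum>i. ennreal (S powr (\<beta> / \<beta>\<^sub>0 - 1)) * ennreal (c i \<omega> powr \<beta>\<^sub>0))"
    proof (rule suminf_le)
      fix i
      have "c i \<omega> powr \<beta> = (c i \<omega> powr \<beta>\<^sub>0) powr (\<beta> / \<beta>\<^sub>0 - 1) * c i \<omega> powr \<beta>\<^sub>0"
        using beta0 by (cases "c i \<omega> = 0") (auto simp: powr_powr powr_add[symmetric] field_simps)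
      also have "\<dots> \<le> S powr (\<beta> / \<beta>\<^sub>0 - 1) * c i \<omega> powr \<beta>\<^sub>0"
        using assms beta0 le[of i] by (intro mult_right_mono powr_mono2) auto
      finally show "ennreal (c i \<omega> powr \<beta>) \<le> ennreal (S powr (\<beta> / \<beta>\<^sub>0 - 1)) * ennreal (c i \<omega> powr \<beta>\<^sub>0)"
        by (simp add: ennreal_mult[symmetric] ennreal_leI)
    qed auto
    also have "\<dots> = ennreal (S powr (\<beta> / \<beta>\<^sub>0 - 1) * S)"
      using S by (simp add: ennreal_mult)
    also have "S powr (\<beta> / \<beta>\<^sub>0 - 1) * S = S powr (\<beta> / \<beta>\<^sub>0)"
      using S(2) by (cases "S = 0") (auto simp: powr_diff)
    finally have "ennreal_powr (\<Sum>i. ennreal (c i \<omega> powr \<beta>)) (\<alpha> / \<beta>) \<le> ennreal_powr (ennreal (S powr (\<beta> / \<beta>\<^sub>0))) (\<alpha> / \<beta>)"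
      using assms beta0 by (intro ennreal_powr_mono) auto
    also have "\<dots> = ennreal_powr (\<Sum>i. ennreal (c i \<omega> powr \<beta>\<^sub>0)) (\<alpha> / \<beta>\<^sub>0)"
      using assms beta0 S by (simp add: ennreal_powr_ennreal powr_powr)
    finally show ?thesis .
  qed
  then show ?thesis by (rule le_less_trans[OF nn_integral_mono moment])
qed

lemma \<phi>_finite:
  assumes "\<beta>\<^sub>0 \<le> \<beta>" "\<beta> \<le> \<alpha>"
  shows "\<phi> \<beta> < \<infinity>"
proof -
  have "x \<le> 1 + ennreal_powr x (\<alpha> / \<beta>)" for x
  proof (cases x)
    case (real y)
    have "y \<le> 1 + y powr (\<alpha> / \<beta>)"
    proof (cases "y \<le> 1")
      case False
      then have "y powr 1 \<le> y powr (\<alpha> / \<beta>)" using assms beta0 by (intro powr_mono) auto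
      then show ?thesis using False by simp
    qed (simp add: add_increasing2)
    then show ?thesis using real by (simp add: ennreal_powr_ennreal ennreal_1[symmetric] ennreal_plus[symmetric] del: ennreal_1 ennreal_plus)
  qed (simp add: ennreal_powr_def)
  then have "\<phi> \<beta> \<le> (\<integral>\<^sup>+\<omega>. 1 + ennreal_powr (\<Sum>i. ennreal (c i \<omega> powr \<beta>)) (\<alpha> / \<beta>) \<partial>M)"
    unfolding \<phi>_def by (intro nn_integral_mono)
  also have "\<dots> = 1 + (\<integral>\<^sup>+\<omega>. ennreal_powr (\<Sum>i. ennreal (c i \<omega> powr \<beta>)) (\<alpha> / \<beta>) \<partial>M)"
    by (subst nn_integral_add) (auto simp: emeasure_space_1)
  also have "\<dots> < \<infinity>" using moment_beta[OF assms] by simp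
  finally show ?thesis .
qed

text \<open>Tilting by \<open>c\<^sup>\<alpha>\<close> turns the recursion for the tail into a renewal equation with step distribution \<open>\<nu>\<close>.\<close>
definition \<nu> :: "real measure" where
  "\<nu> = distr (density (M \<Otimes>\<^sub>M count_space UNIV) (\<lambda>(\<omega>, i). ennreal (c i \<omega> powr \<alpha>))) borel (\<lambda>(\<omega>, i). ln (c i \<omega>))"

lemma sets_\<nu> [measurable_cong]: "sets \<nu> = sets borel" and space_\<nu> [simp]: "space \<nu> = UNIV"
  by (simp_all add: \<nu>_def)

lemma measurable_c_pair [measurable]: "(\<lambda>(\<omega>, i). c i \<omega>) \<in> borel_measurable (M \<Otimes>\<^sub>M count_space UNIV)"
  unfolding case_prod_unfold by (rule measurable_compose_countable[where f = "\<lambda>i z. c i (fst z)" and g = snd]) auto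

lemma nn_integral_\<nu>:
  assumes [measurable]: "k \<in> borel_measurable borel"
  shows "(\<integral>\<^sup>+u. k u \<partial>\<nu>) = (\<integral>\<^sup>+\<omega>. (\<Sum>i. ennreal (c i \<omega> powr \<alpha>) * k (ln (c i \<omega>))) \<partial>M)"
proof -
  interpret C: sigma_finite_measure "count_space (UNIV :: nat set)"
    by (rule sigma_finite_measure_count_space)
  have m1[measurable]: "(\<lambda>(\<omega>, i). ln (c i \<omega>)) \<in> borel_measurable (M \<Otimes>\<^sub>M count_space UNIV)"
    using borel_measurable_ln[OF measurable_c_pair] by (simp add: case_prod_unfold)
  have m2[measurable]: "(\<lambda>(\<omega>, i). ennreal (c i \<omega> powr \<alpha>)) \<in> borel_measurable (M \<Otimes>\<^sub>M count_space UNIV)"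
    using measurable_c_pair by (simp add: case_prod_unfold)
  have "(\<integral>\<^sup>+u. k u \<partial>\<nu>) = (\<integral>\<^sup>+z. (case z of (\<omega>, i) \<Rightarrow> ennreal (c i \<omega> powr \<alpha>)) * k (case z of (\<omega>, i) \<Rightarrow> ln (c i \<omega>)) \<partial>(M \<Otimes>\<^sub>M count_space UNIV))"
    unfolding \<nu>_def by (subst nn_integral_distr) (auto simp: nn_integral_density)
  also have "\<dots> = (\<integral>\<^sup>+\<omega>. \<integral>\<^sup>+i. ennreal (c i \<omega> powr \<alpha>) * k (ln (c i \<omega>)) \<partial>count_space UNIV \<partial>M)"
    by (subst C.nn_integral_fst[symmetric]) auto
  finally show ?thesis by (simp add: nn_integral_count_space_nat)
qed

lemma prob_space_\<nu>: "prob_space \<nu>"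
proof
  have "emeasure \<nu> (space \<nu>) = (\<integral>\<^sup>+u. 1 \<partial>\<nu>)" by simp
  also have "\<dots> = 1" using sum_one by (subst nn_integral_\<nu>) auto
  finally show "emeasure \<nu> (space \<nu>) = 1" .
qed

text \<open>On c j > 0 the contribution of index j to \<nu> has the positive density c j powr
  \<alpha>, so a lattice that carries \<nu> carries ln (c j) almost surely there.\<close>

lemma nonarith_\<nu>:
  assumes "0 < d"
  shows "\<not> (AE x in \<nu>. x \<in> range (\<lambda>k::int. d * of_int k))"
proof
  define Z where "Z = range (\<lambda>k::int. d * of_int k)"
  assume "AE x in \<nu>. x \<in> range (\<lambda>k::int. d * of_int k)"
  then have AE: "AE x in \<nu>. x \<in> Z" by (simp add: Z_def)
  have "countable Z" by (simp add: Z_def)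
  then have [measurable]: "Z \<in> sets borel" by (rule sets.countable[rotated]) auto
  have "(\<integral>\<^sup>+u. indicator (- Z) u \<partial>\<nu>) = (\<integral>\<^sup>+u. 0 \<partial>\<nu>)"
    by (rule nn_integral_cong_AE) (use AE in \<open>auto simp: indicator_def elim!: eventually_mono\<close>)
  then have "(\<integral>\<^sup>+\<omega>. (\<Sum>i. ennreal (c i \<omega> powr \<alpha>) * indicator (- Z) (ln (c i \<omega>))) \<partial>M) = 0"
    by (subst (asm) nn_integral_\<nu>) auto
  then have AE0: "AE \<omega> in M. (\<Sum>i. ennreal (c i \<omega> powr \<alpha>) * indicator (- Z) (ln (c i \<omega>))) = 0"
    by (subst (asm) nn_integral_0_iff_AE) auto
  obtain j where j: "\<And>d. 0 < d \<Longrightarrow> \<not> (AE \<omega> in M. 0 < c j \<omega> \<longrightarrow> ln (c j \<omega>) \<in> range (\<lambda>k::int. d * of_int k))"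
    using nonarith by blast
  have "AE \<omega> in M. 0 < c j \<omega> \<longrightarrow> ln (c j \<omega>) \<in> Z"
    using AE0
  proof eventually_elim
    case (elim \<omega>)
    have "ennreal (c j \<omega> powr \<alpha>) * indicator (- Z) (ln (c j \<omega>)) \<le> 0"
      unfolding elim[symmetric] by (rule ennreal_le_suminf)
    then show ?case by (auto simp: indicator_def split: if_splits)
  qed
  then show False using j[OF assms] by (simp add: Z_def)
qed

lemma nn_integral_exp_\<nu>: "(\<integral>\<^sup>+u. ennreal (exp (- \<delta> * u)) \<partial>\<nu>) = \<phi> (\<alpha> - \<delta>)"
proof -
  have "ennreal (c i \<omega> powr \<alpha>) * ennreal (exp (- \<delta> * ln (c i \<omega>))) = ennreal (c i \<omega> powr (\<alpha> - \<delta>))" for i \<omega>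
    using c_nonneg[of i \<omega>]
    by (cases "c i \<omega> = 0") (simp_all add: ennreal_mult[symmetric] powr_def exp_add[symmetric] algebra_simps)
  then show ?thesis by (subst nn_integral_\<nu>) (auto simp: \<phi>_def)
qed

lemma integrable_exp_\<nu>:
  assumes "0 \<le> \<delta>" "\<delta> \<le> \<alpha> - \<beta>\<^sub>0"
  shows "integrable \<nu> (\<lambda>u. exp (- \<delta> * u))"
  by (rule integrableI_nonneg) (use \<phi>_finite[of "\<alpha> - \<delta>"] assms in \<open>auto simp: nn_integral_exp_\<nu>[simplified]\<close>)

lemma AE_sum_finite:
  assumes "\<beta>\<^sub>0 \<le> \<beta>" "\<beta> \<le> \<alpha>"
  shows "AE \<omega> in M. (\<Sum>i. ennreal (c i \<omega> powr \<beta>)) \<noteq> \<infinity>"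
  by (rule nn_integral_PInf_AE) (use \<phi>_finite[OF assms] in \<open>auto simp: \<phi>_def\<close>)

text \<open>The terms of the series have both signs, and only its sum is assumed integrable. The
  negative part has finite mean by the exponential moment of \<nu>. Where the c i powr \<alpha> are
  summable, only finitely many c i exceed 1, so the positive part is a finite sum; it is then
  bounded by the modulus of the total plus the negative part.\<close>

lemma integrable_id_\<nu>: "integrable \<nu> (\<lambda>u. u)"
  and integral_id_\<nu>: "(\<integral>u. u \<partial>\<nu>) = (\<integral>\<omega>. (\<Sum>i. c i \<omega> powr \<alpha> * ln (c i \<omega>)) \<partial>M)"
proof -
  define P where "P \<omega> = (\<Sum>i. ennreal (c i \<omega> powr \<alpha>) * ennreal (ln (c i \<omega>)))" for \<omega>
  define N where "N \<omega> = (\<Sum>i. ennreal (c i \<omega> powr \<alpha>) * ennreal (- ln (c i \<omega>)))" for \<omega>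
  have [measurable]: "P \<in> borel_measurable M" "N \<in> borel_measurable M" unfolding P_def N_def by measurable
  define \<delta> where "\<delta> = \<alpha> - \<beta>\<^sub>0"
  have "0 < \<delta>" using beta0 by (simp add: \<delta>_def)
  have intP: "(\<integral>\<^sup>+u. ennreal u \<partial>\<nu>) = (\<integral>\<^sup>+\<omega>. P \<omega> \<partial>M)" unfolding P_def by (rule nn_integral_\<nu>) simp
  have intN: "(\<integral>\<^sup>+u. ennreal (- u) \<partial>\<nu>) = (\<integral>\<^sup>+\<omega>. N \<omega> \<partial>M)" unfolding N_def by (rule nn_integral_\<nu>) simp
  have N_finite: "(\<integral>\<^sup>+\<omega>. N \<omega> \<partial>M) < \<infinity>"
  proof -
    have "(\<integral>\<^sup>+u. ennreal (- u) \<partial>\<nu>) \<le> (\<integral>\<^sup>+u. ennreal (1 / \<delta>) * ennreal (exp (- \<delta> * u)) \<partial>\<nu>)"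
    proof (rule nn_integral_mono)
      fix u
      have "- u \<le> 1 / \<delta> * exp (- \<delta> * u)"
        using exp_ge_add_one_self[of "- \<delta> * u"] \<open>0 < \<delta>\<close> by (simp add: field_simps)
      then show "ennreal (- u) \<le> ennreal (1 / \<delta>) * ennreal (exp (- \<delta> * u))"
        using \<open>0 < \<delta>\<close> by (subst ennreal_mult[symmetric]) (auto intro: ennreal_leI)
    qed
    also have "\<dots> = ennreal (1 / \<delta>) * \<phi> \<beta>\<^sub>0"
      by (subst nn_integral_cmult) (simp_all only: nn_integral_exp_\<nu>, simp_all add: \<delta>_def)
    also have "\<dots> < \<infinity>" using \<phi>_finite[of \<beta>\<^sub>0] beta0 by (simp add: ennreal_mult_less_top)
    finally show ?thesis by (simp add: intN)
  qed
  have AE_N: "AE \<omega> in M. N \<omega> \<noteq> \<infinity>" by (rule nn_integral_PInf_AE) (use N_finite in auto)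
  have AE_eq: "AE \<omega> in M. P \<omega> < \<infinity> \<and> N \<omega> < \<infinity> \<and> (\<Sum>i. c i \<omega> powr \<alpha> * ln (c i \<omega>)) = enn2real (P \<omega>) - enn2real (N \<omega>)"
    using AE_N AE_sum_finite[OF less_imp_le[OF beta0(2)] order_refl]
  proof eventually_elim
    case (elim \<omega>)
    define p where "p i = c i \<omega> powr \<alpha> * max 0 (ln (c i \<omega>))" for i
    define n where "n i = c i \<omega> powr \<alpha> * max 0 (- ln (c i \<omega>))" for i
    have pn: "0 \<le> p i" "0 \<le> n i" "p i - n i = c i \<omega> powr \<alpha> * ln (c i \<omega>)" for i
      by (auto simp: p_def n_def max_def)
    have P_eq: "P \<omega> = (\<Sum>i. ennreal (p i))" and N_eq: "N \<omega> = (\<Sum>i. ennreal (n i))"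
      unfolding P_def N_def p_def n_def by (simp_all add: ennreal_mult ennreal_max_0)
    have "summable (\<lambda>i. c i \<omega> powr \<alpha>)"
      using elim(2) by (intro summable_suminf_not_top) auto
    then have "(\<lambda>i. c i \<omega> powr \<alpha>) \<longlonglongrightarrow> 0" by (rule summable_LIMSEQ_zero)
    then have "\<forall>\<^sub>F i in sequentially. c i \<omega> powr \<alpha> < 1" by (rule order_tendstoD) simp
    then have "\<forall>\<^sub>F i in sequentially. p i = 0"
    proof eventually_elim
      case (elim i)
      have "c i \<omega> \<le> 1"
      proof (rule ccontr)
        assume "\<not> c i \<omega> \<le> 1"
        then have "1 powr \<alpha> < c i \<omega> powr \<alpha>" using alpha_pos by (intro powr_less_mono2) auto
        then show False using elim by simp
      qed
      then have "ln (c i \<omega>) \<le> 0" using c_nonneg[of i \<omega>] by (cases "c i \<omega> = 0") auto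
      then show ?case by (simp add: p_def)
    qed
    then obtain n0 where "\<And>i. n0 \<le> i \<Longrightarrow> p i = 0" by (auto simp: eventually_sequentially)
    then have sp: "summable p" by (intro summable_finite[of "{..<n0}"]) (auto simp: not_less)
    have sn: "summable n" using elim(1) pn unfolding N_eq by (intro summable_suminf_not_top) auto
    have "(\<Sum>i. c i \<omega> powr \<alpha> * ln (c i \<omega>)) = suminf p - suminf n"
      using suminf_diff[OF sp sn] by (simp add: pn)
    moreover have "P \<omega> = ennreal (suminf p)" "N \<omega> = ennreal (suminf n)"
      unfolding P_eq N_eq using sp sn pn by (auto intro: suminf_ennreal2)
    ultimately show ?case using suminf_nonneg[OF sp] suminf_nonneg[OF sn] pn by simp
  qed
  have P_finite: "(\<integral>\<^sup>+\<omega>. P \<omega> \<partial>M) < \<infinity>"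
  proof -
    have "(\<integral>\<^sup>+\<omega>. P \<omega> \<partial>M) \<le> (\<integral>\<^sup>+\<omega>. ennreal \<bar>\<Sum>i. c i \<omega> powr \<alpha> * ln (c i \<omega>)\<bar> + N \<omega> \<partial>M)"
    proof (rule nn_integral_mono_AE)
      show "AE \<omega> in M. P \<omega> \<le> ennreal \<bar>\<Sum>i. c i \<omega> powr \<alpha> * ln (c i \<omega>)\<bar> + N \<omega>"
        using AE_eq
      proof eventually_elim
        case (elim \<omega>)
        then show ?case by (cases "P \<omega>"; cases "N \<omega>") (auto simp: ennreal_plus[symmetric] simp del: ennreal_plus intro!: ennreal_leI)
      qed
    qed
    also have "\<dots> = (\<integral>\<^sup>+\<omega>. ennreal \<bar>\<Sum>i. c i \<omega> powr \<alpha> * ln (c i \<omega>)\<bar> \<partial>M) + (\<integral>\<^sup>+\<omega>. N \<omega> \<partial>M)"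
      using log_integrable by (intro nn_integral_add) auto
    also have "\<dots> < \<infinity>" using N_finite log_integrable by (simp add: integrable_iff_bounded)
    finally show ?thesis .
  qed
  show int: "integrable \<nu> (\<lambda>u. u)"
  proof (rule integrableI_bounded)
    have "(\<integral>\<^sup>+u. ennreal (norm u) \<partial>\<nu>) = (\<integral>\<^sup>+u. ennreal u + ennreal (- u) \<partial>\<nu>)"
      by (rule nn_integral_cong) (auto simp: abs_if ennreal_neg)
    also have "\<dots> = (\<integral>\<^sup>+\<omega>. P \<omega> \<partial>M) + (\<integral>\<^sup>+\<omega>. N \<omega> \<partial>M)"
      by (subst nn_integral_add) (auto simp: intP intN)
    also have "\<dots> < \<infinity>" using P_finite N_finite by simp
    finally show "(\<integral>\<^sup>+u. ennreal (norm u) \<partial>\<nu>) < \<infinity>" .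
  qed simp
  have "(\<integral>u. u \<partial>\<nu>) = enn2real (\<integral>\<^sup>+\<omega>. P \<omega> \<partial>M) - enn2real (\<integral>\<^sup>+\<omega>. N \<omega> \<partial>M)"
    unfolding real_lebesgue_integral_def[OF int] intP intN ..
  also have "enn2real (\<integral>\<^sup>+\<omega>. P \<omega> \<partial>M) = (\<integral>\<omega>. enn2real (P \<omega>) \<partial>M)"
    by (rule enn2real_nn_integral_eq_integral) (use P_finite AE_eq in auto)
  also have "enn2real (\<integral>\<^sup>+\<omega>. N \<omega> \<partial>M) = (\<integral>\<omega>. enn2real (N \<omega>) \<partial>M)"
    by (rule enn2real_nn_integral_eq_integral) (use N_finite AE_eq in auto)
  also have "(\<integral>\<omega>. enn2real (P \<omega>) \<partial>M) - (\<integral>\<omega>. enn2real (N \<omega>) \<partial>M) = (\<integral>\<omega>. enn2real (P \<omega>) - enn2real (N \<omega>) \<partial>M)"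
    using P_finite N_finite by (intro Bochner_Integration.integral_diff[symmetric] integrable_enn2real_finite) auto
  also have "\<dots> = (\<integral>\<omega>. (\<Sum>i. c i \<omega> powr \<alpha> * ln (c i \<omega>)) \<partial>M)"
    by (rule integral_cong_AE) (use AE_eq log_integrable in auto)
  finally show "(\<integral>u. u \<partial>\<nu>) = (\<integral>\<omega>. (\<Sum>i. c i \<omega> powr \<alpha> * ln (c i \<omega>)) \<partial>M)" .
qed

text \<open>
  The difference quotients of \<open>\<phi>\<close> at \<open>\<alpha>\<close> tend to the positive mean of \<open>\<nu>\<close>, so \<open>\<phi>\<close> is below \<open>1\<close> at
  some \<open>\<alpha> - \<delta>\<close>; convexity does the rest.
\<close>
lemma \<phi>_less_1:
  obtains \<delta>\<^sub>1 where "0 < \<delta>\<^sub>1" "\<delta>\<^sub>1 \<le> \<alpha> - \<beta>\<^sub>0" "\<And>\<delta>. 0 < \<delta> \<Longrightarrow> \<delta> \<le> \<delta>\<^sub>1 \<Longrightarrow> \<phi> (\<alpha> - \<delta>) < 1"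
proof -
  interpret nu: prob_space \<nu> by (rule prob_space_\<nu>)
  define e where "e = \<alpha> - \<beta>\<^sub>0"
  have "0 < e" using beta0 by (simp add: e_def)
  define \<delta> where "\<delta> n = e / 2 / real (Suc n)" for n
  have \<delta>: "0 < \<delta> n" "\<delta> n \<le> e / 2" "\<delta> n \<noteq> 0" for n using \<open>0 < e\<close> by (auto simp: \<delta>_def field_simps)
  have \<delta>_lim: "\<delta> \<longlonglongrightarrow> 0"
    using tendsto_mult_left[OF LIMSEQ_Suc[OF lim_1_over_n], of "e / 2"] by (simp add: \<delta>_def[abs_def])
  have diff_quot: "((\<lambda>d. (1 - exp (- d * u)) / d) \<longlongrightarrow> u) (at 0)" for u :: real
  proof -
    have "((\<lambda>d. 1 - exp (- d * u)) has_real_derivative u) (at 0)"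
      by (auto intro!: derivative_eq_intros)
    then show ?thesis by (simp add: has_field_derivative_iff)
  qed
  \<comment> \<open>With \<open>abs_mult_exp_le\<close> this dominates the difference quotients for
    all d \<le> e / 2 at once.\<close>
  have lin: "\<bar>(1 - exp (- d * u)) / d\<bar> \<le> \<bar>u\<bar> * (1 + exp (- d * u))" if "0 < d" for d u :: real
  proof -
    have "1 - exp (- d * u) \<le> d * u" using exp_ge_add_one_self[of "- d * u"] by simp
    moreover have "exp (- d * u) - 1 \<le> exp (- d * u) * (- d * u)"
    proof -
      have "exp (- d * u) * (1 + d * u) \<le> exp (- d * u) * exp (d * u)"
        by (rule mult_left_mono) (auto simp: exp_ge_add_one_self)
      also have "\<dots> = 1" by (simp add: exp_add[symmetric])
      finally show ?thesis by (simp add: distrib_left)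
    qed
    ultimately have "\<bar>1 - exp (- d * u)\<bar> \<le> \<bar>d * u\<bar> * (1 + exp (- d * u))"
    proof -
      assume a: "1 - exp (- d * u) \<le> d * u" and b: "exp (- d * u) - 1 \<le> exp (- d * u) * (- d * u)"
      have "exp (- d * u) * (- d * u) \<le> exp (- d * u) * \<bar>d * u\<bar>" by (rule mult_left_mono) (auto simp: abs_if)
      moreover have "0 \<le> exp (- d * u) * \<bar>d * u\<bar>" by simp
      ultimately show ?thesis using a b by (auto simp: algebra_simps abs_if split: if_splits)
    qed
    also have "\<dots> = d * (\<bar>u\<bar> * (1 + exp (- d * u)))" using that by (simp add: abs_mult)
    finally show ?thesis using that by (simp add: field_simps)
  qed
  have int_e: "integrable \<nu> (\<lambda>u. exp (- e * u))" using \<open>0 < e\<close> by (intro integrable_exp_\<nu>) (auto simp: e_def)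
  have int_d: "integrable \<nu> (\<lambda>u. exp (- \<delta> n * u))" for n
    using \<delta>[of n] \<open>0 < e\<close> by (intro integrable_exp_\<nu>) (auto simp: e_def)
  have "(\<lambda>n. \<integral>u. (1 - exp (- \<delta> n * u)) / \<delta> n \<partial>\<nu>) \<longlonglongrightarrow> (\<integral>u. u \<partial>\<nu>)"
  proof (rule integral_dominated_convergence)
    show "integrable \<nu> (\<lambda>u. 2 * \<bar>u\<bar> + 2 / e * exp (- e * u))" using integrable_id_\<nu> int_e by simp
    show "AE u in \<nu>. (\<lambda>n. (1 - exp (- \<delta> n * u)) / \<delta> n) \<longlonglongrightarrow> u"
      by (intro AE_I2 filterlim_compose[OF diff_quot]) (use \<delta>_lim \<delta>(3) in \<open>simp add: filterlim_at\<close>)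
    show "AE u in \<nu>. norm ((1 - exp (- \<delta> n * u)) / \<delta> n) \<le> 2 * \<bar>u\<bar> + 2 / e * exp (- e * u)" for n
    proof (rule AE_I2)
      fix u
      show "norm ((1 - exp (- \<delta> n * u)) / \<delta> n) \<le> 2 * \<bar>u\<bar> + 2 / e * exp (- e * u)"
        using lin[OF \<delta>(1)[of n], of u] abs_mult_exp_le[OF less_imp_le[OF \<delta>(1)] \<delta>(2) \<open>0 < e\<close>, of u n] by (simp add: algebra_simps)
    qed
  qed auto
  then have "\<forall>\<^sub>F n in sequentially. 0 < (\<integral>u. (1 - exp (- \<delta> n * u)) / \<delta> n \<partial>\<nu>)"
    using log_pos by (intro order_tendstoD) (auto simp: integral_id_\<nu>)
  then obtain n where n: "0 < (\<integral>u. (1 - exp (- \<delta> n * u)) / \<delta> n \<partial>\<nu>)"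
    using eventually_happens'[OF sequentially_bot] by blast
  have "(\<integral>u. (1 - exp (- \<delta> n * u)) / \<delta> n \<partial>\<nu>) = (1 - (\<integral>u. exp (- \<delta> n * u) \<partial>\<nu>)) / \<delta> n"
    using int_d[of n] nu.prob_space by simp
  then have less: "(\<integral>u. exp (- \<delta> n * u) \<partial>\<nu>) < 1" using n \<delta>(1)[of n] by (simp add: zero_less_divide_iff)
  show ?thesis
  proof (rule that)
    show "0 < \<delta> n" "\<delta> n \<le> \<alpha> - \<beta>\<^sub>0" using \<delta>[of n] \<open>0 < e\<close> by (auto simp: e_def)
    fix d assume d: "0 < d" "d \<le> \<delta> n"
    \<comment> \<open>- d u lies at the fraction \<theta> of the way from 0 to -
      \<open>\<delta> n\<close> u. The endpoint 0 contributes exp 0 = 1, whose integral is the mass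
      of \<nu>.\<close>
    define \<theta> where "\<theta> = d / \<delta> n"
    have \<theta>: "0 < \<theta>" "\<theta> \<le> 1" using d \<delta>(1)[of n] by (auto simp: \<theta>_def)
    have int: "integrable \<nu> (\<lambda>u. exp (- d * u))"
      using d \<delta>[of n] \<open>0 < e\<close> by (intro integrable_exp_\<nu>) (auto simp: e_def)
    have "(\<integral>u. exp (- d * u) \<partial>\<nu>) \<le> (\<integral>u. (1 - \<theta>) + \<theta> * exp (- \<delta> n * u) \<partial>\<nu>)"
    proof (rule integral_mono)
      fix u
      have "exp ((1 - \<theta>) *\<^sub>R 0 + \<theta> *\<^sub>R (- \<delta> n * u)) \<le> (1 - \<theta>) * exp 0 + \<theta> * exp (- \<delta> n * u)"
        using \<theta> by (intro convex_onD[OF exp_convex]) auto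
      then show "exp (- d * u) \<le> (1 - \<theta>) + \<theta> * exp (- \<delta> n * u)" using \<delta>(1)[of n] by (simp add: \<theta>_def)
    qed (use int int_d in auto)
    also have "\<dots> = (1 - \<theta>) + \<theta> * (\<integral>u. exp (- \<delta> n * u) \<partial>\<nu>)" using int_d[of n] nu.prob_space by simp
    also have "\<dots> < (1 - \<theta>) + \<theta> * 1" using less \<theta> by (intro add_strict_left_mono mult_strict_left_mono) auto
    finally have "(\<integral>u. exp (- d * u) \<partial>\<nu>) < 1" by simp
    moreover have "\<phi> (\<alpha> - d) = ennreal (\<integral>u. exp (- d * u) \<partial>\<nu>)"
      unfolding nn_integral_exp_\<nu>[symmetric] using int by (rule nn_integral_eq_integral) auto
    ultimately show "\<phi> (\<alpha> - d) < 1" by (simp add: ennreal_less_one_iff)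
  qed
qed

end

section \<open>The maximum recursion\<close>

lemma ennreal_less_mult_iff: "0 < a \<Longrightarrow> 0 \<le> v \<Longrightarrow> ennreal v < ennreal a * y \<longleftrightarrow> ennreal (v / a) < y"
  by (cases y) (auto simp: ennreal_mult[symmetric] ennreal_mult_top ennreal_less_iff field_simps)

lemma nn_integral_powr_Ioo:
  assumes "0 < s" "0 \<le> a"
  shows "(\<integral>\<^sup>+v. ennreal (indicator {0<..<a} v * (s * v powr (s - 1))) \<partial>lborel) = ennreal (a powr s)"
proof -
  have "((\<lambda>v. v powr (s - 1)) has_integral a powr (s - 1 + 1) / (s - 1 + 1)) {0..a}"
    using assms by (intro has_integral_powr_from_0) auto
  then have "((\<lambda>v. s * v powr (s - 1)) has_integral s * (a powr (s - 1 + 1) / (s - 1 + 1))) {0..a}"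
    by (rule has_integral_mult_right)
  then have "((\<lambda>v. s * v powr (s - 1)) has_integral a powr s) {0..a}"
    using assms by simp
  then have "((\<lambda>v. if v \<in> {0..a} then s * v powr (s - 1) else 0) has_integral a powr s) UNIV"
    by (subst has_integral_restrict_UNIV)
  then have "(\<integral>\<^sup>+v. ennreal (if v \<in> {0..a} then s * v powr (s - 1) else 0) \<partial>lborel) = ennreal (a powr s)"
    using assms by (intro nn_integral_has_integral_lborel) auto
  moreover have "(\<integral>\<^sup>+v. ennreal (if v \<in> {0..a} then s * v powr (s - 1) else 0) \<partial>lborel)
      = (\<integral>\<^sup>+v. ennreal (indicator {0<..<a} v * (s * v powr (s - 1))) \<partial>lborel)"
    by (rule nn_integral_cong_AE)
      (use AE_lborel_singleton[of a] AE_lborel_singleton[of 0] in eventually_elim, auto simp: indicator_def)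
  ultimately show ?thesis by simp
qed

lemma nn_integral_powr_Ici:
  assumes "0 < s" "0 < a"
  shows "(\<integral>\<^sup>+v. ennreal (indicator {a..} v * (v powr (- s - 1))) \<partial>lborel) = ennreal (a powr (- s) / s)"
proof -
  have "((\<lambda>v. v powr (- s - 1)) has_integral - (a powr (- s - 1 + 1)) / (- s - 1 + 1)) {a..}"
    using assms by (intro has_integral_powr_to_inf) auto
  then have "((\<lambda>v. if v \<in> {a..} then v powr (- s - 1) else 0) has_integral a powr (- s) / s) UNIV"
    by (subst has_integral_restrict_UNIV) simp
  then have "(\<integral>\<^sup>+v. ennreal (if v \<in> {a..} then v powr (- s - 1) else 0) \<partial>lborel) = ennreal (a powr (- s) / s)"
    by (intro nn_integral_has_integral_lborel) auto
  moreover have "(if v \<in> {a..} then v powr (- s - 1) else 0) = indicator {a..} v * (v powr (- s - 1))" for v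
    by (auto simp: indicator_def)
  ultimately show ?thesis by simp
qed

text \<open>The density of d(v^\<alpha>) on the positive half-line.\<close>

definition power_weight :: "real \<Rightarrow> real \<Rightarrow> ennreal" where
  "power_weight \<alpha> v = ennreal (indicator {0<..} v * (\<alpha> * v powr (\<alpha> - 1)))"

lemma power_weight_measurable [measurable]: "power_weight \<alpha> \<in> borel_measurable borel"
  unfolding power_weight_def[abs_def] by measurable

definition exceeds :: "real \<Rightarrow> ennreal \<Rightarrow> ennreal" where
  "exceeds v y = (if ennreal v < y then 1 else 0)"

lemma exceeds_measurable [measurable (raw)]:
  assumes [measurable]: "f \<in> borel_measurable M" "g \<in> borel_measurable M"
  shows "(\<lambda>x. exceeds (f x) (g x)) \<in> borel_measurable M"
  unfolding exceeds_def by measurable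

lemma layer_cake:
  assumes "0 < \<alpha>"
  shows "(\<integral>\<^sup>+v. power_weight \<alpha> v * exceeds v y \<partial>lborel) = ennreal_powr y \<alpha>"
proof -
  have finite_case: "(\<integral>\<^sup>+v. power_weight \<alpha> v * exceeds v (ennreal a) \<partial>lborel) = ennreal (a powr \<alpha>)" if "0 \<le> a" for a
  proof -
    have "power_weight \<alpha> v * exceeds v (ennreal a) = ennreal (indicator {0<..<a} v * (\<alpha> * v powr (\<alpha> - 1)))" for v
      using that by (cases "v < 0") (auto simp: power_weight_def exceeds_def indicator_def ennreal_less_iff)
    then show ?thesis using nn_integral_powr_Ioo[OF assms that] by simp
  qed
  show ?thesis
  proof (cases y)
    case (real a)
    then show ?thesis using finite_case[of a] by (simp add: ennreal_powr_ennreal)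
  next
    case top
    \<comment> \<open>An infinite value is compared with n powr (1 / \<alpha>), for which the finite
      case gives exactly n.\<close>
    have *: "ennreal (real n) \<le> (\<integral>\<^sup>+v. power_weight \<alpha> v * exceeds v y \<partial>lborel)" for n
    proof -
      have "ennreal (real n) = (\<integral>\<^sup>+v. power_weight \<alpha> v * exceeds v (ennreal (real n powr (1 / \<alpha>))) \<partial>lborel)"
        using assms by (subst finite_case) (auto simp: powr_powr)
      also have "\<dots> \<le> (\<integral>\<^sup>+v. power_weight \<alpha> v * exceeds v y \<partial>lborel)"
        by (intro nn_integral_mono mult_left_mono) (auto simp: exceeds_def top)
      finally show ?thesis .
    qed
    have "(\<integral>\<^sup>+v. power_weight \<alpha> v * exceeds v y \<partial>lborel) = \<infinity>"
    proof (cases "\<integral>\<^sup>+v. power_weight \<alpha> v * exceeds v y \<partial>lborel")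
      case (real b)
      obtain n where "b < real n" using reals_Archimedean2 by blast
      then show ?thesis using * [of n] real by simp
    qed simp
    then show ?thesis using top by (simp add: ennreal_powr_def)
  qed
qed

text \<open>The minimum changes branch at v = A^(1 / \<beta>). Below, the linear branch is
  integrable because \<beta> < \<alpha>; above, the quadratic one is because \<alpha> < 2 \<beta>.
  By scaling both pieces are multiples of A^(\<alpha> / \<beta>).\<close>

lemma nn_integral_min_square:
  assumes "\<beta> < \<alpha>" "\<alpha> < 2 * \<beta>" "0 < \<beta>"
  obtains K where "0 \<le> K" "\<And>A. 0 \<le> A \<Longrightarrow>
    (\<integral>\<^sup>+v. power_weight \<alpha> v * ennreal (min (A * v powr (- \<beta>)) ((A * v powr (- \<beta>))\<^sup>2)) \<partial>lborel) \<le> ennreal (K * A powr (\<alpha> / \<beta>))"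
proof -
  define K where "K = \<alpha> / (\<alpha> - \<beta>) + \<alpha> / (2 * \<beta> - \<alpha>)"
  have "(\<integral>\<^sup>+v. power_weight \<alpha> v * ennreal (min (A * v powr (- \<beta>)) ((A * v powr (- \<beta>))\<^sup>2)) \<partial>lborel) \<le> ennreal (K * A powr (\<alpha> / \<beta>))"
    if "0 \<le> A" for A
  proof (cases "A = 0")
    case False
    then have A: "0 < A" using that by simp
    define a where "a = A powr (1 / \<beta>)"
    have "0 < a" using A by (simp add: a_def)
    define k1 where "k1 = \<alpha> * A / (\<alpha> - \<beta>)"
    define k2 where "k2 = \<alpha> * A\<^sup>2"
    have k: "0 \<le> k1" "0 \<le> k2" using assms A by (auto simp: k1_def k2_def)
    have le: "power_weight \<alpha> v * ennreal (min (A * v powr (- \<beta>)) ((A * v powr (- \<beta>))\<^sup>2))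
        \<le> ennreal k1 * ennreal (indicator {0<..<a} v * ((\<alpha> - \<beta>) * v powr (\<alpha> - \<beta> - 1)))
          + ennreal k2 * ennreal (indicator {a..} v * v powr (- (2 * \<beta> - \<alpha>) - 1))" for v
    proof (cases "0 < v")
      case True
      have 1: "\<alpha> * v powr (\<alpha> - 1) * (A * v powr (- \<beta>)) = k1 * ((\<alpha> - \<beta>) * v powr (\<alpha> - \<beta> - 1))"
      proof -
        have "v powr (\<alpha> - \<beta> - 1) = v powr (\<alpha> - 1) * v powr (- \<beta>)" by (simp add: powr_add[symmetric] algebra_simps)
        then show ?thesis using assms by (simp add: k1_def)
      qed
      have 2: "\<alpha> * v powr (\<alpha> - 1) * (A * v powr (- \<beta>))\<^sup>2 = k2 * v powr (- (2 * \<beta> - \<alpha>) - 1)"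
      proof -
        have "v powr (- (2 * \<beta> - \<alpha>) - 1) = v powr (\<alpha> - 1) * (v powr (- \<beta>) * v powr (- \<beta>))"
        proof -
          have e: "- (2 * \<beta> - \<alpha>) - 1 = (\<alpha> - 1) + (- \<beta> + - \<beta>)" by simp
          show ?thesis unfolding e by (simp only: powr_add)
        qed
        then show ?thesis by (simp add: k2_def power2_eq_square mult_ac)
      qed
      have pw: "power_weight \<alpha> v = ennreal (\<alpha> * v powr (\<alpha> - 1))" using True by (simp add: power_weight_def)
      show ?thesis
      proof (cases "v < a")
        case True
        have "power_weight \<alpha> v * ennreal (min (A * v powr (- \<beta>)) ((A * v powr (- \<beta>))\<^sup>2))
            \<le> ennreal (\<alpha> * v powr (\<alpha> - 1)) * ennreal (A * v powr (- \<beta>))"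
          unfolding pw by (intro mult_left_mono ennreal_leI) auto
        also have "\<dots> = ennreal k1 * ennreal ((\<alpha> - \<beta>) * v powr (\<alpha> - \<beta> - 1))"
          using assms A k by (simp add: ennreal_mult[symmetric] 1)
        finally show ?thesis using True \<open>0 < v\<close> by simp
      next
        case False
        have "power_weight \<alpha> v * ennreal (min (A * v powr (- \<beta>)) ((A * v powr (- \<beta>))\<^sup>2))
            \<le> ennreal (\<alpha> * v powr (\<alpha> - 1)) * ennreal ((A * v powr (- \<beta>))\<^sup>2)"
          unfolding pw by (intro mult_left_mono ennreal_leI) auto
        also have "\<dots> = ennreal k2 * ennreal (v powr (- (2 * \<beta> - \<alpha>) - 1))"
          using assms A k by (simp add: ennreal_mult[symmetric] 2)
        finally show ?thesis using False \<open>0 < v\<close> by simp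
      qed
    qed (simp add: power_weight_def)
    have "(\<integral>\<^sup>+v. power_weight \<alpha> v * ennreal (min (A * v powr (- \<beta>)) ((A * v powr (- \<beta>))\<^sup>2)) \<partial>lborel)
        \<le> (\<integral>\<^sup>+v. ennreal k1 * ennreal (indicator {0<..<a} v * ((\<alpha> - \<beta>) * v powr (\<alpha> - \<beta> - 1)))
          + ennreal k2 * ennreal (indicator {a..} v * v powr (- (2 * \<beta> - \<alpha>) - 1)) \<partial>lborel)"
      by (intro nn_integral_mono le)
    also have "\<dots> = ennreal k1 * ennreal (a powr (\<alpha> - \<beta>)) + ennreal k2 * ennreal (a powr (- (2 * \<beta> - \<alpha>)) / (2 * \<beta> - \<alpha>))"
      using nn_integral_powr_Ioo[of "\<alpha> - \<beta>" a] nn_integral_powr_Ici[of "2 * \<beta> - \<alpha>" a] assms \<open>0 < a\<close>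
      by (simp add: nn_integral_add nn_integral_cmult)
    also have "\<dots> = ennreal (k1 * a powr (\<alpha> - \<beta>) + k2 * (a powr (- (2 * \<beta> - \<alpha>)) / (2 * \<beta> - \<alpha>)))"
      using k assms by (simp add: ennreal_mult[symmetric] ennreal_plus[symmetric] del: ennreal_plus)
    also have "k1 * a powr (\<alpha> - \<beta>) + k2 * (a powr (- (2 * \<beta> - \<alpha>)) / (2 * \<beta> - \<alpha>)) = K * A powr (\<alpha> / \<beta>)"
    proof -
      have "A * a powr (\<alpha> - \<beta>) = A powr (\<alpha> / \<beta>)"
      proof -
        have e: "\<alpha> / \<beta> = 1 + (\<alpha> - \<beta>) / \<beta>" using assms by (simp add: field_simps)
        show ?thesis unfolding e powr_add using A by (simp add: a_def powr_powr)
      qed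
      moreover have "A\<^sup>2 * a powr (- (2 * \<beta> - \<alpha>)) = A powr (\<alpha> / \<beta>)"
      proof -
        have e: "\<alpha> / \<beta> = 2 + - (2 * \<beta> - \<alpha>) / \<beta>" using assms by (simp add: field_simps)
        show ?thesis unfolding e powr_add using A by (simp add: a_def powr_powr)
      qed
      moreover have "k1 * a powr (\<alpha> - \<beta>) + k2 * (a powr (- (2 * \<beta> - \<alpha>)) / (2 * \<beta> - \<alpha>))
          = \<alpha> / (\<alpha> - \<beta>) * (A * a powr (\<alpha> - \<beta>)) + \<alpha> / (2 * \<beta> - \<alpha>) * (A\<^sup>2 * a powr (- (2 * \<beta> - \<alpha>)))"
        by (simp add: k1_def k2_def)
      ultimately show ?thesis by (simp add: K_def distrib_right)
    qed
    finally show ?thesis .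
  qed simp
  moreover have "0 \<le> K" using assms by (simp add: K_def)
  ultimately show ?thesis using that by blast
qed

text \<open>The quadratic bound comes from exp (- x) \<le> 1 / (1 + x) \<le> 1 - x + x^2, the linear
  one from exp (- x) \<le> 1.\<close>

lemma exp_defect_le: "0 \<le> x \<Longrightarrow> x \<le> y \<Longrightarrow> x - 1 + exp (- x) \<le> min y (y\<^sup>2)" for x y :: real
proof -
  assume x: "0 \<le> x" "x \<le> y"
  have "exp (- x) \<le> 1 / (1 + x)"
    using exp_ge_add_one_self[of x] x by (simp add: exp_minus field_simps)
  also have "\<dots> \<le> 1 - x + x\<^sup>2"
  proof -
    have "(1 - x + x\<^sup>2) * (1 + x) = 1 + x ^ 3" by (simp add: algebra_simps power2_eq_square power3_eq_cube)
    then show ?thesis using x by (simp add: divide_le_eq)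
  qed
  finally have "x - 1 + exp (- x) \<le> x\<^sup>2" by simp
  also have "\<dots> \<le> y\<^sup>2" using x by (intro power_mono)
  finally have "x - 1 + exp (- x) \<le> y\<^sup>2" .
  moreover have "exp (- x) \<le> 1" using x by simp
  ultimately have "x - 1 + exp (- x) \<le> y" "x - 1 + exp (- x) \<le> y\<^sup>2" using x by linarith+
  then show ?thesis by (rule min.boundedI)
qed

section \<open>The product space of a root and independent copies\<close>

context prob_space begin

abbreviation sibling_space :: "(nat \<Rightarrow> 'a) measure" where
  "sibling_space \<equiv> \<Pi>\<^sub>M i\<in>{1..}. M"

lemma prob_space_copies: "prob_space sibling_space"
  by (rule prob_space_PiM) (rule prob_space_axioms)

lemma measurable_component [measurable]: "(\<lambda>y. y (Suc i)) \<in> sibling_space \<rightarrow>\<^sub>M M"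
  by (rule measurable_component_singleton) simp

lemma measurable_root [measurable]: "fst \<in> copies_space M \<rightarrow>\<^sub>M M"
  unfolding copies_space_def by simp

lemma measurable_copy [measurable]: "(\<lambda>x. snd x (Suc i)) \<in> copies_space M \<rightarrow>\<^sub>M M"
  unfolding copies_space_def by (rule measurable_compose[OF measurable_snd measurable_component])

lemma nn_integral_component:
  assumes [measurable]: "f \<in> borel_measurable M"
  shows "(\<integral>\<^sup>+y. f (y (Suc i)) \<partial>sibling_space) = (\<integral>\<^sup>+\<omega>. f \<omega> \<partial>M)"
proof -
  have "M = distr sibling_space M (\<lambda>y. y (Suc i))"
    by (rule distr_PiM_component[symmetric]) (auto intro: prob_space_axioms)
  then have "(\<integral>\<^sup>+\<omega>. f \<omega> \<partial>M) = (\<integral>\<^sup>+\<omega>. f \<omega> \<partial>distr sibling_space M (\<lambda>y. y (Suc i)))" by simp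
  also have "\<dots> = (\<integral>\<^sup>+y. f (y (Suc i)) \<partial>sibling_space)" by (rule nn_integral_distr) auto
  finally show ?thesis ..
qed

lemma nn_integral_copies_mult:
  assumes [measurable]: "f \<in> borel_measurable M" "h \<in> borel_measurable M"
  shows "(\<integral>\<^sup>+z. f (fst z) * h (snd z (Suc i)) \<partial>copies_space M) = (\<integral>\<^sup>+\<omega>. f \<omega> \<partial>M) * (\<integral>\<^sup>+\<omega>. h \<omega> \<partial>M)"
proof -
  interpret copies: prob_space sibling_space by (rule prob_space_copies)
  have "(\<lambda>z. f (fst z) * h (snd z (Suc i))) \<in> borel_measurable (copies_space M)" by measurable
  from copies.nn_integral_fst[OF this[unfolded copies_space_def], symmetric]
  have "(\<integral>\<^sup>+z. f (fst z) * h (snd z (Suc i)) \<partial>copies_space M)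
      = (\<integral>\<^sup>+\<omega>. \<integral>\<^sup>+y. f \<omega> * h (y (Suc i)) \<partial>sibling_space \<partial>M)"
    unfolding copies_space_def fst_conv snd_conv .
  also have "\<dots> = (\<integral>\<^sup>+\<omega>. f \<omega> * (\<integral>\<^sup>+\<omega>'. h \<omega>' \<partial>M) \<partial>M)"
    by (subst nn_integral_cmult) (auto simp: nn_integral_component simp del: One_nat_def)
  also have "\<dots> = (\<integral>\<^sup>+\<omega>. f \<omega> \<partial>M) * (\<integral>\<^sup>+\<omega>. h \<omega> \<partial>M)"
    by (rule nn_integral_multc) measurable
  finally show ?thesis .
qed

end

text \<open>What the asymptotics takes from the tree: the fixed-point equation in law and polynomial
  tail bounds of all orders slightly below \<alpha>. Child i meets the copy \<open>Suc i\<close>, as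
  copies are numbered from 1.\<close>

locale max_recursion = random_weights +
  fixes q :: "'a \<Rightarrow> real" and R :: "'a \<Rightarrow> ennreal"
  assumes q_meas[measurable]: "q \<in> borel_measurable M" and q_nonneg: "\<And>\<omega>. 0 \<le> q \<omega>"
    and q_moment: "integrable M (\<lambda>\<omega>. q \<omega> powr \<alpha>)"
    and R_meas[measurable]: "R \<in> borel_measurable M"
    and tail: "\<exists>\<delta>\<^sub>1. 0 < \<delta>\<^sub>1 \<and> \<delta>\<^sub>1 \<le> \<alpha> - \<beta>\<^sub>0 \<and> (\<forall>\<delta>. 0 < \<delta> \<and> \<delta> \<le> \<delta>\<^sub>1 \<longrightarrow>
      (\<exists>K. \<forall>v>0. measure M {\<omega> \<in> space M. ennreal v < R \<omega>} \<le> K * v powr (- (\<alpha> - \<delta>))))"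
    and fixed_point: "\<And>v. 0 < v \<Longrightarrow> emeasure M {\<omega> \<in> space M. ennreal v < R \<omega>} =
      emeasure (copies_space M) {x \<in> space (copies_space M).
        ennreal v < max (SUP i. ennreal (c i (fst x)) * R (snd x (Suc i))) (ennreal (q (fst x)))}"
begin

definition tail_prob :: "real \<Rightarrow> real" where
  "tail_prob v = measure M {\<omega> \<in> space M. ennreal v < R \<omega>}"

definition mean_exceedances :: "real \<Rightarrow> ennreal" where
  "mean_exceedances v = (\<integral>\<^sup>+(\<omega>, \<omega>'). (\<Sum>i. exceeds v (ennreal (c i \<omega>) * R \<omega>')) \<partial>(M \<Otimes>\<^sub>M M))"

lemma tail_prob_nonneg: "0 \<le> tail_prob v"
  by (simp add: tail_prob_def)

lemma tail_prob_mono: "v \<le> w \<Longrightarrow> tail_prob w \<le> tail_prob v"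
  unfolding tail_prob_def by (intro finite_measure_mono) (auto intro: le_less_trans[OF ennreal_leI])

lemma tail_prob_measurable [measurable]: "tail_prob \<in> borel_measurable borel"
proof -
  have "mono (\<lambda>v. - tail_prob v)" by (rule monoI) (simp add: tail_prob_mono)
  then have "(\<lambda>v. - (- tail_prob v)) \<in> borel_measurable borel"
    by (intro borel_measurable_uminus borel_measurable_mono)
  then show ?thesis by simp
qed

lemma nn_integral_exceeds_R: "(\<integral>\<^sup>+\<omega>. exceeds v (R \<omega>) \<partial>M) = ennreal (tail_prob v)"
proof -
  have "(\<integral>\<^sup>+\<omega>. exceeds v (R \<omega>) \<partial>M) = (\<integral>\<^sup>+\<omega>. indicator {\<omega> \<in> space M. ennreal v < R \<omega>} \<omega> \<partial>M)"
    by (rule nn_integral_cong) (auto simp: exceeds_def indicator_def)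
  then show ?thesis by (simp add: tail_prob_def emeasure_eq_measure)
qed

text \<open>The case a = 0 is split off because v / 0 = 0 would produce \<open>tail_prob 0\<close>
  in place of 0.\<close>

lemma nn_integral_exceeds_mult_R:
  assumes "0 \<le> a" "0 < v"
  shows "(\<integral>\<^sup>+\<omega>. exceeds v (ennreal a * R \<omega>) \<partial>M) = ennreal (if a = 0 then 0 else tail_prob (v / a))"
proof (cases "a = 0")
  case False
  have "exceeds v (ennreal a * R \<omega>) = exceeds (v / a) (R \<omega>)" for \<omega>
    using False assms by (simp add: exceeds_def ennreal_less_mult_iff)
  then show ?thesis using False nn_integral_exceeds_R by simp
qed (simp add: exceeds_def)

lemma tail_prob_scaled_le:
  assumes "\<And>v. 0 < v \<Longrightarrow> tail_prob v \<le> K * v powr (- \<beta>)" "0 \<le> a" "0 < v" "0 < \<beta>"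
  shows "(if a = 0 then 0 else tail_prob (v / a)) \<le> K * v powr (- \<beta>) * a powr \<beta>"
proof (cases "a = 0")
  case False
  then have "tail_prob (v / a) \<le> K * (v / a) powr (- \<beta>)" using assms by simp
  also have "(v / a) powr (- \<beta>) = v powr (- \<beta>) * a powr \<beta>"
    using assms False by (simp add: powr_divide powr_minus field_simps)
  finally show ?thesis using False by (simp add: mult_ac)
qed simp

lemma mean_exceedances_eq: "0 < v \<Longrightarrow> mean_exceedances v = (\<integral>\<^sup>+\<omega>. (\<Sum>i. ennreal (if c i \<omega> = 0 then 0 else tail_prob (v / c i \<omega>))) \<partial>M)"
proof -
  assume v: "0 < v"
  have "mean_exceedances v = (\<integral>\<^sup>+\<omega>. \<integral>\<^sup>+\<omega>'. (\<Sum>i. exceeds v (ennreal (c i \<omega>) * R \<omega>')) \<partial>M \<partial>M)"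
    unfolding mean_exceedances_def by (subst nn_integral_fst[symmetric]) auto
  also have "\<dots> = (\<integral>\<^sup>+\<omega>. (\<Sum>i. \<integral>\<^sup>+\<omega>'. exceeds v (ennreal (c i \<omega>) * R \<omega>') \<partial>M) \<partial>M)"
    by (intro nn_integral_cong nn_integral_suminf) simp
  finally show ?thesis using v c_nonneg by (simp add: nn_integral_exceeds_mult_R)
qed

lemma mean_exceedances_measurable [measurable]: "mean_exceedances \<in> borel_measurable borel"
proof -
  interpret MM: pair_sigma_finite M M ..
  have "sigma_finite_measure (M \<Otimes>\<^sub>M M)" by (rule MM.P.sigma_finite_measure_axioms)
  then show ?thesis unfolding mean_exceedances_def[abs_def] case_prod_unfold
    by (rule sigma_finite_measure.borel_measurable_nn_integral) simp
qed

lemma mean_exceedances_finite: "0 < v \<Longrightarrow> mean_exceedances v < \<infinity>"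
proof -
  assume v: "0 < v"
  obtain \<delta> K where \<delta>: "0 < \<delta>" "\<delta> \<le> \<alpha> - \<beta>\<^sub>0" and K: "\<And>v. 0 < v \<Longrightarrow> tail_prob v \<le> K * v powr (- (\<alpha> - \<delta>))"
    using tail unfolding tail_prob_def by blast
  have "0 \<le> K" using K[of 1] tail_prob_nonneg[of 1] by simp
  have "mean_exceedances v \<le> (\<integral>\<^sup>+\<omega>. (\<Sum>i. ennreal (K * v powr (- (\<alpha> - \<delta>))) * ennreal (c i \<omega> powr (\<alpha> - \<delta>))) \<partial>M)"
    unfolding mean_exceedances_eq[OF v]
  proof (intro nn_integral_mono suminf_le)
    fix \<omega> i
    have "(if c i \<omega> = 0 then 0 else tail_prob (v / c i \<omega>)) \<le> K * v powr (- (\<alpha> - \<delta>)) * c i \<omega> powr (\<alpha> - \<delta>)"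
      using \<delta> beta0 by (intro tail_prob_scaled_le K v c_nonneg) auto
    then show "ennreal (if c i \<omega> = 0 then 0 else tail_prob (v / c i \<omega>)) \<le> ennreal (K * v powr (- (\<alpha> - \<delta>))) * ennreal (c i \<omega> powr (\<alpha> - \<delta>))"
      using \<open>0 \<le> K\<close> by (subst ennreal_mult[symmetric]) (auto intro: ennreal_leI)
  qed auto
  also have "\<dots> = ennreal (K * v powr (- (\<alpha> - \<delta>))) * \<phi> (\<alpha> - \<delta>)"
    unfolding \<phi>_def by (simp add: nn_integral_cmult)
  also have "\<dots> < \<infinity>" using \<phi>_finite[of "\<alpha> - \<delta>"] \<delta> by (simp add: ennreal_mult_less_top)
  finally show ?thesis .
qed

sublocale copies: prob_space sibling_space
  by (rule prob_space_copies)

abbreviation P :: "('a \<times> (nat \<Rightarrow> 'a)) measure" where "P \<equiv> copies_space M"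

lemma P_eq: "P = M \<Otimes>\<^sub>M sibling_space"
  by (simp add: copies_space_def)

sublocale P: prob_space P
  unfolding P_eq by (rule prob_space_pair) unfold_locales

text \<open>
  \<open>excess\<close> counts the exceedances beyond the first one, and \<open>gain\<close> indicates an exceedance due to \<open>q\<close> alone.
  Their weighted totals have finite mean, whereas those of the two sides of the identity \<open>balance\<close> below
  need not.
\<close>
definition branch_value :: "nat \<Rightarrow> 'a \<times> (nat \<Rightarrow> 'a) \<Rightarrow> ennreal" where
  "branch_value i x = ennreal (c i (fst x)) * R (snd x (Suc i))"

definition branch_max :: "'a \<times> (nat \<Rightarrow> 'a) \<Rightarrow> ennreal" where "branch_max x = (SUP i. branch_value i x)"

definition root_max :: "'a \<times> (nat \<Rightarrow> 'a) \<Rightarrow> ennreal" where "root_max x = max (branch_max x) (ennreal (q (fst x)))"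

definition exceedance_count :: "real \<Rightarrow> 'a \<times> (nat \<Rightarrow> 'a) \<Rightarrow> ennreal" where "exceedance_count v x = (\<Sum>i. exceeds v (branch_value i x))"

definition excess :: "real \<Rightarrow> 'a \<times> (nat \<Rightarrow> 'a) \<Rightarrow> ennreal" where "excess v x = exceedance_count v x - exceeds v (branch_max x)"

definition gain :: "real \<Rightarrow> 'a \<times> (nat \<Rightarrow> 'a) \<Rightarrow> ennreal" where "gain v x = exceeds v (root_max x) - exceeds v (branch_max x)"

lemma branch_value_measurable [measurable]: "branch_value i \<in> borel_measurable P" unfolding branch_value_def[abs_def] by measurable
lemma branch_max_measurable [measurable]: "branch_max \<in> borel_measurable P" unfolding branch_max_def[abs_def] by measurable
lemma root_max_measurable [measurable]: "root_max \<in> borel_measurable P" unfolding root_max_def[abs_def] by measurable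

lemma exceedance_count_measurable [measurable (raw)]:
  assumes [measurable]: "f \<in> borel_measurable K" "g \<in> K \<rightarrow>\<^sub>M P"
  shows "(\<lambda>x. exceedance_count (f x) (g x)) \<in> borel_measurable K"
  unfolding exceedance_count_def[abs_def] by measurable

lemma excess_measurable [measurable (raw)]:
  assumes [measurable]: "f \<in> borel_measurable K" "g \<in> K \<rightarrow>\<^sub>M P"
  shows "(\<lambda>x. excess (f x) (g x)) \<in> borel_measurable K"
  unfolding excess_def[abs_def] by measurable

lemma gain_measurable [measurable (raw)]:
  assumes [measurable]: "f \<in> borel_measurable K" "g \<in> K \<rightarrow>\<^sub>M P"
  shows "(\<lambda>x. gain (f x) (g x)) \<in> borel_measurable K"
  unfolding gain_def[abs_def] by measurable

lemma exceeds_branch_max_le: "exceeds v (branch_max x) \<le> exceedance_count v x"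
proof (cases "ennreal v < branch_max x")
  case True
  then obtain i where "ennreal v < branch_value i x" by (auto simp: branch_max_def less_SUP_iff)
  then have "exceeds v (branch_max x) = exceeds v (branch_value i x)" using True by (simp add: exceeds_def)
  also have "\<dots> \<le> exceedance_count v x" unfolding exceedance_count_def by (rule ennreal_le_suminf)
  finally show ?thesis .
qed (simp add: exceeds_def)

lemma exceedance_count_eq: "exceedance_count v x = exceeds v (branch_max x) + excess v x"
  unfolding excess_def by (simp add: exceeds_branch_max_le add_diff_inverse_ennreal)

text \<open>Both sides are the indicator for the branches plus \<open>excess\<close> plus
  \<open>gain\<close>. The additive form remains correct when the count is infinite.\<close>

lemma balance: "exceeds v (root_max x) + excess v x = exceedance_count v x + gain v x"
proof -
  have "exceeds v (branch_max x) \<le> exceeds v (root_max x)" by (auto simp: exceeds_def root_max_def less_max_iff_disj)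
  then have "exceeds v (root_max x) = exceeds v (branch_max x) + gain v x" unfolding gain_def by (simp add: add_diff_inverse_ennreal)
  then show ?thesis unfolding exceedance_count_eq by (simp add: ac_simps)
qed

lemma gain_le: "0 \<le> v \<Longrightarrow> gain v x \<le> exceeds v (ennreal (q (fst x)))"
  by (auto simp: gain_def exceeds_def root_max_def less_max_iff_disj)

lemma nn_integral_exceeds_root_max: "0 < v \<Longrightarrow> (\<integral>\<^sup>+x. exceeds v (root_max x) \<partial>P) = ennreal (tail_prob v)"
proof -
  assume v: "0 < v"
  have "(\<integral>\<^sup>+x. exceeds v (root_max x) \<partial>P) = (\<integral>\<^sup>+x. indicator {x \<in> space P. ennreal v < root_max x} x \<partial>P)"
    by (rule nn_integral_cong) (auto simp: exceeds_def indicator_def)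
  also have "\<dots> = emeasure P {x \<in> space P. ennreal v < root_max x}" by (subst nn_integral_indicator) auto
  also have "\<dots> = ennreal (tail_prob v)"
    unfolding root_max_def branch_max_def branch_value_def fixed_point[OF v, symmetric] by (simp add: tail_prob_def emeasure_eq_measure)
  finally show ?thesis .
qed

lemma nn_integral_exceedance_count_inner:
  assumes "\<omega> \<in> space M" "0 < v"
  shows "(\<integral>\<^sup>+y. exceedance_count v (\<omega>, y) \<partial>sibling_space) = (\<Sum>i. ennreal (if c i \<omega> = 0 then 0 else tail_prob (v / c i \<omega>)))"
proof -
  have "(\<integral>\<^sup>+y. exceedance_count v (\<omega>, y) \<partial>sibling_space)
      = (\<Sum>i. \<integral>\<^sup>+y. exceeds v (ennreal (c i \<omega>) * R (y (Suc i))) \<partial>sibling_space)"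
    unfolding exceedance_count_def branch_value_def fst_conv snd_conv by (rule nn_integral_suminf) simp
  also have "\<dots> = (\<Sum>i. \<integral>\<^sup>+\<omega>'. exceeds v (ennreal (c i \<omega>) * R \<omega>') \<partial>M)"
    by (subst nn_integral_component[of "\<lambda>\<omega>'. exceeds v (ennreal (c i \<omega>) * R \<omega>')" for i]) auto
  finally show ?thesis using assms c_nonneg by (simp add: nn_integral_exceeds_mult_R)
qed

lemma nn_integral_exceedance_count: "0 < v \<Longrightarrow> (\<integral>\<^sup>+x. exceedance_count v x \<partial>P) = mean_exceedances v"
proof -
  assume v: "0 < v"
  have "(\<integral>\<^sup>+x. exceedance_count v x \<partial>P) = (\<integral>\<^sup>+\<omega>. \<integral>\<^sup>+y. exceedance_count v (\<omega>, y) \<partial>sibling_space \<partial>M)"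
  proof -
    have "exceedance_count v \<in> borel_measurable P" by measurable
    then show ?thesis unfolding P_eq by (rule copies.nn_integral_fst[symmetric])
  qed
  also have "\<dots> = mean_exceedances v"
    unfolding mean_exceedances_eq[OF v] by (intro nn_integral_cong nn_integral_exceedance_count_inner v)
  finally show ?thesis .
qed

text \<open>
  Given the root, the exceedances of different children are independent. If \<open>s\<close> is the sum of their
  probabilities, the mean excess is \<open>s - 1 + \<Prod> (1 - \<pi>\<^sub>i) \<le> s - 1 + exp (- s)\<close>, which is quadratic in \<open>s\<close> at \<open>0\<close>.
\<close>
lemma nn_integral_excess_inner:
  assumes \<omega>: "\<omega> \<in> space M" and v: "0 < v" and K: "\<And>v. 0 < v \<Longrightarrow> tail_prob v \<le> K * v powr (- \<beta>)" and "0 < \<beta>"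
    and fin: "(\<Sum>i. ennreal (c i \<omega> powr \<beta>)) = ennreal S" "0 \<le> S"
  shows "(\<integral>\<^sup>+y. excess v (\<omega>, y) \<partial>sibling_space) \<le> ennreal (min (K * S * v powr (- \<beta>)) ((K * S * v powr (- \<beta>))\<^sup>2))"
proof -
  have "0 \<le> K" using K[of 1] tail_prob_nonneg[of 1] by simp
  define \<pi> where "\<pi> i = (if c i \<omega> = 0 then 0 else tail_prob (v / c i \<omega>))" for i
  have \<pi>: "0 \<le> \<pi> i" for i by (simp add: \<pi>_def tail_prob_nonneg)
  have \<pi>_le: "\<pi> i \<le> K * v powr (- \<beta>) * c i \<omega> powr \<beta>" for i
    unfolding \<pi>_def by (rule tail_prob_scaled_le[OF K c_nonneg v \<open>0 < \<beta>\<close>])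
  have summ: "summable (\<lambda>i. c i \<omega> powr \<beta>)"
    using fin by (intro summable_suminf_not_top) auto
  have "(\<Sum>i. ennreal (c i \<omega> powr \<beta>)) = ennreal (\<Sum>i. c i \<omega> powr \<beta>)"
    by (rule suminf_ennreal2[OF _ summ]) simp
  from trans[OF this[symmetric] fin(1)] have eq_S: "(\<Sum>i. c i \<omega> powr \<beta>) = S"
    by (rule iffD1[OF ennreal_inj[OF suminf_nonneg[OF summ powr_ge_zero] fin(2)]])
  have sums: "(\<lambda>i. c i \<omega> powr \<beta>) sums S"
    using summable_sums[OF summ] unfolding eq_S .
  have sums': "(\<lambda>i. K * v powr (- \<beta>) * c i \<omega> powr \<beta>) sums (K * v powr (- \<beta>) * S)"
    by (rule sums_mult[OF sums])
  have sum_\<pi>: "summable \<pi>"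
    by (rule summable_comparison_test'[OF sums_summable[OF sums'], of 0]) (use \<pi> \<pi>_le in simp)
  define s where "s = suminf \<pi>"
  have s_nonneg: "0 \<le> s" unfolding s_def by (rule suminf_nonneg[OF sum_\<pi> \<pi>])
  have s_le: "s \<le> K * S * v powr (- \<beta>)"
    using suminf_le[OF \<pi>_le sum_\<pi> sums_summable[OF sums']] sums_unique[OF sums'] by (simp add: s_def mult_ac)
  define B where "B i = {\<omega>' \<in> space M. ennreal v < ennreal (c i \<omega>) * R \<omega>'}" for i
  have [measurable]: "B i \<in> sets M" for i unfolding B_def by measurable
  have prob_B: "prob (B i) = \<pi> i" for i
  proof -
    have "ennreal (\<pi> i) = (\<integral>\<^sup>+\<omega>'. exceeds v (ennreal (c i \<omega>) * R \<omega>') \<partial>M)"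
      by (simp add: nn_integral_exceeds_mult_R c_nonneg v \<pi>_def)
    also have "\<dots> = (\<integral>\<^sup>+\<omega>'. indicator (B i) \<omega>' \<partial>M)"
      by (rule nn_integral_cong) (auto simp: exceeds_def indicator_def B_def)
    finally show ?thesis using \<pi> by (simp add: emeasure_eq_measure)
  qed
  \<comment> \<open>The event that no child exceeds v. The count minus the excess is the indicator
    of its complement.\<close>
  define A where "A = {y \<in> space sibling_space. \<forall>i. y (Suc i) \<notin> B i}"
  have [measurable]: "A \<in> sets sibling_space"
    unfolding A_def by measurable
  \<comment> \<open>The product measure is explicit on finite cylinders only, so \<open>A\<close> is
    enclosed in the cylinder of its first n conditions, and n tends to infinity afterwards.\<close>
  have A_le: "copies.prob A \<le> exp (- (\<Sum>i<n. \<pi> i))" for n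
  proof -
    \<comment> \<open>Copies are numbered from 1 and children from 0, hence j - 1.\<close>
    let ?A = "prod_emb {1..} (\<lambda>_. M) {1..n} (\<Pi>\<^sub>E j\<in>{1..n}. space M - B (j - 1))"
    have "A \<subseteq> ?A"
    proof
      fix y assume y: "y \<in> A"
      have "y j \<in> space M - B (j - 1)" if j: "j \<in> {1..n}" for j
      proof -
        obtain i where "j = Suc i" using j by (cases j) auto
        then show ?thesis using y by (auto simp: A_def space_PiM PiE_def Pi_def)
      qed
      then show "y \<in> ?A" using y by (auto simp: prod_emb_def A_def space_PiM)
    qed
    moreover have "?A \<in> sets sibling_space"
      by (intro sets_PiM_I) auto
    ultimately have "emeasure sibling_space A \<le> emeasure sibling_space ?A" by (rule emeasure_mono)
    also have "\<dots> = (\<Prod>j\<in>{1..n}. emeasure M (space M - B (j - 1)))"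
      by (rule emeasure_PiM_emb) (auto intro: prob_space_axioms)
    also have "\<dots> = (\<Prod>j\<in>{1..n}. ennreal (1 - \<pi> (j - 1)))"
      by (intro prod.cong refl) (simp add: emeasure_eq_measure prob_compl prob_B)
    also have "\<dots> = ennreal (\<Prod>j\<in>{1..n}. 1 - \<pi> (j - 1))"
      using prob_le_1[of "B i" for i] by (intro prod_ennreal) (simp add: prob_B)
    also have "(\<Prod>j\<in>{1..n}. 1 - \<pi> (j - 1)) = (\<Prod>i<n. 1 - \<pi> i)"
      by (rule prod.reindex_bij_witness[of _ Suc "\<lambda>j. j - 1"]) auto
    finally have "copies.prob A \<le> (\<Prod>i<n. 1 - \<pi> i)"
      using prob_le_1[of "B i" for i] by (simp add: copies.emeasure_eq_measure prod_nonneg prob_B del: One_nat_def)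
    also have "\<dots> \<le> (\<Prod>i<n. exp (- \<pi> i))"
      using prob_le_1[of "B i" for i] exp_ge_add_one_self[of "- \<pi> i" for i] by (intro prod_mono) (simp add: prob_B)
    also have "\<dots> = exp (- (\<Sum>i<n. \<pi> i))" by (simp add: exp_sum sum_negf[symmetric])
    finally show ?thesis .
  qed
  have "(\<lambda>n. exp (- (\<Sum>i<n. \<pi> i))) \<longlonglongrightarrow> exp (- s)"
    unfolding s_def by (intro tendsto_intros summable_LIMSEQ sum_\<pi>)
  then have A_exp: "copies.prob A \<le> exp (- s)"
    by (rule LIMSEQ_le_const) (use A_le in auto)
  have D_eq: "(\<integral>\<^sup>+y. excess v (\<omega>, y) \<partial>sibling_space) = ennreal s - ennreal (1 - copies.prob A)"
  proof -
    have root_maxexceedance_count: "(\<lambda>y. exceedance_count v (\<omega>, y)) \<in> borel_measurable sibling_space"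
      unfolding exceedance_count_def[abs_def] branch_value_def fst_conv snd_conv by measurable
    have ms: "(\<lambda>y. exceeds v (branch_max (\<omega>, y))) \<in> borel_measurable sibling_space"
      unfolding branch_max_def branch_value_def fst_conv snd_conv by measurable
    have sup_eq: "(\<integral>\<^sup>+y. exceeds v (branch_max (\<omega>, y)) \<partial>sibling_space) = ennreal (1 - copies.prob A)"
    proof -
      have "(\<integral>\<^sup>+y. exceeds v (branch_max (\<omega>, y)) \<partial>sibling_space) = (\<integral>\<^sup>+y. indicator (space sibling_space - A) y \<partial>sibling_space)"
      proof (rule nn_integral_cong)
        fix y assume y: "y \<in> space sibling_space"
        then have "y (Suc i) \<in> space M" for i by (auto simp: space_PiM)
        then show "exceeds v (branch_max (\<omega>, y)) = indicator (space sibling_space - A) y"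
          using y by (auto simp: exceeds_def branch_max_def branch_value_def less_SUP_iff A_def B_def indicator_def)
      qed
      then show ?thesis by (simp add: copies.emeasure_eq_measure copies.prob_compl del: One_nat_def)
    qed
    have "(\<integral>\<^sup>+y. excess v (\<omega>, y) \<partial>sibling_space) = (\<integral>\<^sup>+y. exceedance_count v (\<omega>, y) \<partial>sibling_space) - (\<integral>\<^sup>+y. exceeds v (branch_max (\<omega>, y)) \<partial>sibling_space)"
      unfolding excess_def by (rule nn_integral_diff[OF root_maxexceedance_count ms]) (simp_all add: sup_eq exceeds_branch_max_le del: One_nat_def)
    also have "(\<integral>\<^sup>+y. exceedance_count v (\<omega>, y) \<partial>sibling_space) = ennreal s"
      unfolding nn_integral_exceedance_count_inner[OF \<omega> v] \<pi>_def[symmetric] s_def by (rule suminf_ennreal2[OF \<pi> sum_\<pi>])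
    finally show ?thesis by (simp add: sup_eq del: One_nat_def)
  qed
  also have "\<dots> = ennreal (s - 1 + copies.prob A)"
    using s_nonneg copies.prob_le_1[of A] by (simp add: ennreal_minus algebra_simps del: One_nat_def)
  also have "\<dots> \<le> ennreal (s - 1 + exp (- s))" using A_exp by (intro ennreal_leI) simp
  also have "\<dots> \<le> ennreal (min (K * S * v powr (- \<beta>)) ((K * S * v powr (- \<beta>))\<^sup>2))"
    by (intro ennreal_leI exp_defect_le s_nonneg s_le)
  finally show ?thesis .
qed

definition total :: "(real \<Rightarrow> 'a \<times> (nat \<Rightarrow> 'a) \<Rightarrow> ennreal) \<Rightarrow> 'a \<times> (nat \<Rightarrow> 'a) \<Rightarrow> ennreal" where
  "total F x = (\<integral>\<^sup>+v. power_weight \<alpha> v * F v x \<partial>lborel)"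

lemma total_measurable:
  assumes [measurable]: "(\<lambda>(x, v). F v x) \<in> borel_measurable (K \<Otimes>\<^sub>M lborel)"
  shows "(\<lambda>x. \<integral>\<^sup>+v. power_weight \<alpha> v * F v x \<partial>lborel) \<in> borel_measurable K"
  by (rule lborel.borel_measurable_nn_integral) simp

text \<open>For a fixed root, exchanging the integrals and applying
  \<open>nn_integral_excess_inner\<close> leads to \<open>nn_integral_min_square\<close> with A = K
  S. This yields a multiple of S^(\<alpha> / \<beta>), which has finite mean by
  \<open>moment_beta\<close>.\<close>

lemma total_excess_finite: "(\<integral>\<^sup>+x. total excess x \<partial>P) < \<infinity>"
proof -
  obtain \<delta>\<^sub>1 where \<delta>\<^sub>1: "0 < \<delta>\<^sub>1" "\<delta>\<^sub>1 \<le> \<alpha> - \<beta>\<^sub>0"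
    and tail': "\<And>\<delta>. 0 < \<delta> \<Longrightarrow> \<delta> \<le> \<delta>\<^sub>1 \<Longrightarrow> \<exists>K. \<forall>v>0. tail_prob v \<le> K * v powr (- (\<alpha> - \<delta>))"
    using tail unfolding tail_prob_def by blast
  \<comment> \<open>\<delta> \<le> \<alpha> / 3 gives \<beta> \<ge> 2 \<alpha> / 3, hence \<alpha> <
    2 \<beta>.\<close>
  define \<delta> where "\<delta> = min \<delta>\<^sub>1 (\<alpha> / 3)"
  have \<delta>: "0 < \<delta>" "\<delta> \<le> \<delta>\<^sub>1" "\<delta> \<le> \<alpha> / 3" using \<delta>\<^sub>1 alpha_pos by (auto simp: \<delta>_def)
  define \<beta> where "\<beta> = \<alpha> - \<delta>"
  have \<beta>: "\<beta> < \<alpha>" "\<alpha> < 2 * \<beta>" "0 < \<beta>" "\<beta>\<^sub>0 \<le> \<beta>" using \<delta> \<delta>\<^sub>1 alpha_pos by (auto simp: \<beta>_def)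
  obtain K where K: "\<And>v. 0 < v \<Longrightarrow> tail_prob v \<le> K * v powr (- \<beta>)" using tail'[OF \<delta>(1,2)] unfolding \<beta>_def by blast
  have "0 \<le> K" using K[of 1] tail_prob_nonneg[of 1] by simp
  obtain L where L: "0 \<le> L" "\<And>A. 0 \<le> A \<Longrightarrow>
    (\<integral>\<^sup>+v. power_weight \<alpha> v * ennreal (min (A * v powr (- \<beta>)) ((A * v powr (- \<beta>))\<^sup>2)) \<partial>lborel) \<le> ennreal (L * A powr (\<alpha> / \<beta>))"
    using nn_integral_min_square[OF \<beta>(1-3)] by blast
  interpret LC: pair_sigma_finite lborel sibling_space
    by (intro pair_sigma_finite.intro sigma_finite_lborel copies.sigma_finite_measure_axioms)
  have "(\<integral>\<^sup>+x. total excess x \<partial>P) = (\<integral>\<^sup>+\<omega>. \<integral>\<^sup>+y. total excess (\<omega>, y) \<partial>sibling_space \<partial>M)"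
  proof -
    have "total excess \<in> borel_measurable P" unfolding total_def[abs_def] by (rule total_measurable) simp
    then show ?thesis unfolding P_eq by (rule copies.nn_integral_fst[symmetric])
  qed
  also have "\<dots> \<le> (\<integral>\<^sup>+\<omega>. ennreal (L * K powr (\<alpha> / \<beta>)) * ennreal_powr (\<Sum>i. ennreal (c i \<omega> powr \<beta>)) (\<alpha> / \<beta>) \<partial>M)"
  proof (rule nn_integral_mono_AE)
    show "AE \<omega> in M. (\<integral>\<^sup>+y. total excess (\<omega>, y) \<partial>sibling_space)
        \<le> ennreal (L * K powr (\<alpha> / \<beta>)) * ennreal_powr (\<Sum>i. ennreal (c i \<omega> powr \<beta>)) (\<alpha> / \<beta>)"
      using AE_sum_finite[OF \<beta>(4) less_imp_le[OF \<beta>(1)]] AE_space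
    proof eventually_elim
      case (elim \<omega>)
      define S where "S = enn2real (\<Sum>i. ennreal (c i \<omega> powr \<beta>))"
      have S: "(\<Sum>i. ennreal (c i \<omega> powr \<beta>)) = ennreal S" "0 \<le> S"
        using elim(1) by (auto simp: S_def less_top)
      have "(\<integral>\<^sup>+y. total excess (\<omega>, y) \<partial>sibling_space)
          = (\<integral>\<^sup>+v. \<integral>\<^sup>+y. power_weight \<alpha> v * excess v (\<omega>, y) \<partial>sibling_space \<partial>lborel)"
        unfolding total_def
      proof (rule LC.Fubini')
        have [measurable]: "(\<lambda>z. (\<omega>, snd z)) \<in> lborel \<Otimes>\<^sub>M sibling_space \<rightarrow>\<^sub>M P"
          unfolding P_eq using elim(2) by simp
        show "(\<lambda>(v, y). power_weight \<alpha> v * excess v (\<omega>, y)) \<in> borel_measurable (lborel \<Otimes>\<^sub>M sibling_space)"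
          unfolding case_prod_unfold by measurable
      qed
      also have "\<dots> \<le> (\<integral>\<^sup>+v. power_weight \<alpha> v * ennreal (min (K * S * v powr (- \<beta>)) ((K * S * v powr (- \<beta>))\<^sup>2)) \<partial>lborel)"
      proof (rule nn_integral_mono)
        fix v
        have [measurable]: "(\<lambda>y. (\<omega>, y)) \<in> sibling_space \<rightarrow>\<^sub>M P"
          unfolding P_eq using elim(2) by simp
        have "(\<integral>\<^sup>+y. power_weight \<alpha> v * excess v (\<omega>, y) \<partial>sibling_space)
            = power_weight \<alpha> v * (\<integral>\<^sup>+y. excess v (\<omega>, y) \<partial>sibling_space)"
          by (rule nn_integral_cmult) measurable
        also have "\<dots> \<le> power_weight \<alpha> v * ennreal (min (K * S * v powr (- \<beta>)) ((K * S * v powr (- \<beta>))\<^sup>2))"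
        proof (cases "0 < v")
          case True
          then show ?thesis using elim(2) K \<beta>(3) S by (intro mult_left_mono nn_integral_excess_inner) auto
        qed (simp add: power_weight_def)
        finally show "(\<integral>\<^sup>+y. power_weight \<alpha> v * excess v (\<omega>, y) \<partial>sibling_space)
            \<le> power_weight \<alpha> v * ennreal (min (K * S * v powr (- \<beta>)) ((K * S * v powr (- \<beta>))\<^sup>2))" .
      qed
      also have "\<dots> \<le> ennreal (L * (K * S) powr (\<alpha> / \<beta>))" using S \<open>0 \<le> K\<close> by (intro L) simp
      also have "\<dots> = ennreal (L * K powr (\<alpha> / \<beta>)) * ennreal_powr (\<Sum>i. ennreal (c i \<omega> powr \<beta>)) (\<alpha> / \<beta>)"
        using S \<open>0 \<le> K\<close> L(1) by (simp add: ennreal_powr_ennreal ennreal_mult[symmetric] powr_mult mult_ac)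
      finally show ?case .
    qed
  qed
  also have "\<dots> = ennreal (L * K powr (\<alpha> / \<beta>)) * (\<integral>\<^sup>+\<omega>. ennreal_powr (\<Sum>i. ennreal (c i \<omega> powr \<beta>)) (\<alpha> / \<beta>) \<partial>M)"
    by (rule nn_integral_cmult) simp
  also have "\<dots> < \<infinity>" using moment_beta[OF \<beta>(4) less_imp_le[OF \<beta>(1)]] by (simp add: ennreal_mult_less_top)
  finally show ?thesis .
qed

text \<open>A gain at threshold v requires q > v, so the total gain is at most q powr
  \<alpha>.\<close>

lemma total_gain_finite: "(\<integral>\<^sup>+x. total gain x \<partial>P) < \<infinity>"
proof -
  have "(\<integral>\<^sup>+x. total gain x \<partial>P) \<le> (\<integral>\<^sup>+x. ennreal (q (fst x) powr \<alpha>) \<partial>P)"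
  proof (rule nn_integral_mono)
    fix x
    have "total gain x \<le> (\<integral>\<^sup>+v. power_weight \<alpha> v * exceeds v (ennreal (q (fst x))) \<partial>lborel)"
      unfolding total_def
    proof (rule nn_integral_mono)
      fix v :: real
      show "power_weight \<alpha> v * gain v x \<le> power_weight \<alpha> v * exceeds v (ennreal (q (fst x)))"
      proof (cases "0 < v")
        case True
        then show ?thesis using gain_le[of v x] by (simp add: mult_left_mono)
      qed (simp add: power_weight_def)
    qed
    also have "\<dots> = ennreal (q (fst x) powr \<alpha>)"
      using q_nonneg by (simp add: layer_cake[OF alpha_pos] ennreal_powr_ennreal)
    finally show "total gain x \<le> ennreal (q (fst x) powr \<alpha>)" .
  qed
  also have "\<dots> = (\<integral>\<^sup>+\<omega>. \<integral>\<^sup>+y. ennreal (q \<omega> powr \<alpha>) \<partial>sibling_space \<partial>M)"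
  proof -
    have "(\<lambda>x. ennreal (q (fst x) powr \<alpha>)) \<in> borel_measurable P" by measurable
    from copies.nn_integral_fst[OF this[unfolded P_eq]] show ?thesis unfolding P_eq fst_conv by (rule sym)
  qed
  also have "\<dots> = (\<integral>\<^sup>+\<omega>. ennreal (q \<omega> powr \<alpha>) \<partial>M)"
    by (simp add: copies.emeasure_space_1 del: One_nat_def)
  also have "\<dots> < \<infinity>" using q_moment by (simp add: integrable_iff_bounded)
  finally show ?thesis .
qed

end

section \<open>Logarithmic change of variable\<close>

lemma exp_substitution:
  fixes f :: "real \<Rightarrow> real"
  assumes [measurable]: "f \<in> borel_measurable borel" and int: "set_integrable lborel {0<..} f"
  shows "integrable lborel (\<lambda>t. exp t * f (exp t))"
    and "(\<integral>t. exp t * f (exp t) \<partial>lborel) = (LINT v:{0<..}|lborel. f v)"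
proof -
  have img: "exp ` UNIV = {0::real<..}" by (auto simp: image_iff intro: exp_ln[symmetric])
  have "f absolutely_integrable_on {0<..}"
    using int by (simp add: set_integrable_def integrable_completion)
  moreover have "integral {0<..} f = (LINT v:{0<..}|lborel. f v)"
    by (rule set_borel_integral_eq_integral(2)[OF int, symmetric])
  moreover have "((\<lambda>t. \<bar>exp t\<bar> * f (exp t)) absolutely_integrable_on UNIV \<and>
      integral UNIV (\<lambda>t. \<bar>exp t\<bar> * f (exp t)) = (LINT v:{0<..}|lborel. f v)) \<longleftrightarrow>
    (f absolutely_integrable_on exp ` UNIV \<and> integral (exp ` UNIV) f = (LINT v:{0<..}|lborel. f v))"
    by (rule has_absolute_integral_change_of_variables_1') (auto intro!: derivative_eq_intros simp: inj_on_def)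
  ultimately have *: "(\<lambda>t. exp t * f (exp t)) absolutely_integrable_on UNIV"
    "integral UNIV (\<lambda>t. exp t * f (exp t)) = (LINT v:{0<..}|lborel. f v)"
    unfolding img by simp_all
  show int': "integrable lborel (\<lambda>t. exp t * f (exp t))"
    using *(1) by (simp add: set_integrable_def integrable_completion)
  have "integral UNIV (\<lambda>t. exp t * f (exp t)) = (\<integral>t. exp t * f (exp t) \<partial>lborel)"
    using set_borel_integral_eq_integral(2)[of UNIV "\<lambda>t. exp t * f (exp t)"] int'
    by (simp add: set_integrable_def set_lebesgue_integral_def)
  then show "(\<integral>t. exp t * f (exp t) \<partial>lborel) = (LINT v:{0<..}|lborel. f v)" using *(2) by simp
qed

section \<open>The two formulas for the limit constant\<close>

context max_recursion begin

definition tail_defect :: "real \<Rightarrow> real" where "tail_defect v = tail_prob v - enn2real (mean_exceedances v)"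

lemma tail_defect_measurable [measurable]: "tail_defect \<in> borel_measurable borel"
  unfolding tail_defect_def[abs_def] by measurable

definition mean_excess :: "real \<Rightarrow> ennreal" where "mean_excess v = (\<integral>\<^sup>+x. excess v x \<partial>P)"
definition mean_gain :: "real \<Rightarrow> ennreal" where "mean_gain v = (\<integral>\<^sup>+x. gain v x \<partial>P)"

lemma mean_excess_measurable [measurable]: "mean_excess \<in> borel_measurable borel"
  and mean_gain_measurable [measurable]: "mean_gain \<in> borel_measurable borel"
  unfolding mean_excess_def[abs_def] mean_gain_def[abs_def] by (rule P.borel_measurable_nn_integral; simp)+

lemma nn_integral_balance:
  assumes "0 < v"
  shows "ennreal (tail_prob v) + mean_excess v = mean_exceedances v + mean_gain v" "mean_excess v < \<infinity>" "mean_gain v < \<infinity>"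
proof -
  have "ennreal (tail_prob v) + mean_excess v = (\<integral>\<^sup>+x. exceeds v (root_max x) + excess v x \<partial>P)"
    unfolding nn_integral_exceeds_root_max[OF assms, symmetric] mean_excess_def by (rule nn_integral_add[symmetric]) measurable
  also have "\<dots> = (\<integral>\<^sup>+x. exceedance_count v x + gain v x \<partial>P)" by (simp add: balance)
  also have "\<dots> = mean_exceedances v + mean_gain v"
    unfolding nn_integral_exceedance_count[OF assms, symmetric] mean_gain_def by (rule nn_integral_add) measurable
  finally show "ennreal (tail_prob v) + mean_excess v = mean_exceedances v + mean_gain v" .
  have "mean_excess v \<le> mean_exceedances v"
    unfolding nn_integral_exceedance_count[OF assms, symmetric] mean_excess_def by (rule nn_integral_mono) (simp add: exceedance_count_eq)
  then show "mean_excess v < \<infinity>" using mean_exceedances_finite[OF assms] by (rule le_less_trans)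
  have "mean_gain v \<le> (\<integral>\<^sup>+x. 1 \<partial>P)"
    unfolding mean_gain_def by (rule nn_integral_mono) (simp add: gain_def exceeds_def)
  also have "\<dots> < \<infinity>" by (simp add: P.emeasure_space_1)
  finally show "mean_gain v < \<infinity>" .
qed

text \<open>At a fixed threshold all four means are finite and \<open>balance\<close> can be
  rearranged. The two terms on the right are separately integrable against the power weight, which
  those defining \<open>tail_defect\<close> may fail to be.\<close>

lemma tail_defect_eq: "0 < v \<Longrightarrow> tail_defect v = enn2real (mean_gain v) - enn2real (mean_excess v)"
proof -
  assume v: "0 < v"
  note b = nn_integral_balance[OF v]
  have "enn2real (ennreal (tail_prob v) + mean_excess v) = enn2real (mean_exceedances v + mean_gain v)" by (simp only: b(1))
  then have "tail_prob v + enn2real (mean_excess v) = enn2real (mean_exceedances v) + enn2real (mean_gain v)"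
    using b(2,3) mean_exceedances_finite[OF v] tail_prob_nonneg[of v] by (simp add: enn2real_plus)
  then show ?thesis by (simp add: tail_defect_def)
qed

lemma total_Fubini:
  assumes [measurable]: "(\<lambda>(v, x). F v x) \<in> borel_measurable (lborel \<Otimes>\<^sub>M P)"
    and "\<And>v. F v \<in> borel_measurable P"
  shows "(\<integral>\<^sup>+v. power_weight \<alpha> v * (\<integral>\<^sup>+x. F v x \<partial>P) \<partial>lborel) = (\<integral>\<^sup>+x. total F x \<partial>P)"
proof -
  interpret LP: pair_sigma_finite lborel P
    by (intro pair_sigma_finite.intro sigma_finite_lborel P.sigma_finite_measure_axioms)
  have "(\<integral>\<^sup>+v. power_weight \<alpha> v * (\<integral>\<^sup>+x. F v x \<partial>P) \<partial>lborel) = (\<integral>\<^sup>+v. \<integral>\<^sup>+x. power_weight \<alpha> v * F v x \<partial>P \<partial>lborel)"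
    using assms(2) by (simp add: nn_integral_cmult)
  also have "\<dots> = (\<integral>\<^sup>+x. total F x \<partial>P)"
    unfolding total_def by (rule LP.Fubini'[symmetric]) simp
  finally show ?thesis .
qed

lemma total_excess_eq: "(\<integral>\<^sup>+v. power_weight \<alpha> v * mean_excess v \<partial>lborel) = (\<integral>\<^sup>+x. total excess x \<partial>P)"
  unfolding mean_excess_def by (rule total_Fubini) (simp_all add: case_prod_unfold)

lemma total_gain_eq: "(\<integral>\<^sup>+v. power_weight \<alpha> v * mean_gain v \<partial>lborel) = (\<integral>\<^sup>+x. total gain x \<partial>P)"
  unfolding mean_gain_def by (rule total_Fubini) (simp_all add: case_prod_unfold)

text \<open>The value to which both formulas reduce, by integrating over the thresholds last or over
  the sample last.\<close>

definition gap :: real where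
  "gap = enn2real (\<integral>\<^sup>+x. total gain x \<partial>P) - enn2real (\<integral>\<^sup>+x. total excess x \<partial>P)"

lemma integral_enn2real_diff:
  assumes [measurable]: "f \<in> borel_measurable N" "h \<in> borel_measurable N"
    and fin: "(\<integral>\<^sup>+x. f x \<partial>N) < \<infinity>" "(\<integral>\<^sup>+x. h x \<partial>N) < \<infinity>"
  shows "integrable N (\<lambda>x. enn2real (f x) - enn2real (h x))"
    and "(\<integral>x. enn2real (f x) - enn2real (h x) \<partial>N) = enn2real (\<integral>\<^sup>+x. f x \<partial>N) - enn2real (\<integral>\<^sup>+x. h x \<partial>N)"
proof -
  have i: "integrable N (\<lambda>x. enn2real (f x))" "integrable N (\<lambda>x. enn2real (h x))"
    using fin by (auto intro: integrable_enn2real_finite)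
  then show "integrable N (\<lambda>x. enn2real (f x) - enn2real (h x))" by simp
  have "AE x in N. f x < \<infinity>" "AE x in N. h x < \<infinity>"
    using nn_integral_PInf_AE[of f N] nn_integral_PInf_AE[of h N] fin by (auto simp: less_top)
  then have "(\<integral>x. enn2real (f x) \<partial>N) = enn2real (\<integral>\<^sup>+x. f x \<partial>N)" "(\<integral>x. enn2real (h x) \<partial>N) = enn2real (\<integral>\<^sup>+x. h x \<partial>N)"
    using fin by (auto intro!: enn2real_nn_integral_eq_integral[symmetric])
  then show "(\<integral>x. enn2real (f x) - enn2real (h x) \<partial>N) = enn2real (\<integral>\<^sup>+x. f x \<partial>N) - enn2real (\<integral>\<^sup>+x. h x \<partial>N)"
    using i by simp
qed

text \<open>\<open>power_weight\<close> contains a factor \<alpha> that is absent from this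
  integrand, hence the division by \<alpha>.\<close>

lemma set_integrable_tail_defect: "set_integrable lborel {0<..} (\<lambda>v. v powr (\<alpha> - 1) * tail_defect v)"
  and set_integral_tail_defect: "(LINT v:{0<..}|lborel. v powr (\<alpha> - 1) * tail_defect v) = gap / \<alpha>"
proof -
  have eq: "indicator {0<..} v * (v powr (\<alpha> - 1) * tail_defect v)
      = 1 / \<alpha> * (enn2real (power_weight \<alpha> v * mean_gain v) - enn2real (power_weight \<alpha> v * mean_excess v))" for v
  proof (cases "0 < v")
    case True
    then have "enn2real (power_weight \<alpha> v * y) = \<alpha> * v powr (\<alpha> - 1) * enn2real y" for y
      using alpha_pos by (simp add: power_weight_def enn2real_mult)
    then show ?thesis using True alpha_pos by (simp add: tail_defect_eq right_diff_distrib)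
  qed (simp add: power_weight_def)
  have fin: "(\<integral>\<^sup>+v. power_weight \<alpha> v * mean_gain v \<partial>lborel) < \<infinity>" "(\<integral>\<^sup>+v. power_weight \<alpha> v * mean_excess v \<partial>lborel) < \<infinity>"
    unfolding total_gain_eq total_excess_eq by (fact total_gain_finite total_excess_finite)+
  note I = integral_enn2real_diff[of "\<lambda>v. power_weight \<alpha> v * mean_gain v" lborel "\<lambda>v. power_weight \<alpha> v * mean_excess v", OF _ _ fin]
  show "set_integrable lborel {0<..} (\<lambda>v. v powr (\<alpha> - 1) * tail_defect v)"
    unfolding set_integrable_def real_scaleR_def eq by (intro integrable_mult_right I(1)) simp_all
  show "(LINT v:{0<..}|lborel. v powr (\<alpha> - 1) * tail_defect v) = gap / \<alpha>"
    unfolding set_lebesgue_integral_def real_scaleR_def eq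
    by (subst integral_mult_right_zero, subst I(2)) (simp_all add: gap_def total_gain_eq total_excess_eq)
qed

lemma tail_prob_tendsto_0: "(tail_prob \<longlongrightarrow> 0) at_top"
proof -
  obtain \<delta> K where \<delta>: "0 < \<delta>" "\<delta> \<le> \<alpha> - \<beta>\<^sub>0" and K: "\<And>v. 0 < v \<Longrightarrow> tail_prob v \<le> K * v powr (- (\<alpha> - \<delta>))"
    using tail unfolding tail_prob_def by blast
  have "((\<lambda>v. K * v powr (- (\<alpha> - \<delta>))) \<longlongrightarrow> K * 0) at_top"
    using \<delta> beta0 by (intro tendsto_intros tendsto_neg_powr filterlim_ident) auto
  then have lim: "((\<lambda>v. K * v powr (- (\<alpha> - \<delta>))) \<longlongrightarrow> 0) at_top" by simp
  have "\<forall>\<^sub>F v in at_top. tail_prob v \<le> K * v powr (- (\<alpha> - \<delta>))"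
    using eventually_gt_at_top[of 0] by eventually_elim (rule K)
  then show ?thesis
    by (rule tendsto_sandwich[OF always_eventually _ tendsto_const lim, rotated]) (simp add: tail_prob_nonneg)
qed

text \<open>By the fixed-point equation \<open>root_max\<close> has the tail of \<open>R\<close> at
  positive thresholds, and this tail tends to 0.\<close>

lemma AE_root_max_finite: "AE x in P. root_max x < \<infinity>"
proof -
  have "P.prob {x \<in> space P. root_max x = \<infinity>} \<le> tail_prob v" if "0 < v" for v
  proof -
    have "ennreal (P.prob {x \<in> space P. root_max x = \<infinity>}) = (\<integral>\<^sup>+x. indicator {x \<in> space P. root_max x = \<infinity>} x \<partial>P)"
      by (simp add: P.emeasure_eq_measure)
    also have "\<dots> \<le> (\<integral>\<^sup>+x. exceeds v (root_max x) \<partial>P)"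
      by (rule nn_integral_mono) (auto simp: exceeds_def indicator_def)
    also have "\<dots> = ennreal (tail_prob v)" by (rule nn_integral_exceeds_root_max[OF that])
    finally show ?thesis using tail_prob_nonneg by simp
  qed
  then have "P.prob {x \<in> space P. root_max x = \<infinity>} \<le> 0"
    by (intro tendsto_lowerbound[OF tail_prob_tendsto_0]) (auto intro: eventually_mono[OF eventually_gt_at_top[of 0]])
  then have "P.prob {x \<in> space P. root_max x = \<infinity>} = 0" by (simp add: measure_le_0_iff)
  then have "AE x in P. \<not> root_max x = \<infinity>"
    by (subst (asm) P.prob_eq_0) auto
  then show ?thesis by (simp add: less_top)
qed

text \<open>The layer-cake formula applied to \<open>balance\<close> at a fixed sample
  point.\<close>

lemma power_balance:
  assumes [measurable]: "x \<in> space P"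
  shows "ennreal_powr (root_max x) \<alpha> + total excess x = (\<Sum>i. ennreal_powr (branch_value i x) \<alpha>) + total gain x"
proof -
  have c[measurable]: "(\<lambda>v. x) \<in> borel \<rightarrow>\<^sub>M P" by simp
  have meas: "(\<lambda>v. excess v x) \<in> borel_measurable borel" "(\<lambda>v. gain v x) \<in> borel_measurable borel"
    "(\<lambda>v. exceedance_count v x) \<in> borel_measurable borel" "(\<lambda>v. exceeds v y) \<in> borel_measurable borel" for y
    by (measurable; fail)+
  note [measurable] = meas
  have "ennreal_powr (root_max x) \<alpha> + total excess x = (\<integral>\<^sup>+v. power_weight \<alpha> v * exceeds v (root_max x) + power_weight \<alpha> v * excess v x \<partial>lborel)"
    unfolding total_def layer_cake[OF alpha_pos, symmetric] by (rule nn_integral_add[symmetric]) measurable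
  also have "\<dots> = (\<integral>\<^sup>+v. power_weight \<alpha> v * exceedance_count v x + power_weight \<alpha> v * gain v x \<partial>lborel)"
    by (simp add: distrib_left[symmetric] balance)
  also have "\<dots> = (\<integral>\<^sup>+v. power_weight \<alpha> v * exceedance_count v x \<partial>lborel) + total gain x"
    unfolding total_def by (rule nn_integral_add) measurable
  also have "(\<integral>\<^sup>+v. power_weight \<alpha> v * exceedance_count v x \<partial>lborel) = (\<Sum>i. ennreal_powr (branch_value i x) \<alpha>)"
    unfolding exceedance_count_def layer_cake[OF alpha_pos, symmetric]
    by (simp add: ennreal_suminf_cmult[symmetric] nn_integral_suminf del: ennreal_suminf_cmult)
  finally show ?thesis .
qed

lemma total_excess_measurable [measurable]: "total excess \<in> borel_measurable P"
  and total_gain_measurable [measurable]: "total gain \<in> borel_measurable P"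
  unfolding total_def[abs_def] by (rule total_measurable; simp add: case_prod_unfold)+

text \<open>The mean of the sum of powers may be infinite, so its finiteness is read off from
  \<open>power_balance\<close>, whose left-hand side is finite almost surely.\<close>

lemma AE_powers_finite:
  "AE x in P. ennreal_powr (root_max x) \<alpha> < \<infinity> \<and> (\<Sum>i. ennreal_powr (branch_value i x) \<alpha>) < \<infinity> \<and>
    enn2real (ennreal_powr (root_max x) \<alpha>) - enn2real (\<Sum>i. ennreal_powr (branch_value i x) \<alpha>) = enn2real (total gain x) - enn2real (total excess x)"
proof -
  have "AE x in P. total excess x \<noteq> \<infinity>" "AE x in P. total gain x \<noteq> \<infinity>"
    using nn_integral_PInf_AE[of "total excess" P] nn_integral_PInf_AE[of "total gain" P] total_excess_finite total_gain_finite by auto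
  then show ?thesis using AE_root_max_finite AE_space
  proof eventually_elim
    case (elim x)
    have fm: "ennreal_powr (root_max x) \<alpha> < \<infinity>" using elim(3) by (simp add: ennreal_powr_def)
    then have "(\<Sum>i. ennreal_powr (branch_value i x) \<alpha>) + total gain x < \<infinity>"
      unfolding power_balance[OF elim(4), symmetric] using elim(1) by (simp add: less_top)
    then have fs: "(\<Sum>i. ennreal_powr (branch_value i x) \<alpha>) < \<infinity>" by simp
    have "enn2real (ennreal_powr (root_max x) \<alpha> + total excess x) = enn2real ((\<Sum>i. ennreal_powr (branch_value i x) \<alpha>) + total gain x)"
      by (simp only: power_balance[OF elim(4)])
    then have "enn2real (ennreal_powr (root_max x) \<alpha>) + enn2real (total excess x) = enn2real (\<Sum>i. ennreal_powr (branch_value i x) \<alpha>) + enn2real (total gain x)"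
      using fm fs elim(1,2) by (simp add: enn2real_plus less_top)
    then show ?case using fm fs by simp
  qed
qed

lemma integrable_power_difference:
  "integrable P (\<lambda>x. enn2real (ennreal_powr (root_max x) \<alpha>) - enn2real (\<Sum>i. ennreal_powr (branch_value i x) \<alpha>))"
  and integral_power_difference:
  "(\<integral>x. enn2real (ennreal_powr (root_max x) \<alpha>) - enn2real (\<Sum>i. ennreal_powr (branch_value i x) \<alpha>) \<partial>P) = gap"
proof -
  note I = integral_enn2real_diff[OF total_gain_measurable total_excess_measurable total_gain_finite total_excess_finite]
  have AE: "AE x in P. enn2real (ennreal_powr (root_max x) \<alpha>) - enn2real (\<Sum>i. ennreal_powr (branch_value i x) \<alpha>) = enn2real (total gain x) - enn2real (total excess x)"
    using AE_powers_finite by eventually_elim simp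
  have meas: "(\<lambda>x. enn2real (ennreal_powr (root_max x) \<alpha>) - enn2real (\<Sum>i. ennreal_powr (branch_value i x) \<alpha>)) \<in> borel_measurable P"
    by measurable
  show "integrable P (\<lambda>x. enn2real (ennreal_powr (root_max x) \<alpha>) - enn2real (\<Sum>i. ennreal_powr (branch_value i x) \<alpha>))"
    by (subst integrable_cong_AE[OF meas _ AE]) (use I(1) in auto)
  show "(\<integral>x. enn2real (ennreal_powr (root_max x) \<alpha>) - enn2real (\<Sum>i. ennreal_powr (branch_value i x) \<alpha>) \<partial>P) = gap"
    by (subst integral_cong_AE[OF meas _ AE]) (use I in \<open>auto simp: gap_def\<close>)
qed

theorem tail_asymptotics:
  "((\<lambda>t. t powr \<alpha> * tail_prob t) \<longlongrightarrow> (LINT v:{0<..}|lborel. v powr (\<alpha> - 1) * tail_defect v) /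
     (\<integral>\<omega>. (\<Sum>i. c i \<omega> powr \<alpha> * ln (c i \<omega>)) \<partial>M)) at_top"
proof -
  obtain \<delta>\<^sub>1 where \<delta>\<^sub>1: "0 < \<delta>\<^sub>1" "\<delta>\<^sub>1 \<le> \<alpha> - \<beta>\<^sub>0"
    and tail': "\<And>\<delta>. 0 < \<delta> \<Longrightarrow> \<delta> \<le> \<delta>\<^sub>1 \<Longrightarrow> \<exists>K. \<forall>v>0. tail_prob v \<le> K * v powr (- (\<alpha> - \<delta>))"
    using tail unfolding tail_prob_def by blast
  interpret nu: prob_space \<nu> by (rule prob_space_\<nu>)
  interpret renewal_step \<nu> \<delta>\<^sub>1
  proof
    show "sets \<nu> = sets borel" by (rule sets_\<nu>)
    show "integrable \<nu> (\<lambda>u. u)" by (rule integrable_id_\<nu>)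
    show "0 < (\<integral>u. u \<partial>\<nu>)" using log_pos by (simp add: integral_id_\<nu>)
    show "integrable \<nu> (\<lambda>u. exp (- \<delta>\<^sub>1 * u))" using \<delta>\<^sub>1 by (intro integrable_exp_\<nu>) auto
  qed (fact nonarith_\<nu> \<delta>\<^sub>1(1))+
  define r where "r t = exp (\<alpha> * t) * tail_prob (exp t)" for t
  define h where "h t = exp (\<alpha> * t) * tail_defect (exp t)" for t
  have [measurable]: "r \<in> borel_measurable borel" unfolding r_def by measurable
  have growth: "\<exists>K. \<forall>t. r t \<le> K * exp (\<delta> * t)" if \<delta>: "0 < \<delta>" "\<delta> \<le> \<delta>\<^sub>1" for \<delta>
  proof -
    obtain K where K: "\<And>v. 0 < v \<Longrightarrow> tail_prob v \<le> K * v powr (- (\<alpha> - \<delta>))" using tail'[OF \<delta>] by blast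
    have "r t \<le> K * exp (\<delta> * t)" for t
    proof -
      have "r t \<le> exp (\<alpha> * t) * (K * exp t powr (- (\<alpha> - \<delta>)))" unfolding r_def by (intro mult_left_mono K) auto
      also have "\<dots> = K * (exp (\<alpha> * t) * exp (- (\<alpha> - \<delta>) * t))" by (simp add: powr_def)
      also have "exp (\<alpha> * t) * exp (- (\<alpha> - \<delta>) * t) = exp (\<delta> * t)" by (simp add: exp_add[symmetric] algebra_simps)
      finally show ?thesis .
    qed
    then show ?thesis by blast
  qed
  have mono: "r t \<le> exp (\<alpha> * (t - s)) * r s" if "s \<le> t" for s t
  proof -
    have "exp (\<alpha> * t) * tail_prob (exp t) \<le> exp (\<alpha> * t) * tail_prob (exp s)" using that by (intro mult_left_mono tail_prob_mono) auto
    also have "\<dots> = exp (\<alpha> * (t - s)) * r s"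
      by (simp add: r_def mult.assoc[symmetric] exp_add[symmetric] algebra_simps)
    finally show ?thesis by (simp add: r_def)
  qed
  have conv_r: "(\<integral>u. r (t - u) \<partial>\<nu>) = exp (\<alpha> * t) * enn2real (mean_exceedances (exp t))" for t
  proof -
    \<comment> \<open>The tilt compensates the shift: c powr \<alpha> restores exp (\<alpha> t) when
      t is replaced by t - ln c. For c = 0 both sides vanish.\<close>
    have term_eq: "ennreal (c i \<omega> powr \<alpha>) * ennreal (r (t - ln (c i \<omega>)))
        = ennreal (exp (\<alpha> * t)) * ennreal (if c i \<omega> = 0 then 0 else tail_prob (exp t / c i \<omega>))" for i \<omega>
    proof (cases "c i \<omega> = 0")
      case False
      then have c: "0 < c i \<omega>" using c_nonneg[of i \<omega>] by simp
      have "c i \<omega> powr \<alpha> * exp (\<alpha> * (t - ln (c i \<omega>))) = exp (\<alpha> * t)"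
        using c by (simp add: powr_def exp_add[symmetric] algebra_simps)
      then have "c i \<omega> powr \<alpha> * r (t - ln (c i \<omega>)) = exp (\<alpha> * t) * tail_prob (exp t / c i \<omega>)"
        using c by (simp add: r_def exp_diff mult.assoc[symmetric])
      then show ?thesis using False tail_prob_nonneg by (simp add: ennreal_mult[symmetric] r_def)
    qed simp
    have "(\<integral>\<^sup>+u. ennreal (r (t - u)) \<partial>\<nu>) = (\<integral>\<^sup>+\<omega>. (\<Sum>i. ennreal (exp (\<alpha> * t)) * ennreal (if c i \<omega> = 0 then 0 else tail_prob (exp t / c i \<omega>))) \<partial>M)"
      by (subst nn_integral_\<nu>) (simp_all only: term_eq, measurable)
    also have "\<dots> = ennreal (exp (\<alpha> * t)) * mean_exceedances (exp t)"
      by (simp add: mean_exceedances_eq nn_integral_cmult)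
    finally have "(\<integral>\<^sup>+u. ennreal (r (t - u)) \<partial>\<nu>) = ennreal (exp (\<alpha> * t)) * mean_exceedances (exp t)" .
    moreover have "(\<integral>u. r (t - u) \<partial>\<nu>) = enn2real (\<integral>\<^sup>+u. ennreal (r (t - u)) \<partial>\<nu>)"
      by (rule integral_eq_nn_integral) (auto simp: r_def tail_prob_nonneg)
    ultimately show ?thesis by (simp add: enn2real_mult)
  qed
  have h_eq: "h t = r t - (\<integral>u. r (t - u) \<partial>\<nu>)" for t
    unfolding conv_r by (simp add: h_def r_def tail_defect_def right_diff_distrib)
  \<comment> \<open>One factor exp t is split off as the Jacobian of v = exp t.\<close>
  have h_exp: "h t = exp t * (exp t powr (\<alpha> - 1) * tail_defect (exp t))" for t
  proof -
    have "exp t * exp t powr (\<alpha> - 1) = exp (\<alpha> * t)" by (simp add: powr_def exp_add[symmetric] algebra_simps)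
    then show ?thesis by (simp add: h_def mult.assoc[symmetric])
  qed
  have sub: "integrable lborel h" "(\<integral>t. h t \<partial>lborel) = (LINT v:{0<..}|lborel. v powr (\<alpha> - 1) * tail_defect v)"
    unfolding h_exp by (rule exp_substitution[OF _ set_integrable_tail_defect]; measurable)+
  have "(r \<longlongrightarrow> (\<integral>t. h t \<partial>lborel) / (\<integral>u. u \<partial>\<nu>)) at_top"
    by (rule renewal_theorem_monotone[OF alpha_pos _ _ mono growth h_eq sub(1)]) (auto simp: r_def tail_prob_nonneg)
  then have "((\<lambda>t. r (ln t)) \<longlongrightarrow> (\<integral>t. h t \<partial>lborel) / (\<integral>u. u \<partial>\<nu>)) at_top"
    by (rule filterlim_compose[OF _ ln_at_top])
  moreover have "\<forall>\<^sub>F t in at_top. r (ln t) = t powr \<alpha> * tail_prob t"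
    using eventually_gt_at_top[of 0] by eventually_elim (simp add: r_def powr_def)
  ultimately have "((\<lambda>t. t powr \<alpha> * tail_prob t) \<longlongrightarrow> (\<integral>t. h t \<partial>lborel) / (\<integral>u. u \<partial>\<nu>)) at_top"
    by (rule Lim_transform_eventually)
  then show ?thesis unfolding sub(2) integral_id_\<nu> .
qed

end

section \<open>The branching property\<close>

lemma nodes_Cons [simp]: "Suc i # k \<in> nodes \<longleftrightarrow> k \<in> nodes" and nodes_Nil [simp]: "[] \<in> nodes"
  by (auto simp: nodes_def)

text \<open>Clipping gives a nonnegative function on the whole value space, and the value 0 beyond
  the last child lets suprema and sums range over all indices.\<close>

definition child_weight :: "nat \<Rightarrow> real \<times> enat \<times> (nat \<Rightarrow> real) \<Rightarrow> real" where
  "child_weight i v = (if enat (Suc i) \<le> fst (snd v) then max 0 (snd (snd v) (Suc i)) else 0)"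

lemma child_weight_nonneg: "0 \<le> child_weight i v"
  by (simp add: child_weight_def)

abbreviation subtree :: "nat \<Rightarrow> (nat list \<Rightarrow> 'b) \<Rightarrow> nat list \<Rightarrow> 'b" where
  "subtree i x \<equiv> (\<lambda>k. x (Suc i # k))"

text \<open>Children are indexed from \<open>0\<close>: the child with index \<open>i\<close> has the label \<open>Suc i\<close>.\<close>
primrec level_functional :: "nat \<Rightarrow> (nat list \<Rightarrow> real \<times> enat \<times> (nat \<Rightarrow> real)) \<Rightarrow> ennreal" where
  "level_functional 0 x = ennreal (fst (x []))"
| "level_functional (Suc n) x = (SUP i. ennreal (child_weight i (x [])) * level_functional n (subtree i x))"

definition tree_functional :: "(nat list \<Rightarrow> real \<times> enat \<times> (nat \<Rightarrow> real)) \<Rightarrow> ennreal" where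
  "tree_functional x = (SUP n. level_functional n x)"

text \<open>Splits the tree at the first label. Suprema in \<open>ennreal\<close> commute with each
  other and with multiplication, so the identity holds for every single family.\<close>

lemma tree_functional_rec:
  "tree_functional x = max (SUP i. ennreal (child_weight i (x [])) * tree_functional (subtree i x)) (ennreal (fst (x [])))"
proof -
  have "tree_functional x = max (SUP n. level_functional (Suc n) x) (level_functional 0 x)"
  proof (rule antisym)
    show "tree_functional x \<le> max (SUP n. level_functional (Suc n) x) (level_functional 0 x)"
      unfolding tree_functional_def
    proof (rule SUP_least)
      fix n show "level_functional n x \<le> max (SUP n. level_functional (Suc n) x) (level_functional 0 x)"
      proof (cases n)
        case (Suc k)
        then have "level_functional n x \<le> (SUP n. level_functional (Suc n) x)" by (auto intro: SUP_upper2)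
        then show ?thesis by (rule max.coboundedI1)
      qed (simp add: max.coboundedI2)
    qed
    show "max (SUP n. level_functional (Suc n) x) (level_functional 0 x) \<le> tree_functional x"
      unfolding tree_functional_def by (auto intro!: SUP_least SUP_upper simp del: level_functional.simps)
  qed
  also have "(SUP n. level_functional (Suc n) x) = (SUP i. SUP n. ennreal (child_weight i (x [])) * level_functional n (subtree i x))"
    by (simp, rule SUP_commute)
  also have "\<dots> = (SUP i. ennreal (child_weight i (x [])) * tree_functional (subtree i x))"
    by (simp add: SUP_mult_left_ennreal tree_functional_def)
  finally show ?thesis by simp
qed

text \<open>The product measure lives on functions that are undefined outside \<open>nodes\<close>;
  the functional reads only values at nodes.\<close>

lemma level_functional_restrict: "level_functional n (restrict x nodes) = level_functional n x"
proof (induction n arbitrary: x)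
  case (Suc n)
  have eq: "subtree i (restrict x nodes) = restrict (subtree i x) nodes" for i
    by (auto simp: restrict_def)
  have "level_functional n (subtree i (restrict x nodes)) = level_functional n (subtree i x)" for i
    unfolding eq by (rule Suc)
  moreover have "restrict x nodes [] = x []" by simp
  ultimately show ?case by (simp only: level_functional.simps)
qed simp

lemma weight_Nil [simp]: "weight C [] \<omega> = 1" by (simp add: weight.simps)

lemma weight_snoc: "weight C (k @ [j]) \<omega> = C (k @ [j]) \<omega> * weight C k \<omega>"
  by (subst weight.simps) simp

lemma weight_Cons: "weight C (j # k) \<omega> = C [j] \<omega> * weight (\<lambda>k. C (j # k)) k \<omega>"
proof (induction k rule: rev_induct)
  case Nil
  show ?case using weight_snoc[of C "[]" j] by simp
next
  case (snoc l k)
  then show ?case using weight_snoc[of C "j # k" l] by (simp add: weight_snoc)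
qed

text \<open>\<open>generation\<close> grows at the last label, whereas the recursion for the maximum
  splits off the first one.\<close>

lemma generation_Suc_Cons:
  "generation N (Suc n) \<omega> = (\<Union>i\<in>{i. enat (Suc i) \<le> N [] \<omega>}. (#) (Suc i) ` generation (subtree i N) n \<omega>)"
proof (induction n)
  case 0
  have "1 \<le> j \<and> enat j \<le> N [] \<omega> \<longleftrightarrow> (\<exists>i. j = Suc i \<and> enat (Suc i) \<le> N [] \<omega>)" for j
    by (cases j) auto
  then show ?case by auto
next
  case (Suc n)
  have "generation N (Suc (Suc n)) \<omega>
      = {k @ [j] | k j. k \<in> generation N (Suc n) \<omega> \<and> 1 \<le> j \<and> enat j \<le> N k \<omega>}"
    by (subst generation.simps(2)) simp
  also have "\<dots> = (\<Union>i\<in>{i. enat (Suc i) \<le> N [] \<omega>}. (#) (Suc i) `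
      {k @ [j] | k j. k \<in> generation (subtree i N) n \<omega> \<and> 1 \<le> j \<and> enat j \<le> N (Suc i # k) \<omega>})"
    unfolding Suc by (fastforce simp: image_iff)
  finally show ?case by simp
qed

text \<open>The induction is over all Q, N and C, since its step passes to the families below a
  first label.\<close>

lemma level_max_eq_functional:
  assumes "\<And>k. k \<in> nodes \<Longrightarrow> 0 \<le> Q k \<omega>" "\<And>k j. k \<in> nodes \<Longrightarrow> 1 \<le> j \<Longrightarrow> 0 \<le> C (k @ [j]) \<omega>"
  shows "level_max Q N C n \<omega> = level_functional n (\<lambda>k. node_vector Q N C k \<omega>)"
  using assms
proof (induction n arbitrary: Q N C)
  case 0
  then show ?case by (simp add: level_max_def node_vector_def)
next
  case (Suc n)
  have C0: "0 \<le> C [Suc i] \<omega>" for i using Suc.prems(2)[of "[]" "Suc i"] by simp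
  have IH: "level_max (subtree i Q) (subtree i N) (subtree i C) n \<omega>
      = level_functional n (subtree i (\<lambda>k. node_vector Q N C k \<omega>))" for i
  proof -
    have "level_max (subtree i Q) (subtree i N) (subtree i C) n \<omega>
        = level_functional n (\<lambda>k. node_vector (subtree i Q) (subtree i N) (subtree i C) k \<omega>)"
      by (rule Suc.IH) (use Suc.prems(1) Suc.prems(2)[of "Suc i # k" for k] in auto)
    then show ?thesis by (simp add: node_vector_def)
  qed
  have "level_max Q N C (Suc n) \<omega> = (SUP i\<in>{i. enat (Suc i) \<le> N [] \<omega>}. SUP k\<in>generation (subtree i N) n \<omega>.
      ennreal (Q (Suc i # k) \<omega> * weight C (Suc i # k) \<omega>))"
    unfolding level_max_def generation_Suc_Cons by (simp add: SUP_UNION image_image)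
  also have "\<dots> = (SUP i\<in>{i. enat (Suc i) \<le> N [] \<omega>}. ennreal (C [Suc i] \<omega>) * level_max (subtree i Q) (subtree i N) (subtree i C) n \<omega>)"
  proof (rule SUP_cong[OF refl])
    fix i
    have "ennreal (Q (Suc i # k) \<omega> * weight C (Suc i # k) \<omega>)
        = ennreal (C [Suc i] \<omega>) * ennreal (Q (Suc i # k) \<omega> * weight (subtree i C) k \<omega>)" for k
      using C0[of i] by (simp add: weight_Cons ennreal_mult'[symmetric] mult_ac)
    then show "(SUP k\<in>generation (subtree i N) n \<omega>. ennreal (Q (Suc i # k) \<omega> * weight C (Suc i # k) \<omega>))
        = ennreal (C [Suc i] \<omega>) * level_max (subtree i Q) (subtree i N) (subtree i C) n \<omega>"
      by (simp add: level_max_def SUP_mult_left_ennreal)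
  qed
  also have "\<dots> = (SUP i\<in>{i. enat (Suc i) \<le> N [] \<omega>}. ennreal (C [Suc i] \<omega>) * level_functional n (subtree i (\<lambda>k. node_vector Q N C k \<omega>)))"
    by (simp only: IH)
  also have "\<dots> = (SUP i. ennreal (child_weight i (node_vector Q N C [] \<omega>)) * level_functional n (subtree i (\<lambda>k. node_vector Q N C k \<omega>)))"
  proof (rule antisym; rule SUP_least)
    fix i assume "i \<in> {i. enat (Suc i) \<le> N [] \<omega>}"
    then have "child_weight i (node_vector Q N C [] \<omega>) = C [Suc i] \<omega>"
      using C0[of i] by (simp add: child_weight_def node_vector_def)
    then show "ennreal (C [Suc i] \<omega>) * level_functional n (subtree i (\<lambda>k. node_vector Q N C k \<omega>))
        \<le> (SUP i. ennreal (child_weight i (node_vector Q N C [] \<omega>)) * level_functional n (subtree i (\<lambda>k. node_vector Q N C k \<omega>)))"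
      by (intro SUP_upper2[of i]) auto
  next
    fix i
    show "ennreal (child_weight i (node_vector Q N C [] \<omega>)) * level_functional n (subtree i (\<lambda>k. node_vector Q N C k \<omega>))
        \<le> (SUP i\<in>{i. enat (Suc i) \<le> N [] \<omega>}. ennreal (C [Suc i] \<omega>) * level_functional n (subtree i (\<lambda>k. node_vector Q N C k \<omega>)))"
    proof (cases "enat (Suc i) \<le> N [] \<omega>")
      case True
      then have "child_weight i (node_vector Q N C [] \<omega>) = C [Suc i] \<omega>"
        using C0[of i] by (simp add: child_weight_def node_vector_def)
      then show ?thesis using True by (intro SUP_upper2[of i]) auto
    qed (simp add: child_weight_def node_vector_def)
  qed
  finally show ?case by simp
qed

text \<open>
  Replaces the \<open>\<beta>\<close>-th power of the maximum by a sum over the generation, whose mean is multiplicative in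
  the generation.
\<close>
primrec power_functional :: "real \<Rightarrow> nat \<Rightarrow> (nat list \<Rightarrow> real \<times> enat \<times> (nat \<Rightarrow> real)) \<Rightarrow> ennreal" where
  "power_functional \<beta> 0 x = ennreal (fst (x []) powr \<beta>)"
| "power_functional \<beta> (Suc n) x = (\<Sum>i. ennreal (child_weight i (x []) powr \<beta>) * power_functional \<beta> n (subtree i x))"

text \<open>A pathwise form of Markov's inequality: some child of weight a has a subtree exceeding v
  / a, and a^\<beta> times (v / a)^\<beta> is v^\<beta> again.\<close>

lemma power_functional_ge:
  assumes "0 < \<beta>" "0 < v" "ennreal v < level_functional n x"
  shows "ennreal (v powr \<beta>) \<le> power_functional \<beta> n x"
  using assms(2,3)
proof (induction n arbitrary: v x)
  case 0
  then show ?case using assms(1) by (auto simp: ennreal_less_iff intro!: ennreal_leI powr_mono2)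
next
  case (Suc n)
  then obtain i where i: "ennreal v < ennreal (child_weight i (x [])) * level_functional n (subtree i x)"
    by (auto simp: less_SUP_iff)
  define a where "a = child_weight i (x [])"
  have "a \<noteq> 0" using i by (auto simp: a_def)
  then have a: "0 < a" using child_weight_nonneg[of i "x []"] by (simp add: a_def)
  have "ennreal (v / a) < level_functional n (subtree i x)"
    using i a Suc.prems(1) by (simp add: a_def ennreal_less_mult_iff)
  then have "ennreal ((v / a) powr \<beta>) \<le> power_functional \<beta> n (subtree i x)"
    using Suc.prems(1) a by (intro Suc.IH) auto
  then have "ennreal (a powr \<beta>) * ennreal ((v / a) powr \<beta>) \<le> ennreal (a powr \<beta>) * power_functional \<beta> n (subtree i x)"
    by (rule mult_left_mono) simp
  also have "\<dots> \<le> power_functional \<beta> (Suc n) x"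
    unfolding a_def by (simp add: ennreal_le_suminf[where f = "\<lambda>i. ennreal (child_weight i (x []) powr \<beta>) * power_functional \<beta> n (subtree i x)"])
  also have "ennreal (a powr \<beta>) * ennreal ((v / a) powr \<beta>) = ennreal (v powr \<beta>)"
    using a Suc.prems(1) by (simp add: ennreal_mult[symmetric] powr_divide)
  finally show ?case .
qed

abbreviation families :: "(nat list \<Rightarrow> real \<times> enat \<times> (nat \<Rightarrow> real)) measure" where
  "families \<equiv> Pi\<^sub>M nodes (\<lambda>_. generic_vector_space)"

lemma measurable_gvs_fst [measurable]: "fst \<in> borel_measurable generic_vector_space"
  and measurable_gvs_count [measurable]: "(\<lambda>v. fst (snd v)) \<in> generic_vector_space \<rightarrow>\<^sub>M count_space UNIV"
  and measurable_gvs_weight: "1 \<le> j \<Longrightarrow> (\<lambda>v. snd (snd v) j) \<in> borel_measurable generic_vector_space"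
proof -
  show "fst \<in> borel_measurable generic_vector_space" "(\<lambda>v. fst (snd v)) \<in> generic_vector_space \<rightarrow>\<^sub>M count_space UNIV"
    unfolding generic_vector_space_def by measurable
  assume "1 \<le> j"
  have "(\<lambda>f. f j) \<in> borel_measurable (\<Pi>\<^sub>M j\<in>{1..}. borel)"
    by (rule measurable_component_singleton) (use \<open>1 \<le> j\<close> in simp)
  then show "(\<lambda>v. snd (snd v) j) \<in> borel_measurable generic_vector_space"
    unfolding generic_vector_space_def by (intro measurable_compose[OF measurable_compose[OF measurable_snd measurable_snd]])
qed

lemma child_weight_measurable [measurable]: "child_weight i \<in> borel_measurable generic_vector_space"
proof -
  note [measurable] = measurable_gvs_weight[of "Suc i", simplified]
  show ?thesis unfolding child_weight_def[abs_def] by measurable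
qed

lemma subtree_measurable: "subtree i \<in> families \<rightarrow>\<^sub>M families"
proof -
  have "(\<lambda>x. \<lambda>k\<in>nodes. x (Suc i # k)) \<in> families \<rightarrow>\<^sub>M families"
    by (rule measurable_restrict) (rule measurable_component_singleton, simp)
  \<comment> \<open>Outside \<open>nodes\<close> both sides are undefined, because
    \<open>Suc i # k\<close> is a node exactly if \<open>k\<close> is.\<close>
  moreover have "subtree i x = (\<lambda>k\<in>nodes. x (Suc i # k))" if "x \<in> space families" for x
    using that by (auto simp: space_PiM PiE_def extensional_def restrict_def)
  ultimately show ?thesis by (simp cong: measurable_cong)
qed

lemma root_measurable: "(\<lambda>x. x []) \<in> families \<rightarrow>\<^sub>M generic_vector_space"
  by (rule measurable_component_singleton) simp

lemma level_functional_measurable [measurable]: "level_functional n \<in> borel_measurable families"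
proof (induction n)
  case 0
  note [measurable] = root_measurable
  have "(\<lambda>x. ennreal (fst (x []))) \<in> borel_measurable families" by measurable
  then show ?case by (simp cong: measurable_cong)
next
  case (Suc n)
  note [measurable] = Suc root_measurable subtree_measurable
  have "(\<lambda>x. SUP i. ennreal (child_weight i (x [])) * level_functional n (subtree i x)) \<in> borel_measurable families"
    by measurable
  then show ?case by (simp cong: measurable_cong)
qed

lemma tree_functional_measurable [measurable]: "tree_functional \<in> borel_measurable families"
  unfolding tree_functional_def[abs_def] by measurable

lemma power_functional_measurable [measurable]: "power_functional \<beta> n \<in> borel_measurable families"
proof (induction n)
  case 0
  note [measurable] = root_measurable
  have "(\<lambda>x. ennreal (fst (x []) powr \<beta>)) \<in> borel_measurable families" by measurable
  then show ?case by (simp cong: measurable_cong)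
next
  case (Suc n)
  note [measurable] = Suc root_measurable subtree_measurable
  have "(\<lambda>x. \<Sum>i. ennreal (child_weight i (x []) powr \<beta>) * power_functional \<beta> n (subtree i x)) \<in> borel_measurable families"
    by measurable
  then show ?case by (simp cong: measurable_cong)
qed

section \<open>Independence and laws of subtrees\<close>

context weighted_branching_tree begin

abbreviation nv :: "nat list \<Rightarrow> 'a \<Rightarrow> real \<times> enat \<times> (nat \<Rightarrow> real)" where
  "nv \<equiv> node_vector Q N C"

definition family :: "'a \<Rightarrow> nat list \<Rightarrow> real \<times> enat \<times> (nat \<Rightarrow> real)" where
  "family \<omega> = (\<lambda>k\<in>nodes. nv k \<omega>)"

lemma nv_measurable: "k \<in> nodes \<Longrightarrow> nv k \<in> M \<rightarrow>\<^sub>M generic_vector_space"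
  using indep unfolding indep_vars_def by blast

lemma nv_root_measurable [measurable]: "nv [] \<in> M \<rightarrow>\<^sub>M generic_vector_space"
  by (rule nv_measurable) simp

lemma family_measurable [measurable]: "family \<in> M \<rightarrow>\<^sub>M families"
  unfolding family_def[abs_def] by (rule measurable_restrict) (rule nv_measurable)

lemma tree_max_eq: "\<omega> \<in> space M \<Longrightarrow> tree_max Q N C \<omega> = tree_functional (family \<omega>)"
proof -
  assume \<omega>: "\<omega> \<in> space M"
  have "level_max Q N C n \<omega> = level_functional n (family \<omega>)" for n
    unfolding family_def level_functional_restrict
  proof (rule level_max_eq_functional)
    show "0 \<le> Q k \<omega>" if "k \<in> nodes" for k by (rule Q_nonneg[OF that \<omega>])
    show "0 \<le> C (k @ [j]) \<omega>" if "k \<in> nodes" "1 \<le> j" for k j by (rule C_nonneg[OF that \<omega>])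
  qed
  then show ?thesis by (simp only: tree_max_def tree_functional_def)
qed

lemma tree_max_measurable [measurable]: "tree_max Q N C \<in> borel_measurable M"
proof -
  have "(\<lambda>\<omega>. tree_functional (family \<omega>)) \<in> borel_measurable M" by measurable
  then show ?thesis by (simp cong: measurable_cong add: tree_max_eq)
qed

lemma prob_space_generic: "prob_space (distr M generic_vector_space (nv []))"
  by (rule prob_space_distr) (rule nv_root_measurable)

lemma distr_family: "distr M families family = Pi\<^sub>M nodes (\<lambda>_. distr M generic_vector_space (nv []))"
proof -
  have "distr M families (\<lambda>\<omega>. \<lambda>k\<in>nodes. nv k \<omega>) = Pi\<^sub>M nodes (\<lambda>k. distr M generic_vector_space (nv k))"
  proof (rule iffD1[OF indep_vars_iff_distr_eq_PiM' indep])
    show "nodes \<noteq> {}" using nodes_Nil by blast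
  qed (rule nv_measurable)
  also have "\<dots> = Pi\<^sub>M nodes (\<lambda>_. distr M generic_vector_space (nv []))"
    by (intro PiM_cong refl identically_distributed)
  finally show ?thesis by (simp add: family_def[abs_def])
qed

text \<open>A subtree is the family read along the injection of k to \<open>Suc i # k\<close>, and
  injective reindexing of a product of equal factors gives the same product.\<close>

lemma distr_subtree: "distr M families (\<lambda>\<omega>. subtree i (family \<omega>)) = distr M families family"
proof -
  let ?\<mu> = "distr M generic_vector_space (nv [])"
  have sets_eq: "sets (Pi\<^sub>M nodes (\<lambda>_. ?\<mu>)) = sets families"
    by (rule sets_PiM_cong) simp_all
  have "distr M families (\<lambda>\<omega>. subtree i (family \<omega>)) = distr (distr M families family) families (subtree i)"
    by (subst distr_distr[OF subtree_measurable family_measurable]) (simp add: comp_def)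
  also have "\<dots> = distr (Pi\<^sub>M nodes (\<lambda>_. ?\<mu>)) families (subtree i)"
    by (simp only: distr_family)
  also have "\<dots> = distr (Pi\<^sub>M nodes (\<lambda>_. ?\<mu>)) (Pi\<^sub>M nodes (\<lambda>_. ?\<mu>)) (\<lambda>x. \<lambda>k\<in>nodes. x (Suc i # k))"
  proof (rule distr_cong)
    fix x assume "x \<in> space (Pi\<^sub>M nodes (\<lambda>_. ?\<mu>))"
    then show "subtree i x = (\<lambda>k\<in>nodes. x (Suc i # k))"
      by (auto simp: space_PiM PiE_def extensional_def restrict_def)
  qed (simp_all add: sets_eq)
  also have "\<dots> = Pi\<^sub>M nodes (\<lambda>_. ?\<mu>)"
    by (rule distr_PiM_reindex) (auto simp: prob_space_generic)
  finally show ?thesis by (simp only: distr_family)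
qed

text \<open>
  The root block is padded with \<open>0\<close> and the other blocks with a constant node vector, because \<open>indep_vars\<close>
  requires all variables to have the same type.
\<close>
lemma independent_blocks:
  assumes [measurable]: "\<Phi> \<in> borel_measurable families"
  shows "indep_vars (\<lambda>_. generic_vector_space \<Otimes>\<^sub>M borel)
    (\<lambda>i \<omega>. case i of 0 \<Rightarrow> (nv [] \<omega>, 0) | Suc j \<Rightarrow> ((0, 0, \<lambda>_\<in>{1..}. 0), \<Phi> (subtree j (family \<omega>)) :: ennreal)) UNIV"
proof -
  define K where "K i = (case i of 0 \<Rightarrow> {[]} | Suc j \<Rightarrow> (#) (Suc j) ` nodes)" for i :: nat
  define W where "W i z = (case i of 0 \<Rightarrow> (z [], 0) | Suc j \<Rightarrow> ((0, 0, \<lambda>_\<in>{1..}. 0), \<Phi> (\<lambda>k\<in>nodes. z (Suc j # k))))"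
    for i :: nat and z :: "nat list \<Rightarrow> real \<times> enat \<times> (nat \<Rightarrow> real)"
  have v0: "(0, 0, \<lambda>_\<in>{1..}. 0) \<in> space generic_vector_space"
    by (auto simp: generic_vector_space_def space_pair_measure space_PiM)
  have "indep_vars (\<lambda>i. Pi\<^sub>M (K i) (\<lambda>_. generic_vector_space)) (\<lambda>i \<omega>. \<lambda>k\<in>K i. nv k \<omega>) UNIV"
  proof (rule indep_vars_restrict[OF indep])
    show "K i \<subseteq> nodes" for i by (auto simp: K_def split: nat.split)
    show "disjoint_family_on K UNIV" by (auto simp: disjoint_family_on_def K_def split: nat.split)
  qed
  then have "indep_vars (\<lambda>_. generic_vector_space \<Otimes>\<^sub>M borel) (\<lambda>i \<omega>. W i (\<lambda>k\<in>K i. nv k \<omega>)) UNIV"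
  proof (rule indep_vars_compose2)
    fix i
    show "W i \<in> Pi\<^sub>M (K i) (\<lambda>_. generic_vector_space) \<rightarrow>\<^sub>M generic_vector_space \<Otimes>\<^sub>M borel"
    proof (cases i)
      case 0
      have "(\<lambda>z. z []) \<in> Pi\<^sub>M {[]} (\<lambda>_. generic_vector_space) \<rightarrow>\<^sub>M generic_vector_space"
        by (rule measurable_component_singleton) simp
      then show ?thesis using 0 by (simp add: W_def[abs_def] K_def)
    next
      case (Suc j)
      have "(\<lambda>z. \<lambda>k\<in>nodes. z (Suc j # k)) \<in> Pi\<^sub>M ((#) (Suc j) ` nodes) (\<lambda>_. generic_vector_space) \<rightarrow>\<^sub>M families"
        by (rule measurable_restrict) (rule measurable_component_singleton, simp)
      from measurable_compose[OF this assms] show ?thesis using Suc v0 by (simp add: W_def[abs_def] K_def)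
    qed
  qed
  also have "(\<lambda>i \<omega>. W i (\<lambda>k\<in>K i. nv k \<omega>))
      = (\<lambda>i \<omega>. case i of 0 \<Rightarrow> (nv [] \<omega>, 0) | Suc j \<Rightarrow> ((0, 0, \<lambda>_\<in>{1..}. 0), \<Phi> (subtree j (family \<omega>))))"
  proof (intro ext)
    fix i \<omega>
    have "(\<lambda>k\<in>nodes. (\<lambda>k\<in>(#) (Suc j) ` nodes. nv k \<omega>) (Suc j # k)) = subtree j (family \<omega>)" for j
      by (auto simp: family_def restrict_def)
    then show "W i (\<lambda>k\<in>K i. nv k \<omega>) = (case i of 0 \<Rightarrow> (nv [] \<omega>, 0) | Suc j \<Rightarrow> ((0, 0, \<lambda>_\<in>{1..}. 0), \<Phi> (subtree j (family \<omega>))))"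
      by (cases i) (simp_all add: W_def K_def)
  qed
  finally show ?thesis .
qed

text \<open>The coordinates of a product are independent with law \<open>M\<close>, and separate
  maps of the coordinates preserve independence.\<close>

lemma indep_vars_coordinates:
  assumes "\<And>i. Y i \<in> M \<rightarrow>\<^sub>M L i"
  shows "distr (Pi\<^sub>M UNIV (\<lambda>_::nat. M)) (Pi\<^sub>M UNIV L) (\<lambda>\<eta> i. Y i (\<eta> i)) = Pi\<^sub>M UNIV (\<lambda>i. distr M (L i) (Y i))"
proof -
  let ?P = "Pi\<^sub>M UNIV (\<lambda>_::nat. M)"
  interpret P: prob_space ?P by (rule prob_space_PiM) (rule prob_space_axioms)
  have comp: "(\<lambda>\<eta>. \<eta> i) \<in> ?P \<rightarrow>\<^sub>M M" for i by (rule measurable_component_singleton) simp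
  have marg: "distr ?P M (\<lambda>\<eta>. \<eta> i) = M" for i
    by (rule distr_PiM_component) (auto intro: prob_space_axioms)
  have "P.indep_vars (\<lambda>_. M) (\<lambda>i \<eta>. \<eta> i) UNIV"
  proof (subst P.indep_vars_iff_distr_eq_PiM)
    show "distr ?P ?P (\<lambda>x. \<lambda>i\<in>UNIV. x i) = Pi\<^sub>M UNIV (\<lambda>i. distr ?P M (\<lambda>x. x i))"
      by (simp add: marg distr_id[unfolded id_def] restrict_UNIV)
  qed (auto intro: comp)
  then have "P.indep_vars L (\<lambda>i \<eta>. Y i (\<eta> i)) UNIV"
    by (rule P.indep_vars_compose2) (rule assms)
  then have "distr ?P (Pi\<^sub>M UNIV L) (\<lambda>\<eta>. \<lambda>i\<in>UNIV. Y i (\<eta> i)) = Pi\<^sub>M UNIV (\<lambda>i. distr ?P (L i) (\<lambda>\<eta>. Y i (\<eta> i)))"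
    using measurable_compose[OF comp assms] by (subst (asm) P.indep_vars_iff_distr_eq_PiM) auto
  moreover have "distr ?P (L i) (\<lambda>\<eta>. Y i (\<eta> i)) = distr M (L i) (Y i)" for i
  proof -
    have "distr ?P (L i) (\<lambda>\<eta>. Y i (\<eta> i)) = distr (distr ?P M (\<lambda>\<eta>. \<eta> i)) (L i) (Y i)"
      by (subst distr_distr[OF assms comp]) (simp add: comp_def)
    then show ?thesis by (simp add: marg)
  qed
  ultimately show ?thesis by (simp add: restrict_UNIV)
qed

text \<open>The root vector and the functionals of its subtrees are independent, and each subtree
  has the law of a whole tree. The root of one sample and whole trees at further independent samples
  have the same product law, hence the same integrals.\<close>

lemma branching_property:
  assumes \<Phi>[measurable]: "\<Phi> \<in> borel_measurable families"
    and k[measurable]: "k \<in> borel_measurable (generic_vector_space \<Otimes>\<^sub>M Pi\<^sub>M UNIV (\<lambda>_::nat. borel))"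
  shows "(\<integral>\<^sup>+\<omega>. k (nv [] \<omega>, \<lambda>i. \<Phi> (subtree i (family \<omega>)) :: ennreal) \<partial>M)
    = (\<integral>\<^sup>+z. k (nv [] (fst z), \<lambda>i. \<Phi> (family (snd z (Suc i)))) \<partial>copies_space M)"
proof -
  let ?L = "generic_vector_space \<Otimes>\<^sub>M (borel :: ennreal measure)"
  let ?P = "Pi\<^sub>M UNIV (\<lambda>_::nat. M)"
  let ?v0 = "(0, 0, \<lambda>_\<in>{1..}. 0) :: real \<times> enat \<times> (nat \<Rightarrow> real)"
  \<comment> \<open>In both families index 0 carries the root, and padding gives all entries one
    type. All \<open>Y i\<close> are evaluated at one sample, each \<open>Y' i\<close> at a sample
    of its own.\<close>
  define Y where "Y i \<omega> = (case i of 0 \<Rightarrow> (nv [] \<omega>, 0) | Suc j \<Rightarrow> (?v0, \<Phi> (subtree j (family \<omega>))))" for i \<omega>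
  define Y' where "Y' i \<omega> = (case i of 0 \<Rightarrow> (nv [] \<omega>, 0) | Suc j \<Rightarrow> (?v0, \<Phi> (family \<omega>)))" for i :: nat and \<omega>
  have v0: "?v0 \<in> space generic_vector_space"
    by (auto simp: generic_vector_space_def space_pair_measure space_PiM)
  have root: "(\<lambda>\<omega>. (nv [] \<omega>, 0)) \<in> M \<rightarrow>\<^sub>M ?L"
    by (rule measurable_Pair[OF nv_root_measurable measurable_const]) simp
  have \<Phi>1: "(\<lambda>\<omega>. \<Phi> (subtree j (family \<omega>))) \<in> borel_measurable M" for j
    by (rule measurable_compose[OF measurable_compose[OF family_measurable subtree_measurable] \<Phi>])
  have \<Phi>2: "(\<lambda>\<omega>. \<Phi> (family \<omega>)) \<in> borel_measurable M"
    by (rule measurable_compose[OF family_measurable \<Phi>])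
  have Y0: "Y 0 = (\<lambda>\<omega>. (nv [] \<omega>, 0))" "Y' 0 = (\<lambda>\<omega>. (nv [] \<omega>, 0))"
    and YS: "Y (Suc j) = (\<lambda>\<omega>. (?v0, \<Phi> (subtree j (family \<omega>))))" "Y' (Suc j) = (\<lambda>\<omega>. (?v0, \<Phi> (family \<omega>)))" for j
    unfolding Y_def[abs_def] Y'_def[abs_def] by (simp_all only: nat.case)
  have Ym: "Y i \<in> M \<rightarrow>\<^sub>M ?L" for i
    by (cases i) (simp_all only: Y0 YS root measurable_Pair[OF measurable_const[OF v0] \<Phi>1])
  have Y'm: "Y' i \<in> M \<rightarrow>\<^sub>M ?L" for i
    by (cases i) (simp_all only: Y0 YS root measurable_Pair[OF measurable_const[OF v0] \<Phi>2])
  have Y_all: "(\<lambda>\<omega> i. Y i \<omega>) \<in> M \<rightarrow>\<^sub>M Pi\<^sub>M UNIV (\<lambda>_. ?L)"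
    using measurable_restrict[of UNIV Y M "\<lambda>_. ?L"] Ym by (simp add: restrict_UNIV)
  have Y'_all: "(\<lambda>\<eta> i. Y' i (\<eta> i)) \<in> ?P \<rightarrow>\<^sub>M Pi\<^sub>M UNIV (\<lambda>_. ?L)"
  proof -
    have "(\<lambda>\<eta>. Y' i (\<eta> i)) \<in> ?P \<rightarrow>\<^sub>M ?L" for i
      by (rule measurable_compose[OF _ Y'm]) (rule measurable_component_singleton, simp)
    from measurable_restrict[of UNIV "\<lambda>i \<eta>. Y' i (\<eta> i)" ?P "\<lambda>_. ?L", OF this] show ?thesis
      by (simp only: restrict_UNIV)
  qed
  have marg: "distr M ?L (Y i) = distr M ?L (Y' i)" for i
  proof (cases i)
    case (Suc j)
    have m: "(\<lambda>x. (?v0, \<Phi> x)) \<in> families \<rightarrow>\<^sub>M ?L" by (rule measurable_Pair[OF measurable_const[OF v0] \<Phi>])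
    have "distr M ?L (Y i) = distr (distr M families (\<lambda>\<omega>. subtree j (family \<omega>))) ?L (\<lambda>x. (?v0, \<Phi> x))"
      unfolding Suc YS
      by (subst distr_distr[OF m measurable_compose[OF family_measurable subtree_measurable]]) (simp add: comp_def)
    also have "\<dots> = distr (distr M families family) ?L (\<lambda>x. (?v0, \<Phi> x))"
      by (simp only: distr_subtree)
    also have "\<dots> = distr M ?L (Y' i)"
      unfolding Suc YS by (subst distr_distr[OF m]) (simp_all add: comp_def)
    finally show ?thesis .
  qed (simp only: Y0)
  have "indep_vars (\<lambda>_. ?L) Y UNIV"
    unfolding Y_def[abs_def] by (rule independent_blocks[OF \<Phi>])
  then have law: "distr M (Pi\<^sub>M UNIV (\<lambda>_. ?L)) (\<lambda>\<omega> i. Y i \<omega>) = distr ?P (Pi\<^sub>M UNIV (\<lambda>_. ?L)) (\<lambda>\<eta> i. Y' i (\<eta> i))"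
    unfolding indep_vars_coordinates[OF Y'm] marg[symmetric]
    using Ym by (subst (asm) indep_vars_iff_distr_eq_PiM) (auto simp: restrict_UNIV)
  define \<Psi> where "\<Psi> z = k (fst (z 0), \<lambda>i. snd (z (Suc i)))" for z :: "nat \<Rightarrow> (real \<times> enat \<times> (nat \<Rightarrow> real)) \<times> ennreal"
  have comp: "(\<lambda>z. z i) \<in> Pi\<^sub>M UNIV (\<lambda>_::nat. ?L) \<rightarrow>\<^sub>M ?L" for i
    by (rule measurable_component_singleton) simp
  have "(\<lambda>z. \<lambda>i\<in>UNIV. snd (z (Suc i))) \<in> Pi\<^sub>M UNIV (\<lambda>_::nat. ?L) \<rightarrow>\<^sub>M Pi\<^sub>M UNIV (\<lambda>_::nat. borel)"
    by (rule measurable_restrict) (rule measurable_compose[OF comp measurable_snd])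
  then have [measurable]: "\<Psi> \<in> borel_measurable (Pi\<^sub>M UNIV (\<lambda>_. ?L))"
    unfolding \<Psi>_def[abs_def] using measurable_compose[OF comp measurable_fst]
    by (intro measurable_compose[OF measurable_Pair k]) (auto simp: restrict_UNIV)
  have all: "UNIV = insert 0 {1::nat..}" by auto
  \<comment> \<open>The root sample together with the copies numbered from 1 is a sequence numbered
    from 0.\<close>
  have glue: "?P = distr (copies_space M) ?P (\<lambda>z. (snd z)(0 := fst z))"
    unfolding copies_space_def all case_prod_unfold[symmetric]
    using distr_pair_PiM_eq_PiM[of "{1::nat..}" "\<lambda>_. M" 0] prob_space_axioms by (simp add: case_prod_unfold)
  have glue_m: "(\<lambda>z. (snd z)(0 := fst z)) \<in> copies_space M \<rightarrow>\<^sub>M ?P"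
  proof -
    have "(\<lambda>z. (snd z)(0 := fst z)) \<in> M \<Otimes>\<^sub>M (\<Pi>\<^sub>M i\<in>{1::nat..}. M) \<rightarrow>\<^sub>M Pi\<^sub>M (insert 0 {1..}) (\<lambda>_. M)"
      by measurable
    then show ?thesis unfolding copies_space_def all .
  qed
  have "(\<integral>\<^sup>+\<omega>. k (nv [] \<omega>, \<lambda>i. \<Phi> (subtree i (family \<omega>))) \<partial>M) = (\<integral>\<^sup>+\<omega>. \<Psi> (\<lambda>i. Y i \<omega>) \<partial>M)"
    by (simp add: \<Psi>_def Y_def)
  also have "\<dots> = (\<integral>\<^sup>+z. \<Psi> z \<partial>distr M (Pi\<^sub>M UNIV (\<lambda>_. ?L)) (\<lambda>\<omega> i. Y i \<omega>))"
    by (rule nn_integral_distr[symmetric, OF Y_all]) measurable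
  also have "\<dots> = (\<integral>\<^sup>+\<eta>. \<Psi> (\<lambda>i. Y' i (\<eta> i)) \<partial>?P)"
    unfolding law by (rule nn_integral_distr[OF Y'_all]) measurable
  also have "\<dots> = (\<integral>\<^sup>+\<eta>. \<Psi> (\<lambda>i. Y' i (\<eta> i)) \<partial>distr (copies_space M) ?P (\<lambda>z. (snd z)(0 := fst z)))"
    using glue by simp
  also have "\<dots> = (\<integral>\<^sup>+z. \<Psi> (\<lambda>i. Y' i (((snd z)(0 := fst z)) i)) \<partial>copies_space M)"
  proof (rule nn_integral_distr[OF glue_m])
    have "(\<lambda>\<eta>. \<Psi> (\<lambda>i. Y' i (\<eta> i))) \<in> borel_measurable ?P"
      by (rule measurable_compose[OF Y'_all]) measurable
    then show "(\<lambda>\<eta>. \<Psi> (\<lambda>i. Y' i (\<eta> i))) \<in> borel_measurable (distr (copies_space M) ?P (\<lambda>z. (snd z)(0 := fst z)))"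
      by (simp only: measurable_distr_eq1)
  qed
  also have "\<dots> = (\<integral>\<^sup>+z. k (nv [] (fst z), \<lambda>i. \<Phi> (family (snd z (Suc i)))) \<partial>copies_space M)"
    by (simp add: \<Psi>_def Y'_def)
  finally show ?thesis .
qed

end

section \<open>Moments, tail bound and fixed-point law of \<open>tree_max\<close>\<close>

context weighted_branching_tree begin

lemma child_weight_nv_measurable [measurable]: "(\<lambda>\<omega>. child_weight i (nv [] \<omega>)) \<in> borel_measurable M"
  by (rule measurable_compose[OF nv_root_measurable child_weight_measurable])

lemma child_weight_eq:
  "\<omega> \<in> space M \<Longrightarrow> child_weight i (nv [] \<omega>) = (if enat (Suc i) \<le> N [] \<omega> then C [Suc i] \<omega> else 0)"
  using C_nonneg[of "[]" "Suc i" \<omega>] by (simp add: child_weight_def node_vector_def)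

text \<open>F 0 i = 0 lets the zero weights beyond the last child stand for the end of the
  series.\<close>

lemma series_upto_child_weight:
  fixes F :: "real \<Rightarrow> nat \<Rightarrow> 'b::{comm_monoid_add,topological_space}"
  assumes "\<omega> \<in> space M" "\<And>i. F 0 i = 0"
  shows "series_upto (N [] \<omega>) (\<lambda>i. F (C [i] \<omega>) i) = (\<Sum>i. F (child_weight i (nv [] \<omega>)) (Suc i))"
  unfolding series_upto_def by (rule suminf_cong) (simp add: child_weight_eq assms)

text \<open>Each root weight is independent of the subtree functional it multiplies, and the means
  of these functionals agree, so every generation contributes one factor.\<close>

lemma power_functional_moment:
  "(\<integral>\<^sup>+\<omega>. power_functional \<beta> n (family \<omega>) \<partial>M)
    = (\<integral>\<^sup>+\<omega>. (\<Sum>i. ennreal (child_weight i (nv [] \<omega>) powr \<beta>)) \<partial>M) ^ n * (\<integral>\<^sup>+\<omega>. ennreal (Q [] \<omega> powr \<beta>) \<partial>M)"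
proof (induction n)
  case 0
  show ?case by (simp add: family_def node_vector_def)
next
  case (Suc n)
  define k :: "(real \<times> enat \<times> (nat \<Rightarrow> real)) \<times> (nat \<Rightarrow> ennreal) \<Rightarrow> ennreal"
    where "k z = (\<Sum>i. ennreal (child_weight i (fst z) powr \<beta>) * snd z i)" for z
  have [measurable]: "(\<lambda>z. snd z i) \<in> borel_measurable (generic_vector_space \<Otimes>\<^sub>M Pi\<^sub>M UNIV (\<lambda>_::nat. borel :: ennreal measure))" for i
    by (rule measurable_compose[OF measurable_snd]) (rule measurable_component_singleton, simp)
  have k: "k \<in> borel_measurable (generic_vector_space \<Otimes>\<^sub>M Pi\<^sub>M UNIV (\<lambda>_::nat. borel))"
    unfolding k_def[abs_def] by measurable
  define pf where "pf \<omega> = power_functional \<beta> n (family \<omega>)" for \<omega>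
  have pf[measurable]: "pf \<in> borel_measurable M" unfolding pf_def[abs_def] by measurable
  define w where "w i \<omega> = ennreal (child_weight i (nv [] \<omega>) powr \<beta>)" for i \<omega>
  have w[measurable]: "w i \<in> borel_measurable M" for i
    unfolding w_def[abs_def] using child_weight_nv_measurable[of i] by simp
  have "(\<integral>\<^sup>+\<omega>. power_functional \<beta> (Suc n) (family \<omega>) \<partial>M)
      = (\<integral>\<^sup>+\<omega>. k (nv [] \<omega>, \<lambda>i. power_functional \<beta> n (subtree i (family \<omega>))) \<partial>M)"
    by (simp add: k_def family_def)
  also have "\<dots> = (\<integral>\<^sup>+z. k (nv [] (fst z), \<lambda>i. power_functional \<beta> n (family (snd z (Suc i)))) \<partial>copies_space M)"
    by (rule branching_property[OF power_functional_measurable k])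
  also have "\<dots> = (\<integral>\<^sup>+z. (\<Sum>i. w i (fst z) * pf (snd z (Suc i))) \<partial>copies_space M)"
    by (simp add: k_def w_def pf_def)
  also have "\<dots> = (\<Sum>i. \<integral>\<^sup>+z. w i (fst z) * pf (snd z (Suc i)) \<partial>copies_space M)"
    by (rule nn_integral_suminf) measurable
  also have "\<dots> = (\<Sum>i. (\<integral>\<^sup>+\<omega>. w i \<omega> \<partial>M) * (\<integral>\<^sup>+\<omega>. pf \<omega> \<partial>M))"
    by (simp only: nn_integral_copies_mult[OF w pf])
  also have "\<dots> = (\<integral>\<^sup>+\<omega>. (\<Sum>i. w i \<omega>) \<partial>M) * (\<integral>\<^sup>+\<omega>. pf \<omega> \<partial>M)"
    by (simp add: nn_integral_suminf ennreal_suminf_multc)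
  finally show ?case unfolding w_def pf_def Suc by (simp add: mult.assoc)
qed

text \<open>Markov's inequality in each generation and a union bound over the generations. The
  moments decay geometrically, so the sum is a / (1 - f).\<close>

lemma tree_max_tail:
  assumes "0 < \<beta>" and \<phi>: "(\<integral>\<^sup>+\<omega>. (\<Sum>i. ennreal (child_weight i (nv [] \<omega>) powr \<beta>)) \<partial>M) < 1"
    and q: "(\<integral>\<^sup>+\<omega>. ennreal (Q [] \<omega> powr \<beta>) \<partial>M) < \<infinity>"
  shows "\<exists>K. \<forall>v>0. measure M {\<omega> \<in> space M. ennreal v < tree_max Q N C \<omega>} \<le> K * v powr (- \<beta>)"
proof -
  have real_form: "\<exists>f. y = ennreal f \<and> 0 \<le> f \<and> f < 1" if "y < 1" for y
    using that by (cases y) (auto simp: ennreal_less_one_iff)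
  obtain f where f: "(\<integral>\<^sup>+\<omega>. (\<Sum>i. ennreal (child_weight i (nv [] \<omega>) powr \<beta>)) \<partial>M) = ennreal f" "0 \<le> f" "f < 1"
    using real_form[OF \<phi>] by blast
  have real_form': "\<exists>a. y = ennreal a \<and> 0 \<le> a" if "y < \<infinity>" for y :: ennreal
    using that by (cases y) auto
  obtain a where a: "(\<integral>\<^sup>+\<omega>. ennreal (Q [] \<omega> powr \<beta>) \<partial>M) = ennreal a" "0 \<le> a"
    using real_form'[OF q] by blast
  have sum: "(\<Sum>n. \<integral>\<^sup>+\<omega>. power_functional \<beta> n (family \<omega>) \<partial>M) = ennreal (a / (1 - f))"
  proof -
    have "(\<Sum>n. \<integral>\<^sup>+\<omega>. power_functional \<beta> n (family \<omega>) \<partial>M) = (\<Sum>n. ennreal (f ^ n * a))"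
      using f a by (simp add: power_functional_moment ennreal_power ennreal_mult)
    also have "\<dots> = ennreal (\<Sum>n. f ^ n * a)"
      using f a by (intro suminf_ennreal2 summable_mult2 summable_geometric) auto
    also have "(\<Sum>n. f ^ n * a) = a / (1 - f)"
      using f suminf_mult2[OF summable_geometric[of f], of a] by (simp add: suminf_geometric)
    finally show ?thesis .
  qed
  have "measure M {\<omega> \<in> space M. ennreal v < tree_max Q N C \<omega>} \<le> a / (1 - f) * v powr (- \<beta>)" if v: "0 < v" for v
  proof -
    define A where "A n = {\<omega> \<in> space M. ennreal v < level_functional n (family \<omega>)}" for n
    have [measurable]: "A n \<in> sets M" for n unfolding A_def by measurable
    have A_le: "ennreal (v powr \<beta>) * emeasure M (A n) \<le> (\<integral>\<^sup>+\<omega>. power_functional \<beta> n (family \<omega>) \<partial>M)" for n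
    proof -
      have "ennreal (v powr \<beta>) * emeasure M (A n) = (\<integral>\<^sup>+\<omega>. ennreal (v powr \<beta>) * indicator (A n) \<omega> \<partial>M)"
        by (simp add: nn_integral_cmult_indicator)
      also have "\<dots> \<le> (\<integral>\<^sup>+\<omega>. power_functional \<beta> n (family \<omega>) \<partial>M)"
      proof (rule nn_integral_mono)
        fix \<omega>
        show "ennreal (v powr \<beta>) * indicator (A n) \<omega> \<le> power_functional \<beta> n (family \<omega>)"
          using power_functional_ge[OF assms(1) v, of n "family \<omega>"] by (cases "\<omega> \<in> A n") (auto simp: A_def)
      qed
      finally show ?thesis .
    qed
    have "{\<omega> \<in> space M. ennreal v < tree_max Q N C \<omega>} = (\<Union>n. A n)"
      by (auto simp: A_def tree_max_eq tree_functional_def less_SUP_iff)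
    then have "ennreal (v powr \<beta>) * emeasure M {\<omega> \<in> space M. ennreal v < tree_max Q N C \<omega>}
        \<le> ennreal (v powr \<beta>) * (\<Sum>n. emeasure M (A n))"
      by (auto intro!: mult_left_mono emeasure_subadditive_countably)
    also have "\<dots> = (\<Sum>n. ennreal (v powr \<beta>) * emeasure M (A n))" by simp
    also have "\<dots> \<le> ennreal (a / (1 - f))" unfolding sum[symmetric] by (rule suminf_le[OF A_le]) auto
    finally have "ennreal (v powr \<beta> * measure M {\<omega> \<in> space M. ennreal v < tree_max Q N C \<omega>}) \<le> ennreal (a / (1 - f))"
      by (simp add: emeasure_eq_measure ennreal_mult)
    then have "v powr \<beta> * measure M {\<omega> \<in> space M. ennreal v < tree_max Q N C \<omega>} \<le> a / (1 - f)"
      using a f by (simp add: ennreal_le_iff)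
    then have "measure M {\<omega> \<in> space M. ennreal v < tree_max Q N C \<omega>} \<le> a / (1 - f) / v powr \<beta>"
      using v by (subst pos_le_divide_eq) (auto simp: mult.commute)
    then show ?thesis by (simp only: powr_minus divide_inverse)
  qed
  then show ?thesis by blast
qed

text \<open>\<open>tree_functional_rec\<close> holds sample by sample with subtrees of the same
  tree; \<open>branching_property\<close> replaces these by independent trees without changing the
  law.\<close>

lemma tree_max_fixed_point:
  "emeasure M {\<omega> \<in> space M. ennreal v < tree_max Q N C \<omega>} =
    emeasure (copies_space M) {x \<in> space (copies_space M). ennreal v <
      max (SUP i. ennreal (child_weight i (nv [] (fst x))) * tree_max Q N C (snd x (Suc i))) (ennreal (Q [] (fst x)))}"
proof -
  define k :: "(real \<times> enat \<times> (nat \<Rightarrow> real)) \<times> (nat \<Rightarrow> ennreal) \<Rightarrow> ennreal"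
    where "k z = exceeds v (max (SUP i. ennreal (child_weight i (fst z)) * snd z i) (ennreal (fst (fst z))))" for z
  have [measurable]: "(\<lambda>z. snd z i) \<in> borel_measurable (generic_vector_space \<Otimes>\<^sub>M Pi\<^sub>M UNIV (\<lambda>_::nat. borel :: ennreal measure))" for i
    by (rule measurable_compose[OF measurable_snd]) (rule measurable_component_singleton, simp)
  have k: "k \<in> borel_measurable (generic_vector_space \<Otimes>\<^sub>M Pi\<^sub>M UNIV (\<lambda>_::nat. borel))"
    unfolding k_def[abs_def] by measurable
  have Q_meas[measurable]: "Q [] \<in> borel_measurable M"
    using measurable_compose[OF nv_root_measurable measurable_gvs_fst] by (simp add: node_vector_def)
  have copy_space: "snd x (Suc i) \<in> space M" if "x \<in> space (copies_space M)" for x i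
    using measurable_space[OF measurable_copy that] .
  have "emeasure M {\<omega> \<in> space M. ennreal v < tree_max Q N C \<omega>} = (\<integral>\<^sup>+\<omega>. indicator {\<omega> \<in> space M. ennreal v < tree_max Q N C \<omega>} \<omega> \<partial>M)"
    by simp
  also have "\<dots> = (\<integral>\<^sup>+\<omega>. k (nv [] \<omega>, \<lambda>i. tree_functional (subtree i (family \<omega>))) \<partial>M)"
  proof (rule nn_integral_cong)
    fix \<omega> assume \<omega>: "\<omega> \<in> space M"
    have "family \<omega> [] = nv [] \<omega>" by (simp add: family_def)
    then show "indicator {\<omega> \<in> space M. ennreal v < tree_max Q N C \<omega>} \<omega> = k (nv [] \<omega>, \<lambda>i. tree_functional (subtree i (family \<omega>)))"
      using \<omega> tree_functional_rec[of "family \<omega>"] by (simp add: k_def exceeds_def tree_max_eq indicator_def)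
  qed
  also have "\<dots> = (\<integral>\<^sup>+z. k (nv [] (fst z), \<lambda>i. tree_functional (family (snd z (Suc i)))) \<partial>copies_space M)"
    by (rule branching_property[OF tree_functional_measurable k])
  also have "\<dots> = (\<integral>\<^sup>+x. indicator {x \<in> space (copies_space M). ennreal v <
      max (SUP i. ennreal (child_weight i (nv [] (fst x))) * tree_max Q N C (snd x (Suc i))) (ennreal (Q [] (fst x)))} x \<partial>copies_space M)"
  proof (rule nn_integral_cong)
    fix x assume x: "x \<in> space (copies_space M)"
    have "tree_functional (family (snd x (Suc i))) = tree_max Q N C (snd x (Suc i))" for i
      by (rule tree_max_eq[OF copy_space[OF x], symmetric])
    then show "k (nv [] (fst x), \<lambda>i. tree_functional (family (snd x (Suc i)))) = indicator {x \<in> space (copies_space M). ennreal v <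
      max (SUP i. ennreal (child_weight i (nv [] (fst x))) * tree_max Q N C (snd x (Suc i))) (ennreal (Q [] (fst x)))} x"
      using x by (simp add: k_def exceeds_def indicator_def node_vector_def)
  qed
  also have "\<dots> = emeasure (copies_space M) {x \<in> space (copies_space M). ennreal v <
      max (SUP i. ennreal (child_weight i (nv [] (fst x))) * tree_max Q N C (snd x (Suc i))) (ennreal (Q [] (fst x)))}"
    by (rule nn_integral_indicator) measurable
  finally show ?thesis .
qed

end

section \<open>Tail asymptotics on the tree\<close>

text \<open>Finiteness and integrability are part of the conclusion so that \<open>enn2real\<close>
  and the Bochner integrals do not take their default value 0. Differences stand inside the
  integrals because their terms may have infinite integrals.\<close>

theorem theorem5p1:
  fixes M :: "'a measure"
    and Q :: "nat list \<Rightarrow> 'a \<Rightarrow> real"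
    and N :: "nat list \<Rightarrow> 'a \<Rightarrow> enat"
    and C :: "nat list \<Rightarrow> 'a \<Rightarrow> real"
    and \<alpha> :: real
  assumes tree: "weighted_branching_tree M Q N C"
    and Q_pos: "measure M {\<omega> \<in> space M. 0 < Q [] \<omega>} > 0"
    and nonarith: "\<exists>j\<ge>1. measure M {\<omega> \<in> space M. enat j \<le> N [] \<omega> \<and> 0 < C [j] \<omega>} > 0 \<and>
      nonarithmetic (distr (restrict_space M {\<omega> \<in> space M. 0 < C [j] \<omega> \<and> enat j \<le> N [] \<omega>})
        borel (\<lambda>\<omega>. ln (C [j] \<omega>)))"
    and alpha: "0 < \<alpha>"
    and Q_moment: "integrable M (\<lambda>\<omega>. Q [] \<omega> powr \<alpha>)"
    and log_integrable:
      "integrable M (\<lambda>\<omega>. series_upto (N [] \<omega>) (\<lambda>i. C [i] \<omega> powr \<alpha> * ln (C [i] \<omega>)))"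
    and log_pos:
      "0 < (\<integral>\<omega>. series_upto (N [] \<omega>) (\<lambda>i. C [i] \<omega> powr \<alpha> * ln (C [i] \<omega>)) \<partial>M)"
    and sum_one: "(\<integral>\<^sup>+\<omega>. series_upto (N [] \<omega>) (\<lambda>i. ennreal (C [i] \<omega> powr \<alpha>)) \<partial>M) = 1"
    and moment_gt_1: "1 < \<alpha> \<Longrightarrow>
      (\<integral>\<^sup>+\<omega>. ennreal_powr (series_upto (N [] \<omega>) (\<lambda>i. ennreal (C [i] \<omega>))) \<alpha> \<partial>M) < \<infinity>"
    and moment_le_1: "\<alpha> \<le> 1 \<Longrightarrow> \<exists>\<epsilon>. 0 < \<epsilon> \<and> \<epsilon> < 1 \<and>
      (\<integral>\<^sup>+\<omega>. ennreal_powr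
        (series_upto (N [] \<omega>) (\<lambda>i. ennreal (C [i] \<omega> powr (\<alpha> / (1 + \<epsilon>))))) (1 + \<epsilon>) \<partial>M) < \<infinity>"
  shows "\<exists>H::real. 0 \<le> H \<and>
    ((\<lambda>t. t powr \<alpha> * measure M {\<omega> \<in> space M. ennreal t < tree_max Q N C \<omega>}) \<longlongrightarrow> H) at_top \<and>
    (\<forall>v>0. expected_exceedances M Q N C v < \<infinity>) \<and>
    set_integrable lborel {0<..} (\<lambda>v. v powr (\<alpha> - 1) *
      (measure M {\<omega> \<in> space M. ennreal v < tree_max Q N C \<omega>} -
       enn2real (expected_exceedances M Q N C v))) \<and>
    H = 1 / (\<integral>\<omega>. series_upto (N [] \<omega>) (\<lambda>i. C [i] \<omega> powr \<alpha> * ln (C [i] \<omega>)) \<partial>M) *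
      (LINT v:{0<..}|lborel. v powr (\<alpha> - 1) *
        (measure M {\<omega> \<in> space M. ennreal v < tree_max Q N C \<omega>} -
         enn2real (expected_exceedances M Q N C v))) \<and>
    (AE x in copies_space M. max_power Q N C \<alpha> x < \<infinity> \<and> sum_power Q N C \<alpha> x < \<infinity>) \<and>
    integrable (copies_space M)
      (\<lambda>x. enn2real (max_power Q N C \<alpha> x) - enn2real (sum_power Q N C \<alpha> x)) \<and>
    H = (\<integral>x. enn2real (max_power Q N C \<alpha> x) - enn2real (sum_power Q N C \<alpha> x) \<partial>copies_space M) /
      (\<alpha> * (\<integral>\<omega>. series_upto (N [] \<omega>) (\<lambda>i. C [i] \<omega> powr \<alpha> * ln (C [i] \<omega>)) \<partial>M))"
proof -
  interpret weighted_branching_tree M Q N C by (rule tree)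
  have Q_meas: "Q [] \<in> borel_measurable M"
    using measurable_compose[OF nv_root_measurable measurable_gvs_fst] by (simp add: node_vector_def)
  define c where "c i \<omega> = child_weight i (nv [] \<omega>)" for i \<omega>
  \<comment> \<open>Agrees with \<open>Q []\<close> on the space of \<open>M\<close> and is
    nonnegative everywhere.\<close>
  define q where "q \<omega> = max 0 (Q [] \<omega>)" for \<omega>
  have c_meas: "c i \<in> borel_measurable M" for i
    unfolding c_def[abs_def] by (rule child_weight_nv_measurable)
  have c_nonneg: "0 \<le> c i \<omega>" for i \<omega> by (simp add: c_def child_weight_nonneg)
  have c_eq: "c i \<omega> = (if enat (Suc i) \<le> N [] \<omega> then C [Suc i] \<omega> else 0)" if "\<omega> \<in> space M" for i \<omega>
    unfolding c_def by (rule child_weight_eq[OF that])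
  have q_eq: "q \<omega> = Q [] \<omega>" if "\<omega> \<in> space M" for \<omega>
    using Q_nonneg[of "[]" \<omega>] that by (simp add: q_def)
  note series = series_upto_child_weight[folded c_def]
  define \<mu> where "\<mu> = (\<integral>\<omega>. series_upto (N [] \<omega>) (\<lambda>i. C [i] \<omega> powr \<alpha> * ln (C [i] \<omega>)) \<partial>M)"
  have log_series: "series_upto (N [] \<omega>) (\<lambda>i. C [i] \<omega> powr \<alpha> * ln (C [i] \<omega>)) = (\<Sum>i. c i \<omega> powr \<alpha> * ln (c i \<omega>))"
    if "\<omega> \<in> space M" for \<omega>
    by (rule series[OF that, of "\<lambda>x _. x powr \<alpha> * ln x"]) simp
  have pow_series: "series_upto (N [] \<omega>) (\<lambda>i. ennreal (C [i] \<omega> powr \<beta>)) = (\<Sum>i. ennreal (c i \<omega> powr \<beta>))"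
    if "\<omega> \<in> space M" for \<omega> \<beta>
    by (rule series[OF that, of "\<lambda>x _. ennreal (x powr \<beta>)"]) simp
  have lin_series: "series_upto (N [] \<omega>) (\<lambda>i. ennreal (C [i] \<omega>)) = (\<Sum>i. ennreal (c i \<omega> powr 1))"
    if "\<omega> \<in> space M" for \<omega>
    unfolding powr_one[OF c_nonneg] by (rule series[OF that, of "\<lambda>x _. ennreal x"]) simp
  have \<mu>_eq: "\<mu> = (\<integral>\<omega>. (\<Sum>i. c i \<omega> powr \<alpha> * ln (c i \<omega>)) \<partial>M)"
    unfolding \<mu>_def by (rule Bochner_Integration.integral_cong) (simp_all add: log_series)
  obtain \<beta>\<^sub>0 where \<beta>\<^sub>0: "0 < \<beta>\<^sub>0" "\<beta>\<^sub>0 < \<alpha>"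
    and moment: "(\<integral>\<^sup>+\<omega>. ennreal_powr (\<Sum>i. ennreal (c i \<omega> powr \<beta>\<^sub>0)) (\<alpha> / \<beta>\<^sub>0) \<partial>M) < \<infinity>"
  proof (cases "1 < \<alpha>")
    case True
    have eq: "(\<integral>\<^sup>+\<omega>. ennreal_powr (\<Sum>i. ennreal (c i \<omega> powr 1)) (\<alpha> / 1) \<partial>M)
        = (\<integral>\<^sup>+\<omega>. ennreal_powr (series_upto (N [] \<omega>) (\<lambda>i. ennreal (C [i] \<omega>))) \<alpha> \<partial>M)"
      by (rule nn_integral_cong) (simp only: lin_series div_by_1)
    show ?thesis
      by (rule that[OF zero_less_one True]) (unfold eq, rule moment_gt_1[OF True])
  next
    case False
    then have "\<alpha> \<le> 1" by simp
    from moment_le_1[OF this] obtain \<epsilon> where \<epsilon>: "0 < \<epsilon>" "\<epsilon> < 1" and fin: "(\<integral>\<^sup>+\<omega>. ennreal_powr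
        (series_upto (N [] \<omega>) (\<lambda>i. ennreal (C [i] \<omega> powr (\<alpha> / (1 + \<epsilon>))))) (1 + \<epsilon>) \<partial>M) < \<infinity>"
      by blast
    have exponent: "\<alpha> / (\<alpha> / (1 + \<epsilon>)) = 1 + \<epsilon>" using alpha by simp
    have eq: "(\<integral>\<^sup>+\<omega>. ennreal_powr (\<Sum>i. ennreal (c i \<omega> powr (\<alpha> / (1 + \<epsilon>)))) (\<alpha> / (\<alpha> / (1 + \<epsilon>))) \<partial>M)
        = (\<integral>\<^sup>+\<omega>. ennreal_powr (series_upto (N [] \<omega>) (\<lambda>i. ennreal (C [i] \<omega> powr (\<alpha> / (1 + \<epsilon>))))) (1 + \<epsilon>) \<partial>M)"
      unfolding exponent by (rule nn_integral_cong) (simp only: pow_series)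
    have less: "\<alpha> / (1 + \<epsilon>) < \<alpha>" and pos: "0 < \<alpha> / (1 + \<epsilon>)" using alpha \<epsilon> by (simp_all add: divide_less_eq)
    show ?thesis by (rule that[OF pos less]) (unfold eq, rule fin)
  qed
  have sum_one': "(\<integral>\<^sup>+\<omega>. (\<Sum>i. ennreal (c i \<omega> powr \<alpha>)) \<partial>M) = 1"
    unfolding sum_one[symmetric] by (rule nn_integral_cong) (simp only: pow_series)
  have log_int: "integrable M (\<lambda>\<omega>. \<Sum>i. c i \<omega> powr \<alpha> * ln (c i \<omega>))"
    by (rule iffD1[OF Bochner_Integration.integrable_cong[OF refl] log_integrable]) (rule log_series)
  have nonarith': "\<exists>j. \<forall>d>0. \<not> (AE \<omega> in M. 0 < c j \<omega> \<longrightarrow> ln (c j \<omega>) \<in> range (\<lambda>k::int. d * of_int k))"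
  proof -
    obtain j where j: "1 \<le> j" and nonar: "nonarithmetic (distr (restrict_space M {\<omega> \<in> space M. 0 < C [j] \<omega> \<and> enat j \<le> N [] \<omega>})
        borel (\<lambda>\<omega>. ln (C [j] \<omega>)))" (is "nonarithmetic (distr (restrict_space M ?A) borel ?f)")
      using nonarith by blast
    obtain i where i: "j = Suc i" using j by (cases j) auto
    \<comment> \<open>Label j has index i = j - 1, and the truncated weight is positive exactly
      where child j exists and C_j > 0.\<close>
    have A_eq: "?A = {\<omega> \<in> space M. 0 < c i \<omega>}" by (auto simp: c_eq i split: if_splits)
    have A: "?A \<in> sets M" unfolding A_eq using c_meas[of i] by simp
    have f: "?f \<in> borel_measurable (restrict_space M ?A)"
    proof -
      have "(\<lambda>\<omega>. ln (c i \<omega>)) \<in> borel_measurable (restrict_space M ?A)"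
        using c_meas[of i] by (intro measurable_restrict_space1) simp
      moreover have "ln (c i \<omega>) = ?f \<omega>" if "\<omega> \<in> space (restrict_space M ?A)" for \<omega>
        using that by (auto simp: space_restrict_space c_eq i)
      ultimately show ?thesis by (simp cong: measurable_cong)
    qed
    have "\<not> (AE \<omega> in M. 0 < c i \<omega> \<longrightarrow> ln (c i \<omega>) \<in> range (\<lambda>k::int. d * of_int k))" if d: "0 < d" for d
    proof
      define lattice where "lattice = range (\<lambda>k::int. d * of_int k)"
      have lattice: "lattice \<in> sets borel" unfolding lattice_def by (rule sets.countable) auto
      assume "AE \<omega> in M. 0 < c i \<omega> \<longrightarrow> ln (c i \<omega>) \<in> range (\<lambda>k::int. d * of_int k)"
      then have "AE \<omega> in M. \<omega> \<in> ?A \<longrightarrow> ?f \<omega> \<in> lattice"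
        using AE_space by eventually_elim (auto simp: c_eq i lattice_def split: if_splits)
      then have "AE \<omega> in restrict_space M ?A. ?f \<omega> \<in> lattice"
        using A by (subst AE_restrict_space_iff) auto
      then have "AE x in distr (restrict_space M ?A) borel ?f. x \<in> lattice"
        using lattice by (subst AE_distr_iff[OF f]) auto
      then show False using nonar d unfolding nonarithmetic_def lattice_def by blast
    qed
    then show ?thesis by blast
  qed
  interpret random_weights M c \<alpha> \<beta>\<^sub>0
    by unfold_locales (fact c_meas c_nonneg \<beta>\<^sub>0 sum_one' moment log_int log_pos[folded \<mu>_def, unfolded \<mu>_eq] nonarith')+
  have q_moment: "integrable M (\<lambda>\<omega>. q \<omega> powr \<alpha>)"
    by (rule iffD1[OF Bochner_Integration.integrable_cong[OF refl] Q_moment]) (simp add: q_eq)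
  \<comment> \<open>The tail bounds use orders below \<alpha>, and x^\<beta> \<le> 1 + x^\<alpha>
    reduces these to the assumed moment.\<close>
  have Q_moment_le: "(\<integral>\<^sup>+\<omega>. ennreal (Q [] \<omega> powr \<beta>) \<partial>M) < \<infinity>" if "0 < \<beta>" "\<beta> \<le> \<alpha>" for \<beta>
  proof -
    have "(\<integral>\<^sup>+\<omega>. ennreal (Q [] \<omega> powr \<beta>) \<partial>M) \<le> (\<integral>\<^sup>+\<omega>. ennreal (1 + Q [] \<omega> powr \<alpha>) \<partial>M)"
    proof (intro nn_integral_mono ennreal_leI)
      fix \<omega> assume "\<omega> \<in> space M"
      then have Q0: "0 \<le> Q [] \<omega>" by (intro Q_nonneg) auto
      show "Q [] \<omega> powr \<beta> \<le> 1 + Q [] \<omega> powr \<alpha>"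
      proof (cases "Q [] \<omega> \<le> 1")
        case True
        then have "Q [] \<omega> powr \<beta> \<le> 1" using Q0 that by (intro powr_le1) auto
        then show ?thesis by (simp add: add_increasing2)
      next
        case False
        then have "Q [] \<omega> powr \<beta> \<le> Q [] \<omega> powr \<alpha>" using that by (intro powr_mono) auto
        then show ?thesis by simp
      qed
    qed
    also have "\<dots> = ennreal (\<integral>\<omega>. 1 + Q [] \<omega> powr \<alpha> \<partial>M)"
      by (rule nn_integral_eq_integral) (use Q_moment in \<open>auto intro: add_nonneg_nonneg\<close>)
    also have "\<dots> < \<infinity>" by simp
    finally show ?thesis .
  qed
  obtain \<delta>\<^sub>1 where \<delta>\<^sub>1: "0 < \<delta>\<^sub>1" "\<delta>\<^sub>1 \<le> \<alpha> - \<beta>\<^sub>0" "\<And>\<delta>. 0 < \<delta> \<Longrightarrow> \<delta> \<le> \<delta>\<^sub>1 \<Longrightarrow> \<phi> (\<alpha> - \<delta>) < 1"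
    using \<phi>_less_1 by metis
  interpret max_recursion M c \<alpha> \<beta>\<^sub>0 q "tree_max Q N C"
  proof
    show "q \<in> borel_measurable M" unfolding q_def[abs_def] using Q_meas by simp
    show "0 \<le> q \<omega>" for \<omega> by (simp add: q_def)
    show "integrable M (\<lambda>\<omega>. q \<omega> powr \<alpha>)" by (rule q_moment)
    show "tree_max Q N C \<in> borel_measurable M" by (rule tree_max_measurable)
    have "\<exists>K. \<forall>v>0. measure M {\<omega> \<in> space M. ennreal v < tree_max Q N C \<omega>} \<le> K * v powr (- (\<alpha> - \<delta>))"
      if \<delta>: "0 < \<delta>" "\<delta> \<le> \<delta>\<^sub>1" for \<delta>
    proof (rule tree_max_tail)
      show "0 < \<alpha> - \<delta>" using \<delta> \<delta>\<^sub>1 \<beta>\<^sub>0 by simp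
      show "(\<integral>\<^sup>+\<omega>. (\<Sum>i. ennreal (child_weight i (nv [] \<omega>) powr (\<alpha> - \<delta>))) \<partial>M) < 1"
        using \<delta>\<^sub>1(3)[OF \<delta>] by (simp only: \<phi>_def c_def)
      show "(\<integral>\<^sup>+\<omega>. ennreal (Q [] \<omega> powr (\<alpha> - \<delta>)) \<partial>M) < \<infinity>"
        using \<delta> \<delta>\<^sub>1 \<beta>\<^sub>0 by (intro Q_moment_le) auto
    qed
    then show "\<exists>\<delta>\<^sub>1. 0 < \<delta>\<^sub>1 \<and> \<delta>\<^sub>1 \<le> \<alpha> - \<beta>\<^sub>0 \<and> (\<forall>\<delta>. 0 < \<delta> \<and> \<delta> \<le> \<delta>\<^sub>1 \<longrightarrow>
      (\<exists>K. \<forall>v>0. measure M {\<omega> \<in> space M. ennreal v < tree_max Q N C \<omega>} \<le> K * v powr (- (\<alpha> - \<delta>))))"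
      using \<delta>\<^sub>1(1,2) by blast
    fix v :: real
    have "ennreal (q \<omega>) = ennreal (Q [] \<omega>)" for \<omega> by (simp add: q_def ennreal_max_0)
    then show "emeasure M {\<omega> \<in> space M. ennreal v < tree_max Q N C \<omega>} =
      emeasure (copies_space M) {x \<in> space (copies_space M).
        ennreal v < max (SUP i. ennreal (c i (fst x)) * tree_max Q N C (snd x (Suc i))) (ennreal (q (fst x)))}"
      by (simp only: c_def tree_max_fixed_point)
  qed
  have root_space: "fst x \<in> space M" if "x \<in> space (copies_space M)" for x
    using measurable_space[OF measurable_root that] .
  have expected_exceedances_eq: "expected_exceedances M Q N C v = mean_exceedances v" for v
    unfolding expected_exceedances_def mean_exceedances_def
  proof (rule nn_integral_cong)
    fix x assume "x \<in> space (M \<Otimes>\<^sub>M M)"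
    then have "fst x \<in> space M" by (auto simp: space_pair_measure)
    from series[OF this, of "\<lambda>y _. exceeds v (ennreal y * tree_max Q N C (snd x))"]
    show "(case x of (\<omega>, \<omega>') \<Rightarrow> series_upto (N [] \<omega>) (\<lambda>i. indicator {ennreal v<..} (ennreal (C [i] \<omega>) * tree_max Q N C \<omega>')))
        = (case x of (\<omega>, \<omega>') \<Rightarrow> \<Sum>i. exceeds v (ennreal (c i \<omega>) * tree_max Q N C \<omega>'))"
      by (simp add: case_prod_unfold exceeds_def indicator_def of_bool_def)
  qed
  \<comment> \<open>Indices beyond the last child contribute 0, even if their copy is infinite,
    because 0 times infinity is 0 in \<open>ennreal\<close>. The power is monotone and so commutes
    with the maximum.\<close>
  have max_eq: "max_power Q N C \<alpha> x = ennreal_powr (root_max x) \<alpha>" if x: "x \<in> space (copies_space M)" for x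
  proof -
    have \<omega>: "fst x \<in> space M" by (rule root_space[OF x])
    have sup: "(SUP i\<in>{i. 1 \<le> i \<and> enat i \<le> N [] (fst x)}. ennreal (C [i] (fst x)) * tree_max Q N C (snd x i)) = branch_max x"
      unfolding branch_max_def branch_value_def
    proof (rule antisym; rule SUP_least)
      fix i assume i: "i \<in> {i. 1 \<le> i \<and> enat i \<le> N [] (fst x)}"
      then obtain k where k: "i = Suc k" by (cases i) auto
      then have "C [i] (fst x) = c k (fst x)" using i c_eq[OF \<omega>] by simp
      then show "ennreal (C [i] (fst x)) * tree_max Q N C (snd x i) \<le> (SUP i. ennreal (c i (fst x)) * tree_max Q N C (snd x (Suc i)))"
        using k by (auto intro: SUP_upper2[of k])
    next
      fix k
      show "ennreal (c k (fst x)) * tree_max Q N C (snd x (Suc k))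
          \<le> (SUP i\<in>{i. 1 \<le> i \<and> enat i \<le> N [] (fst x)}. ennreal (C [i] (fst x)) * tree_max Q N C (snd x i))"
        using c_eq[OF \<omega>, of k] by (cases "enat (Suc k) \<le> N [] (fst x)") (auto intro: SUP_upper2[of "Suc k"])
    qed
    have "max_power Q N C \<alpha> x = max (ennreal_powr (branch_max x) \<alpha>) (ennreal_powr (ennreal (q (fst x))) \<alpha>)"
      using q_eq[OF \<omega>] Q_nonneg[OF _ \<omega>, of "[]"] by (simp add: max_power_def case_prod_unfold sup ennreal_powr_ennreal del: One_nat_def)
    also have "\<dots> = ennreal_powr (root_max x) \<alpha>"
      unfolding root_max_def using alpha by (intro max_of_mono monoI ennreal_powr_mono) auto
    finally show ?thesis .
  qed
  have sum_eq: "sum_power Q N C \<alpha> x = (\<Sum>i. ennreal_powr (branch_value i x) \<alpha>)" if x: "x \<in> space (copies_space M)" for x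
    using series[OF root_space[OF x], of "\<lambda>y i. ennreal_powr (ennreal y * tree_max Q N C (snd x i)) \<alpha>"] alpha
    by (simp add: sum_power_def case_prod_unfold branch_value_def ennreal_powr_def)
  define H where "H = (LINT v:{0<..}|lborel. v powr (\<alpha> - 1) * tail_defect v) / \<mu>"
  have tail_defect_eq': "measure M {\<omega> \<in> space M. ennreal v < tree_max Q N C \<omega>} - enn2real (expected_exceedances M Q N C v) = tail_defect v" for v
    by (simp add: tail_defect_def tail_prob_def expected_exceedances_eq)
  have lim: "((\<lambda>t. t powr \<alpha> * measure M {\<omega> \<in> space M. ennreal t < tree_max Q N C \<omega>}) \<longlongrightarrow> H) at_top"
    using tail_asymptotics by (simp only: H_def \<mu>_eq tail_prob_def)
  have "0 \<le> H"
    by (rule tendsto_lowerbound[OF lim]) auto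
  moreover have "expected_exceedances M Q N C v < \<infinity>" if "0 < v" for v
    using mean_exceedances_finite[OF that] by (simp only: expected_exceedances_eq)
  moreover have "set_integrable lborel {0<..} (\<lambda>v. v powr (\<alpha> - 1) *
      (measure M {\<omega> \<in> space M. ennreal v < tree_max Q N C \<omega>} - enn2real (expected_exceedances M Q N C v)))"
    unfolding tail_defect_eq' by (rule set_integrable_tail_defect)
  moreover have "H = 1 / \<mu> * (LINT v:{0<..}|lborel. v powr (\<alpha> - 1) *
      (measure M {\<omega> \<in> space M. ennreal v < tree_max Q N C \<omega>} - enn2real (expected_exceedances M Q N C v)))"
    unfolding tail_defect_eq' H_def by simp
  moreover have "AE x in copies_space M. max_power Q N C \<alpha> x < \<infinity> \<and> sum_power Q N C \<alpha> x < \<infinity>"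
    using AE_powers_finite AE_space by eventually_elim (simp only: max_eq sum_eq)
  moreover have "integrable (copies_space M) (\<lambda>x. enn2real (max_power Q N C \<alpha> x) - enn2real (sum_power Q N C \<alpha> x))"
    by (rule iffD2[OF Bochner_Integration.integrable_cong[OF refl] integrable_power_difference]) (simp only: max_eq sum_eq)
  moreover have "H = (\<integral>x. enn2real (max_power Q N C \<alpha> x) - enn2real (sum_power Q N C \<alpha> x) \<partial>copies_space M) / (\<alpha> * \<mu>)"
  proof -
    have "(\<integral>x. enn2real (max_power Q N C \<alpha> x) - enn2real (sum_power Q N C \<alpha> x) \<partial>copies_space M)
        = (\<integral>x. enn2real (ennreal_powr (root_max x) \<alpha>) - enn2real (\<Sum>i. ennreal_powr (branch_value i x) \<alpha>) \<partial>copies_space M)"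
      by (rule Bochner_Integration.integral_cong[OF refl]) (simp only: max_eq sum_eq)
    then show ?thesis unfolding H_def set_integral_tail_defect integral_power_difference by simp
  qed
  ultimately show ?thesis
    using lim unfolding \<mu>_def[symmetric] by blast
qed

end
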